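(* Let $d,n\ge 1$ be integers, let $\lambda_1,\dots,\lambda_n\ge 0$ with $\sum_{i=1}^n\lambda_i=1$, and let $A_1,\dots,A_n\in\mathbb{S}(d,\mathbb{R})_+$. (1) Let $0<q<\frac{d+4}{d+2}$ and $\gamma\ge 0$. Suppose that for each $i=1,\dots,n$, $\mu_i=G_q(0,A_i)$ is the $q$-Gaussian measure (the Gaussian measure when $q=1$) with mean zero and covariance matrix $A_i$. Then the regularized barycenter problem $$\min_{\mu\in\mathcal{P}_2(\mathbb{R}^d)}\ \sum_{i=1}^n\frac12\lambda_i W_2^2(\mu,\mu_i)+\gamma F_q(\mu)$$ has a unique minimizer, which is also a $q$-Gaussian measure (a Gaussian measure when $q=1$) with mean zero and covariance matrix $X\in\mathbb{S}(d,\mathbb{R})_+$ satisfying $$X-\gamma\, m(q,d)\,(\det X)^{\frac{q-1}{2}} I=\sum_{i=1}^n\lambda_i\big(X^{1/2}A_iX^{1/2}\big)^{1/2}.$$ (2) Let $\varphi\in\mathcal{O}(2/(d+2))$. Suppose that for each $i=1,\dots,n$, $\mu_i=G_\varphi(0,A_i)$ is the $\varphi$-exponential measure with mean zero and covariance matrix $A_i$. Then the unregularized barycenter problem $$\min_{\mu\in\mathcal{P}_2(\mathbb{R}^d)}\ \sum_{i=1}^n\frac12\lambda_i W_2^2(\mu,\mu_i)$$ has a unique minimizer, which is also a $\varphi$-exponential measure with mean zero and covariance matrix $X\in\mathbb{S}(d,\mathbb{R})_+$ satisfying $$X=\sum_{i=1}^n\lambda_i\big(X^{1/2}A_iX^{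1/2}\big)^{1/2}.$$
   Context: $\mathbb{S}(d,\mathbb{R})_+$ is the set of real symmetric positive definite $d\times d$ matrices, $I$ is the identity matrix, and $X^{1/2}$ is the symmetric positive definite square root of $X\in\mathbb{S}(d,\mathbb{R})_+$. $\mathcal{P}_2(\mathbb{R}^d)$ is the set of Borel probability measures on $\mathbb{R}^d$ with finite second moment, and $W_2^2(\mu,\nu)=\inf_{\pi}\int|x-y|^2\,\pi(dx,dy)$, the infimum being over all couplings $\pi$ of $\mu$ and $\nu$. **$q$-logarithm, $q$-exponential, entropies.** For $q>0$, $q\ne1$: $\ln_q(t)=\frac{t^{1-q}-1}{1-q}$ for $t>0$ and $\exp_q(t)=\big(\max\{0,1+(1-q)t\}\big)^{\frac1{1-q}}$; for $q=1$, $\ln_1=\ln$ and $\exp_1=\exp$. For an absolutely continuous $\mu=\mu(x)\,dx$, the Tsallis entropy is $F_q(\mu)=\int_{\mathbb{R}^d}\mu(x)\ln_q\mu(x)\,dx=\frac1{1-q}\int_{\mathbb{R}^d}[\mu(x)^{1-q}-1]\mu(x)\,dx$ for $q\neq 1$; for $q=1$, $F_1(\mu)=\int\mu(x)\log\mu(x)\,dx$ is the negative Boltzmann entropy. The convention is $F_q(\mu)=+\infty$ if $\mu$ is not absolutely continuous with respect to Lebesgue measure, and $0\cdot(+\infty)=0$. **$q$-Gaussian measures.** For $0<q<\frac{d+4}{d+2}$, $v\in\mathbb{R}^d$, $V\in\mathbb{S}(d,\mathbb{R})_+$, $G_q(v,V)$ is the probability measure with Lebesgue density $$C_0(q,d)(\det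 V)^{-1/2}\exp_q\Big(-\tfrac12C_1(q,d)\langle x-v,V^{-1}(x-v)\rangle\Big),\qquad C_1(q,d)=\frac{2}{2+(d+2)(1-q)},$$ $$C_0(q,d)=\begin{cases}\dfrac{\Gamma\big(\frac{2-q}{1-q}+\frac d2\big)}{\Gamma\big(\frac{2-q}{1-q}\big)}\Big(\dfrac{(1-q)C_1(q,d)}{2\pi}\Big)^{d/2}&0<q<1,\\[2mm] (2\pi)^{-d/2}&q=1,\\[1mm] \dfrac{\Gamma\big(\frac1{q-1}\big)}{\Gamma\big(\frac1{q-1}-\frac d2\big)}\Big(\dfrac{(q-1)C_1(q,d)}{2\pi}\Big)^{d/2}&1<q<\frac{d+4}{d+2}.\end{cases}$$ It has mean $v$ and covariance matrix $V$; $G_1(v,V)$ is the Gaussian measure $\mathcal{N}(v,V)$. Set $$m(q,d)=\frac{2(2-q)\,C_0(q,d)^{1-q}}{2+(d+2)(1-q)},\qquad\text{so } m(1,d)=1.$$ **$\varphi$-exponential measures.** For an increasing, positive, continuous function $\varphi$ on $(0,\infty)$, let $\ln_\varphi(t)=\int_1^t\frac{ds}{\varphi(s)}$, $l_\varphi=\inf_{t>0}\ln_\varphi(t)$, $L_\varphi=\sup_{t>0}\ln_\varphi(t)$, and let $\exp_\varphi(s)=0$ for $s\le l_\varphi$, $\exp_\varphi(s)=\ln_\varphi^{-1}(s)$ for $s\in(l_\varphi,L_\varphi)$, $\exp_\varphi(s)=\infty$ for $s\ge L_\varphi$. For $a\in\mathbb{R}$, $\mathcal{O}(a)$ is the set of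 all increasing, positive, continuous functions $\varphi$ on $(0,\infty)$ with $\max\{\delta_\varphi,\delta^\varphi\}<a$, where $$\delta_\varphi=\inf\Big\{\delta\in\mathbb{R}:\lim_{s\downarrow0}\tfrac{s^{1+\delta}}{\varphi(s)}\text{ exists}\Big\},\qquad \delta^\varphi=\inf\Big\{\delta\in\mathbb{R}:\lim_{s\uparrow\infty}\tfrac{s^{1+\delta}}{\varphi(s)}=\infty\Big\}.$$ For $\varphi\in\mathcal{O}(2/(d+2))$ it is known that there are constants $\lambda_\varphi,c_\varphi$ (depending only on $\varphi$ and $d$) such that for all $(v,V)\in\mathbb{R}^d\times\mathbb{S}(d,\mathbb{R})_+$ the function $$g_\varphi(v,V)(x)=\exp_\varphi\big(\lambda_\varphi-c_\varphi\langle x-v,V^{-1}(x-v)\rangle\big)(\det V)^{-1/2}$$ is a probability density on $\mathbb{R}^d$ with mean $v$ and covariance matrix $V$; $G_\varphi(v,V)$ denotes the corresponding measure, called the $\varphi$-exponential measure with mean $v$ and covariance matrix $V$. *)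

theory Defs
  imports "HOL-Probability.Probability"
begin

definition spd :: "(real ^ 'n ^ 'n) set" where
  "spd = {V. transpose V = V \<and> (\<forall>x. x \<noteq> 0 \<longrightarrow> 0 < x \<bullet> (V *v x))}"

definition spd_sqrt :: "real ^ 'n ^ 'n \<Rightarrow> real ^ 'n ^ 'n" where
  "spd_sqrt X = (THE S. S \<in> spd \<and> S ** S = X)"

definition P2 :: "(real ^ 'n) measure set" where
  "P2 = {\<mu>. prob_space \<mu> \<and> sets \<mu> = sets borel \<and> integrable \<mu> (\<lambda>x. (norm x)\<^sup>2)}"

definition couplings ::
  "(real ^ 'n) measure \<Rightarrow> (real ^ 'n) measure \<Rightarrow> ((real ^ 'n) \<times> (real ^ 'n)) measure set" where
  "couplings \<mu> \<nu> = {\<pi>. prob_space \<pi> \<and> sets \<pi> = sets (borel \<Otimes>\<^sub>M borel) \<and>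
     distr \<pi> borel fst = \<mu> \<and> distr \<pi> borel snd = \<nu>}"

definition W2_sq :: "(real ^ 'n) measure \<Rightarrow> (real ^ 'n) measure \<Rightarrow> ennreal" where
  "W2_sq \<mu> \<nu> = (INF \<pi> \<in> couplings \<mu> \<nu>. \<integral>\<^sup>+ (x, y). ennreal ((norm (x - y))\<^sup>2) \<partial>\<pi>)"

definition ln_q :: "real \<Rightarrow> real \<Rightarrow> real" where
  "ln_q q t = (if q = 1 then ln t else (t powr (1 - q) - 1) / (1 - q))"

text \<open>For \<open>q > 1\<close> and \<open>1 + (1 - q) * t \<le> 0\<close> the value should be \<open>+\<infinity>\<close>, whereas here it is
  \<open>0 powr _ = 0\<close>. The density of a q-Gaussian only uses \<open>t \<le> 0\<close>, where this does not occur.\<close>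

definition exp_q :: "real \<Rightarrow> real \<Rightarrow> real" where
  "exp_q q t = (if q = 1 then exp t else (max 0 (1 + (1 - q) * t)) powr (1 / (1 - q)))"

text \<open>The integral of the positive part minus that of the negative part. On \<open>P2\<close>, for the range of
  \<open>q\<close> considered here, the negative part of the entropy integrand has finite integral.\<close>

definition ereal_integral :: "'a measure \<Rightarrow> ('a \<Rightarrow> real) \<Rightarrow> ereal" where
  "ereal_integral M f =
     enn2ereal (\<integral>\<^sup>+ x. ennreal (f x) \<partial>M) - enn2ereal (\<integral>\<^sup>+ x. ennreal (- f x) \<partial>M)"

definition tsallis_entropy :: "real \<Rightarrow> (real ^ 'n) measure \<Rightarrow> ereal" where
  "tsallis_entropy q \<mu> =
     (if absolutely_continuous lborel \<mu>
      then ereal_integral lborel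
             (\<lambda>x. enn2real (RN_deriv lborel \<mu> x) * ln_q q (enn2real (RN_deriv lborel \<mu> x)))
      else \<infinity>)"

definition C1 :: "real \<Rightarrow> nat \<Rightarrow> real" where
  "C1 q d = 2 / (2 + (real d + 2) * (1 - q))"

definition C0 :: "real \<Rightarrow> nat \<Rightarrow> real" where
  "C0 q d =
     (if q < 1 then
        Gamma ((2 - q) / (1 - q) + real d / 2) / Gamma ((2 - q) / (1 - q))
          * ((1 - q) * C1 q d / (2 * pi)) powr (real d / 2)
      else if q = 1 then (2 * pi) powr (- (real d / 2))
      else
        Gamma (1 / (q - 1)) / Gamma (1 / (q - 1) - real d / 2)
          * ((q - 1) * C1 q d / (2 * pi)) powr (real d / 2))"

definition q_gaussian :: "real \<Rightarrow> real ^ 'n \<Rightarrow> real ^ 'n ^ 'n \<Rightarrow> (real ^ 'n) measure" where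
  "q_gaussian q v V = density lborel (\<lambda>x. ennreal
     (C0 q CARD('n) * det V powr (- 1 / 2)
       * exp_q q (- (1 / 2) * C1 q CARD('n) * ((x - v) \<bullet> (matrix_inv V *v (x - v))))))"

definition m_const :: "real \<Rightarrow> nat \<Rightarrow> real" where
  "m_const q d = 2 * (2 - q) * C0 q d powr (1 - q) / (2 + (real d + 2) * (1 - q))"

text \<open>A function on \<open>(0, \<infinity>)\<close> is represented by a total function whose values on \<open>(-\<infinity>, 0]\<close> are
  never used.\<close>

definition ln_phi :: "(real \<Rightarrow> real) \<Rightarrow> real \<Rightarrow> real" where
  "ln_phi \<phi> t = (LBINT s = ereal 1..ereal t. 1 / \<phi> s)"

definition l_phi :: "(real \<Rightarrow> real) \<Rightarrow> ereal" where
  "l_phi \<phi> = (INF t \<in> {0<..}. ereal (ln_phi \<phi> t))"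

definition L_phi :: "(real \<Rightarrow> real) \<Rightarrow> ereal" where
  "L_phi \<phi> = (SUP t \<in> {0<..}. ereal (ln_phi \<phi> t))"

definition exp_phi :: "(real \<Rightarrow> real) \<Rightarrow> real \<Rightarrow> ennreal" where
  "exp_phi \<phi> s =
     (if ereal s \<le> l_phi \<phi> then 0
      else if ereal s < L_phi \<phi> then ennreal (the_inv_into {0<..} (ln_phi \<phi>) s)
      else \<infinity>)"

text \<open>The infima are taken in the extended reals, so that the infimum of the empty set is \<open>+\<infinity>\<close>.
  In the first one, the limit is required to be finite: for \<open>\<phi>(s) = s powr q\<close> both numbers then
  equal \<open>q - 1\<close>.\<close>

definition delta_lower :: "(real \<Rightarrow> real) \<Rightarrow> ereal" where
  "delta_lower \<phi> =
     (INF \<delta> \<in> {\<delta>::real. \<exists>L::real. ((\<lambda>s. s powr (1 + \<delta>) / \<phi> s) \<longlongrightarrow> L) (at_right 0)}. ereal \<delta>)"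

definition delta_upper :: "(real \<Rightarrow> real) \<Rightarrow> ereal" where
  "delta_upper \<phi> =
     (INF \<delta> \<in> {\<delta>::real. filterlim (\<lambda>s. s powr (1 + \<delta>) / \<phi> s) at_top at_top}. ereal \<delta>)"

definition O_class :: "real \<Rightarrow> (real \<Rightarrow> real) set" where
  "O_class a = {\<phi>. mono_on {0<..} \<phi> \<and> (\<forall>s>0. 0 < \<phi> s) \<and> continuous_on {0<..} \<phi> \<and>
     max (delta_lower \<phi>) (delta_upper \<phi>) < ereal a}"

definition has_mean_cov :: "(real ^ 'n) measure \<Rightarrow> real ^ 'n \<Rightarrow> real ^ 'n ^ 'n \<Rightarrow> bool" where
  "has_mean_cov \<mu> v V \<longleftrightarrow>
     has_bochner_integral \<mu> (\<lambda>x. x) v \<and>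
     (\<forall>i j. has_bochner_integral \<mu> (\<lambda>x. (x - v) $ i * (x - v) $ j) (V $ i $ j))"

definition phi_measure ::
  "(real \<Rightarrow> real) \<Rightarrow> real \<Rightarrow> real \<Rightarrow> real ^ 'n \<Rightarrow> real ^ 'n ^ 'n \<Rightarrow> (real ^ 'n) measure" where
  "phi_measure \<phi> l c v V = density lborel (\<lambda>x.
     exp_phi \<phi> (l - c * ((x - v) \<bullet> (matrix_inv V *v (x - v)))) * ennreal (det V powr (- 1 / 2)))"

text \<open>The pair \<open>(\<lambda>\<^sub>\<phi>, c\<^sub>\<phi>)\<close>, which depends on \<open>\<phi>\<close> and, through the type argument, on the dimension.
  It is unique: two radial densities \<open>exp\<^sub>\<phi> (\<lambda> - c * |x|\<^sup>2)\<close> for different pairs cross at one radius at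
  most, so they cannot have both the same mass and the same second moment.\<close>

definition phi_consts :: "'n::finite itself \<Rightarrow> (real \<Rightarrow> real) \<Rightarrow> real \<times> real" where
  "phi_consts _ \<phi> = (SOME (l, c). \<forall>(v :: real ^ 'n) (V :: real ^ 'n ^ 'n). V \<in> spd \<longrightarrow>
     prob_space (phi_measure \<phi> l c v V) \<and> has_mean_cov (phi_measure \<phi> l c v V) v V)"

definition phi_exponential ::
  "(real \<Rightarrow> real) \<Rightarrow> real ^ 'n \<Rightarrow> real ^ 'n ^ 'n \<Rightarrow> (real ^ 'n) measure" where
  "phi_exponential \<phi> v V =
     phi_measure \<phi> (fst (phi_consts TYPE('n) \<phi>)) (snd (phi_consts TYPE('n) \<phi>)) v V"

definition barycenter_cost ::
  "nat \<Rightarrow> (nat \<Rightarrow> real) \<Rightarrow> (nat \<Rightarrow> (real ^ 'n) measure) \<Rightarrow> (real ^ 'n) measure \<Rightarrow> ereal" where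
  "barycenter_cost n w \<mu>s \<mu> =
     (\<Sum>i = 1..n. ereal (1 / 2 * w i) * enn2ereal (W2_sq \<mu> (\<mu>s i)))"

definition regularized_cost ::
  "nat \<Rightarrow> (nat \<Rightarrow> real) \<Rightarrow> (nat \<Rightarrow> (real ^ 'n) measure) \<Rightarrow> real \<Rightarrow> real \<Rightarrow>
     (real ^ 'n) measure \<Rightarrow> ereal" where
  "regularized_cost n w \<mu>s q \<gamma> \<mu> = barycenter_cost n w \<mu>s \<mu> + ereal \<gamma> * tsallis_entropy q \<mu>"

end

theory Submission
  imports Defs
begin

text \<open>
  Let \<open>X\<close> solve the matrix equation and let \<open>T\<^sub>i\<close> be the positive definite matrix with
  \<open>T\<^sub>i X T\<^sub>i = A\<^sub>i\<close>. All measures of a given family are images of one rotation invariant measure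
  under \<open>x \<mapsto> V\<^sup>1\<^sup>/\<^sup>2 x\<close>, so \<open>T\<^sub>i\<close> pushes the candidate \<open>\<mu> = G(0, X)\<close> to \<open>\<mu>\<^sub>i\<close>. For positive definite
  \<open>T\<close> there is the identity

  \<open>|x - y|\<^sup>2 = \<langle>x, (I - T) x\<rangle> + \<langle>y, (I - T\<^sup>-\<^sup>1) y\<rangle> + \<langle>y - T x, T\<^sup>-\<^sup>1 (y - T x)\<rangle>\<close>,

  whose last term is nonnegative and vanishes on the graph of \<open>T\<close>. Integrated over a coupling, it is
  Kantorovich duality with quadratic potentials: \<open>W\<^sub>2\<^sup>2(\<nu>, \<mu>\<^sub>i)\<close> is at least the integral of a quadratic
  function of \<open>x\<close> under \<open>\<nu>\<close> plus a constant, with equality at \<open>\<nu> = \<mu>\<close>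
  (\<open>W2_sq_ge_dual_value\<close>, \<open>W2_sq_linear_image\<close>). The equation for \<open>X\<close> says
  \<open>\<Sum>\<^sub>i w\<^sub>i T\<^sub>i = I - k X\<^sup>-\<^sup>1\<close> with \<open>k = \<gamma> m(q,d) (det X)\<^sup>(\<^sup>q\<^sup>-\<^sup>1\<^sup>)\<^sup>/\<^sup>2\<close>, so the transport part of the cost is at
  least \<open>k/2 \<integral>\<langle>x, X\<^sup>-\<^sup>1 x\<rangle> d\<nu>\<close> plus a constant. Without regularization \<open>k = 0\<close>, and \<open>\<mu>\<close> is optimal.

  With regularization, the entropy compensates the quadratic term. The function \<open>t ln\<^sub>q t\<close> is
  convex, and the \<open>q\<close>-logarithm of the density of \<open>\<mu>\<close> is affine in \<open>\<langle>x, X\<^sup>-\<^sup>1 x\<rangle>\<close>. The tangent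
  inequality at that density therefore bounds \<open>F\<^sub>q(\<nu>)\<close> from below by a constant minus a multiple of
  \<open>\<integral>\<langle>x, X\<^sup>-\<^sup>1 x\<rangle> d\<nu>\<close> (\<open>q_gaussian_entropy\<close>), and \<open>m(q,d)\<close> is the constant for which the two multiples
  cancel. Both bounds are equalities at \<open>\<mu>\<close>.

  For uniqueness, let \<open>\<nu>\<close> be another minimizer. Every bound is an equality for \<open>\<nu>\<close>, in particular the
  one for \<open>W\<^sub>2\<^sup>2(\<nu>, \<mu>\<^sub>i)\<close> for some \<open>i\<close> with \<open>w\<^sub>i > 0\<close>. Then the last term of the identity has arbitrarily
  small integral over couplings of \<open>\<nu>\<close> and \<open>\<mu>\<^sub>i\<close>, so the image of \<open>\<nu>\<close> under \<open>T\<^sub>i\<close> is at distance \<open>0\<close> from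
  \<open>\<mu>\<^sub>i\<close>, hence equal to it, and \<open>\<nu> = \<mu>\<close> since \<open>T\<^sub>i\<close> is invertible. These arguments are collected in
  \<open>linear_transport_barycenter\<close>, which covers both parts of the theorem.

  The matrix \<open>X\<close> comes from Brouwer's theorem on an order interval \<open>a I \<le> X \<le> B I\<close>
  (\<open>spd_fixed_point\<close>): the square roots grow like \<open>B\<^sup>1\<^sup>/\<^sup>2\<close> and the determinant term at most like \<open>B\<^sup>\<theta>\<close>
  with \<open>\<theta> < 1\<close>. It remains to see that the families consist of probability measures with finite
  second moment. For \<open>q\<close>-Gaussians this is a computation of radial integrals by Gamma functions. For a
  \<open>\<phi>\<close>-exponential one has to find the pair \<open>(\<lambda>\<^sub>\<phi>, c\<^sub>\<phi>)\<close>: the scale \<open>c\<^sub>\<phi>\<close> normalizes the mass, and the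
  intermediate value theorem provides a \<open>\<lambda>\<^sub>\<phi>\<close> for which the covariance is right as well
  (\<open>excess_ratio_attained\<close>). The two growth conditions on \<open>\<phi>\<close> at \<open>0\<close> and at \<open>\<infinity>\<close> make the moments
  finite and force the relevant ratio of moments to take all positive values.
\<close>

section \<open>Order intervals of symmetric matrices\<close>

lemma inner_symmetric_matrix:
  fixes S :: "real ^ 'n ^ 'n"
  assumes "transpose S = S"
  shows "x \<bullet> (S *v y) = (S *v x) \<bullet> y"
  by (metis assms dot_lmul_matrix transpose_matrix_vector)

lemma scaleR_matrix_vector: "(c *\<^sub>R A) *v x = c *\<^sub>R (A *v (x :: real ^ 'n))"
  by (simp add: scaleR_matrix_vector_assoc)

text \<open>The interval \<open>a I \<le> S \<le> b I\<close> of the Loewner order. These sets are convex and compact, and they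
  exhaust the positive definite matrices, so they serve as domains for Brouwer's theorem.\<close>
definition quad_between :: "real \<Rightarrow> real \<Rightarrow> (real ^ 'n ^ 'n) set" where
  "quad_between a b = {S. transpose S = S \<and>
     (\<forall>x. a * (x \<bullet> x) \<le> x \<bullet> (S *v x) \<and> x \<bullet> (S *v x) \<le> b * (x \<bullet> x))}"

lemma quad_between_spd: "0 < a \<Longrightarrow> S \<in> quad_between a b \<Longrightarrow> S \<in> spd"
  unfolding quad_between_def spd_def
  by (auto intro!: less_le_trans[of 0 "a * (x \<bullet> x)" "x \<bullet> (S *v x)" for x])

lemma spd_quad_between:
  fixes S :: "real ^ 'n ^ 'n"
  assumes "S \<in> spd"
  shows "\<exists>a b. 0 < a \<and> a \<le> b \<and> S \<in> quad_between a b"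
proof -
  let ?f = "\<lambda>x. x \<bullet> (S *v x)"
  have cont: "continuous_on (sphere 0 1) ?f"
    by (intro continuous_intros matrix_vector_mult_linear_continuous_on)
  have ne: "sphere 0 1 \<noteq> ({} :: (real ^ 'n) set)"
    by (simp add: sphere_def) (metis vector_choose_size zero_le_one)
  obtain u where u: "u \<in> sphere 0 1" "\<And>x. x \<in> sphere 0 1 \<Longrightarrow> ?f u \<le> ?f x"
    using continuous_attains_inf[OF compact_sphere ne cont] by blast
  obtain v where v: "v \<in> sphere 0 1" "\<And>x. x \<in> sphere 0 1 \<Longrightarrow> ?f x \<le> ?f v"
    using continuous_attains_sup[OF compact_sphere ne cont] by blast
  have pos: "0 < ?f u"
    using assms u(1) unfolding spd_def by (metis (mono_tags, lifting) mem_Collect_eq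
        mem_sphere_0 norm_zero zero_neq_one)
  have hom: "?f x = (x \<bullet> x) * ?f (x /\<^sub>R norm x)" if "x \<noteq> 0" for x
    using that by (simp add: matrix_vector_mult_scaleR power2_norm_eq_inner[symmetric] power2_eq_square field_simps)
  have "?f u * (x \<bullet> x) \<le> ?f x \<and> ?f x \<le> ?f v * (x \<bullet> x)" for x
  proof (cases "x = 0")
    case False
    then have "x /\<^sub>R norm x \<in> sphere 0 1" by simp
    then have "?f u \<le> ?f (x /\<^sub>R norm x)" "?f (x /\<^sub>R norm x) \<le> ?f v"
      using u(2) v(2) by blast+
    then show ?thesis
      unfolding hom[OF False] by (metis inner_ge_zero mult.commute mult_right_mono)
  qed simp
  then show ?thesis
    using pos u v assms unfolding quad_between_def spd_def by blast
qed

lemma quad_between_subset: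
  "a' \<le> a \<Longrightarrow> b \<le> b' \<Longrightarrow> quad_between a b \<subseteq> quad_between a' b'"
  unfolding quad_between_def
  by (auto intro: order_trans[OF mult_right_mono[of a' a]] order_trans[OF _ mult_right_mono[of b b']])

text \<open>The Cauchy--Schwarz inequality for the positive semidefinite form \<open>\<langle>u, S v\<rangle>\<close>, applied to \<open>x\<close> and
  \<open>S x\<close>.\<close>
lemma quad_between_norm:
  fixes S :: "real ^ 'n ^ 'n"
  assumes S: "S \<in> quad_between 0 b"
  shows "norm (S *v x) \<le> b * norm x"
proof (cases "S *v x = 0")
  case True
  have "0 \<le> x \<bullet> (S *v x)" "x \<bullet> (S *v x) \<le> b * (x \<bullet> x)" using S by (auto simp: quad_between_def)
  then have "0 \<le> b * (x \<bullet> x)" by linarith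
  moreover have "x = 0 \<or> 0 < x \<bullet> x" by simp
  ultimately have "0 \<le> b \<or> x = 0" by (metis zero_le_mult_iff not_le)
  then show ?thesis using True by auto
next
  case False
  define y where "y = S *v x"
  have sym: "u \<bullet> (S *v v) = (S *v u) \<bullet> v" for u v
    using S by (intro inner_symmetric_matrix) (simp add: quad_between_def)
  have up: "u \<bullet> (S *v u) \<le> b * (u \<bullet> u)" and lo: "0 \<le> u \<bullet> (S *v u)" for u
    using S by (auto simp: quad_between_def)
  have "norm x > 0" using False by (auto simp: )
  have b0: "0 \<le> b" using up[of x] lo[of x] \<open>norm x > 0\<close>
    by (metis inner_gt_zero_iff mult_nonneg_nonneg mult_le_cancel_right order.strict_trans1
        not_le order_trans zero_less_norm_iff mult_zero_left)
  define s where "s = norm x"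
  define t where "t = norm y"
  have st: "s > 0" "t > 0" using False by (auto simp: s_def t_def y_def)
  have xx: "x \<bullet> x = s\<^sup>2" "y \<bullet> y = t\<^sup>2" by (auto simp: s_def t_def power2_norm_eq_inner)
  have yx: "y \<bullet> (S *v x) = t\<^sup>2" "x \<bullet> (S *v y) = t\<^sup>2"
    using sym[of x y] by (auto simp: y_def[symmetric] xx)
  have "0 \<le> (t *\<^sub>R x - s *\<^sub>R y) \<bullet> (S *v (t *\<^sub>R x - s *\<^sub>R y))" by (rule lo)
  also have "\<dots> = t\<^sup>2 * (x \<bullet> (S *v x)) + s\<^sup>2 * (y \<bullet> (S *v y)) - 2 * s * t * t\<^sup>2"
    using yx by (simp add: matrix_vector_mult_diff_distrib matrix_vector_mult_scaleR
        inner_diff_left inner_diff_right algebra_simps power2_eq_square)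
  also have "\<dots> \<le> t\<^sup>2 * (b * s\<^sup>2) + s\<^sup>2 * (b * t\<^sup>2) - 2 * s * t * t\<^sup>2"
    using up[of x] up[of y] xx by (intro diff_right_mono add_mono mult_left_mono) auto
  finally have "2 * s * t * t\<^sup>2 \<le> 2 * s * t * (b * s * t)"
    by (simp add: power2_eq_square algebra_simps)
  then have "t\<^sup>2 \<le> b * s * t" using st by simp
  then have "t \<le> b * s" using st by (simp add: power2_eq_square)
  then show ?thesis by (simp add: s_def t_def y_def)
qed

lemma closed_quad_between: "closed (quad_between a b :: (real ^ 'n ^ 'n) set)"
proof -
  have c1: "continuous_on UNIV (\<lambda>S :: real ^ 'n ^ 'n. x \<bullet> (S *v x))" for x :: "real ^ 'n"
    unfolding inner_vec_def matrix_vector_mult_def by (auto intro!: continuous_intros)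
  have c2: "continuous_on UNIV (\<lambda>S :: real ^ 'n ^ 'n. transpose S)"
    unfolding transpose_def by (auto intro!: continuous_intros)
  have eq: "quad_between a b = {S. transpose S = S} \<inter>
      (\<Inter>x. {S. a * (x \<bullet> x) \<le> x \<bullet> (S *v x)} \<inter> {S. x \<bullet> (S *v x) \<le> b * (x \<bullet> x)})"
    unfolding quad_between_def by auto
  have "closed {S :: real ^ 'n ^ 'n. transpose S = S}"
    by (intro closed_Collect_eq c2 continuous_on_id)
  moreover have "closed {S :: real ^ 'n ^ 'n. a * (x \<bullet> x) \<le> x \<bullet> (S *v x)}"
    "closed {S :: real ^ 'n ^ 'n. x \<bullet> (S *v x) \<le> b * (x \<bullet> x)}" for x
    by (intro closed_Collect_le c1 continuous_on_const)+
  ultimately show ?thesis unfolding eq by (intro closed_Int closed_INT ballI)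
qed

lemma quad_between_entry:
  fixes S :: "real ^ 'n ^ 'n"
  assumes "S \<in> quad_between 0 b"
  shows "\<bar>S $ i $ j\<bar> \<le> b"
proof -
  have "S $ i $ j = (S *v axis j 1) $ i"
    by (simp add: matrix_vector_mul_component inner_axis)
  then have "\<bar>S $ i $ j\<bar> \<le> norm (S *v axis j 1)"
    by (metis component_le_norm_cart)
  also have "\<dots> \<le> b * norm (axis j (1::real) :: real ^ 'n)" by (rule quad_between_norm[OF assms])
  finally show ?thesis by simp
qed

lemma compact_quad_between: "0 \<le> a \<Longrightarrow> compact (quad_between a b :: (real ^ 'n ^ 'n) set)"
proof -
  assume "0 \<le> a"
  then have sub: "quad_between a b \<subseteq> (quad_between 0 b :: (real ^ 'n ^ 'n) set)"
    by (rule quad_between_subset) simp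
  have "norm S \<le> (\<Sum>i\<in>(UNIV :: 'n set). \<Sum>j\<in>(UNIV :: 'n set). b)"
    if "S \<in> quad_between a b" for S :: "real ^ 'n ^ 'n"
  proof -
    have "norm S \<le> (\<Sum>i\<in>UNIV. norm (S $ i))"
      unfolding norm_vec_def by (rule L2_set_le_sum) simp
    also have "\<dots> \<le> (\<Sum>i\<in>UNIV. \<Sum>j\<in>UNIV. \<bar>S $ i $ j\<bar>)"
      by (intro sum_mono norm_le_l1_cart)
    also have "\<dots> \<le> (\<Sum>i\<in>(UNIV :: 'n set). \<Sum>j\<in>(UNIV :: 'n set). b)"
      using sub that by (intro sum_mono quad_between_entry) auto
    finally show ?thesis .
  qed
  then have "bounded (quad_between a b :: (real ^ 'n ^ 'n) set)"
    by (rule boundedI)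
  with closed_quad_between show ?thesis by (simp add: compact_eq_bounded_closed)
qed

lemma convex_quad_between: "convex (quad_between a b :: (real ^ 'n ^ 'n) set)"
proof (rule convexI)
  fix S T :: "real ^ 'n ^ 'n" and u v :: real
  assume ST: "S \<in> quad_between a b" "T \<in> quad_between a b" and uv: "0 \<le> u" "0 \<le> v" "u + v = 1"
  have [simp]: "transpose S = S" "transpose T = T" using ST by (auto simp: quad_between_def)
  have "transpose (u *\<^sub>R S + v *\<^sub>R T) = u *\<^sub>R transpose S + v *\<^sub>R transpose T"
    by (simp add: transpose_def vec_eq_iff)
  moreover have "c * (x \<bullet> x) = u * (c * (x \<bullet> x)) + v * (c * (x \<bullet> x))" for c and x :: "real ^ 'n"
    using uv by (metis distrib_right mult_1)
  moreover have "x \<bullet> ((u *\<^sub>R S + v *\<^sub>R T) *v x) = u * (x \<bullet> (S *v x)) + v * (x \<bullet> (T *v x))" for x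
    by (simp add: matrix_vector_mult_add_rdistrib scaleR_matrix_vector inner_add_right)
  moreover have "a * (x \<bullet> x) \<le> x \<bullet> (S *v x)" "x \<bullet> (S *v x) \<le> b * (x \<bullet> x)"
    "a * (x \<bullet> x) \<le> x \<bullet> (T *v x)" "x \<bullet> (T *v x) \<le> b * (x \<bullet> x)" for x
    using ST by (auto simp: quad_between_def)
  ultimately show "u *\<^sub>R S + v *\<^sub>R T \<in> quad_between a b"
    unfolding quad_between_def mem_Collect_eq using uv
    by (metis (no_types, lifting) \<open>transpose S = S\<close> \<open>transpose T = T\<close> add_mono mult_left_mono)
qed

lemma mat_1_quad_between: "a \<le> 1 \<Longrightarrow> 1 \<le> b \<Longrightarrow> mat 1 \<in> quad_between a b"
  unfolding quad_between_def
  using mult_right_mono[of a 1] mult_right_mono[of 1 b] by (auto simp: transpose_mat)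

lemma continuous_on_matrix_mult [continuous_intros]:
  fixes f g :: "'a::topological_space \<Rightarrow> real ^ 'n ^ 'n"
  assumes "continuous_on U f" "continuous_on U g"
  shows "continuous_on U (\<lambda>x. f x ** g x)"
  unfolding matrix_matrix_mult_def by (intro continuous_intros assms)

section \<open>Square roots of positive definite matrices\<close>

lemma matrix_add_rdistrib': "(A + B) ** C = A ** C + B ** (C :: real ^ 'n ^ 'n)"
  by (simp add: matrix_matrix_mult_def vec_eq_iff sum.distrib algebra_simps)

lemma matrix_diff_ldistrib: "A ** (B - C) = A ** B - A ** (C :: real ^ 'n ^ 'n)"
  by (simp add: matrix_matrix_mult_def vec_eq_iff sum_subtractf algebra_simps)

lemma matrix_diff_rdistrib: "(A - B) ** C = A ** C - B ** (C :: real ^ 'n ^ 'n)"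
  by (simp add: matrix_matrix_mult_def vec_eq_iff sum_subtractf algebra_simps)

text \<open>After scaling, \<open>X = I - B\<close> with \<open>0 \<le> B < I\<close>, and \<open>I - Y\<close> is a square root of \<open>X\<close> if and only if
  \<open>Y = (B + Y\<^sup>2) / 2\<close>. The right-hand side maps \<open>{0 \<le> Y \<le> r I}\<close> to itself when \<open>r\<close> is the smaller root of
  the corresponding scalar equation, so Brouwer's theorem applies. The bounds on the root are read
  off from \<open>0 \<le> Y \<le> r I\<close>.\<close>
lemma spd_sqrt_exists:
  fixes X :: "real ^ 'n ^ 'n"
  assumes X: "X \<in> quad_between a b" and a: "0 < a" "a \<le> b"
  shows "\<exists>S \<in> quad_between (sqrt a) (sqrt b). S ** S = X"
proof -
  define B where "B = mat 1 - (1 / b) *\<^sub>R X"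
  define r where "r = 1 - sqrt (a / b)"
  have b: "0 < b" using a by linarith
  have r: "0 \<le> r" "r < 1" using a b by (auto simp: r_def)
  have req: "(1 - a / b) + r\<^sup>2 = 2 * r"
    using a b by (simp add: r_def power2_diff)
  have tX: "transpose X = X" and lo: "a * (x \<bullet> x) \<le> x \<bullet> (X *v x)" and up: "x \<bullet> (X *v x) \<le> b * (x \<bullet> x)" for x
    using X by (auto simp: quad_between_def)
  have tB: "transpose B = B"
    using tX by (auto simp add: B_def transpose_def vec_eq_iff mat_def)
  have Bx: "x \<bullet> (B *v x) = x \<bullet> x - (1/b) * (x \<bullet> (X *v x))" for x
    by (simp add: B_def matrix_vector_mult_diff_rdistrib scaleR_matrix_vector inner_diff_right)
  have B: "0 \<le> x \<bullet> (B *v x)" "x \<bullet> (B *v x) \<le> (1 - a / b) * (x \<bullet> x)" for x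
    using lo[of x] up[of x] b unfolding Bx by (auto simp: field_simps)
  let ?f = "\<lambda>Y. (1/2) *\<^sub>R (B + Y ** Y)"
  obtain Y where Y: "Y \<in> quad_between 0 r" "?f Y = Y"
  proof (rule brouwer[of "quad_between 0 r" ?f])
    show "compact (quad_between 0 r :: (real ^ 'n ^ 'n) set)" by (rule compact_quad_between) simp
    show "convex (quad_between 0 r :: (real ^ 'n ^ 'n) set)" by (rule convex_quad_between)
    have "(0 :: real ^ 'n ^ 'n) \<in> quad_between 0 r"
      using r by (auto simp: quad_between_def transpose_def vec_eq_iff)
    then show "quad_between 0 r \<noteq> ({} :: (real ^ 'n ^ 'n) set)" by blast
    show "continuous_on (quad_between 0 r) ?f" by (intro continuous_intros)
    show "?f \<in> quad_between 0 r \<rightarrow> quad_between 0 r"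
    proof
      fix Y :: "real ^ 'n ^ 'n" assume Y: "Y \<in> quad_between 0 r"
      then have tY: "transpose Y = Y" by (simp add: quad_between_def)
      have "transpose (?f Y) = (1/2) *\<^sub>R (transpose B + transpose (Y ** Y))"
        by (simp add: transpose_def vec_eq_iff)
      then have t: "transpose (?f Y) = ?f Y" by (simp add: matrix_transpose_mul tY tB)
      have YY: "x \<bullet> ((Y ** Y) *v x) = (norm (Y *v x))\<^sup>2" for x
        using inner_symmetric_matrix[OF tY, of x "Y *v x"]
        by (simp add: matrix_vector_mul_assoc power2_norm_eq_inner)
      have YY2: "(norm (Y *v x))\<^sup>2 \<le> r\<^sup>2 * (x \<bullet> x)" for x
        using power_mono[OF quad_between_norm[OF Y, of x], of 2]
        by (simp add: power_mult_distrib power2_norm_eq_inner)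
      have q: "x \<bullet> (?f Y *v x) = (1/2) * (x \<bullet> (B *v x) + (norm (Y *v x))\<^sup>2)" for x
        by (simp only: scaleR_matrix_vector matrix_vector_mult_add_rdistrib inner_scaleR_right inner_add_right YY)
      have "x \<bullet> (?f Y *v x) \<le> r * (x \<bullet> x)" for x
      proof -
        have "x \<bullet> (?f Y *v x) \<le> (1/2) * (((1 - a / b) + r\<^sup>2) * (x \<bullet> x))"
          unfolding q using B(2)[of x] YY2[of x] by (simp add: algebra_simps)
        also have "\<dots> = r * (x \<bullet> x)" unfolding req by simp
        finally show ?thesis .
      qed
      moreover have "0 \<le> x \<bullet> (?f Y *v x)" for x unfolding q using B(1)[of x] by simp
      ultimately show "?f Y \<in> quad_between 0 r" using t by (simp add: quad_between_def)
    qed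
  qed
  have Y2: "Y ** Y = 2 *\<^sub>R Y - B"
    using arg_cong[OF Y(2), of "\<lambda>Z. 2 *\<^sub>R Z"] by (simp add: algebra_simps)
  define S where "S = sqrt b *\<^sub>R (mat 1 - Y)"
  have mult: "(mat 1 - Y) ** (mat 1 - Y) = mat 1 - 2 *\<^sub>R Y + Y ** Y"
    by (simp add: matrix_diff_ldistrib matrix_diff_rdistrib scaleR_2)
  have "S ** S = b *\<^sub>R (mat 1 - 2 *\<^sub>R Y + Y ** Y)"
    using b unfolding S_def mult[symmetric]
    by (simp add: matrix_scalar_ac scalar_matrix_assoc[symmetric])
  also have "\<dots> = b *\<^sub>R (mat 1 - B)" by (simp add: Y2)
  also have "\<dots> = X" using b by (simp add: B_def)
  finally have SS: "S ** S = X" .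
  have tY: "transpose Y = Y" and Yq: "0 \<le> x \<bullet> (Y *v x)" "x \<bullet> (Y *v x) \<le> r * (x \<bullet> x)" for x
    using Y(1) by (auto simp: quad_between_def)
  have "transpose S = sqrt b *\<^sub>R (mat 1 - transpose Y)"
    by (simp add: S_def transpose_def vec_eq_iff mat_def)
  then have tS: "transpose S = S" by (simp add: tY S_def)
  have q: "x \<bullet> (S *v x) = sqrt b * (x \<bullet> x - x \<bullet> (Y *v x))" for x
    by (simp add: S_def matrix_vector_mult_diff_rdistrib scaleR_matrix_vector inner_diff_right)
  have "sqrt a * (x \<bullet> x) \<le> x \<bullet> (S *v x)" for x
  proof -
    have "sqrt a * (x \<bullet> x) = sqrt b * (x \<bullet> x - r * (x \<bullet> x))"
      using a b by (simp add: r_def real_sqrt_divide algebra_simps)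
    also have "\<dots> \<le> x \<bullet> (S *v x)"
      unfolding q using b Yq(2)[of x] by (intro mult_left_mono) auto
    finally show ?thesis .
  qed
  moreover have "x \<bullet> (S *v x) \<le> sqrt b * (x \<bullet> x)" for x
    unfolding q using b Yq(1)[of x] by (intro mult_left_mono) auto
  ultimately have "S \<in> quad_between (sqrt a) (sqrt b)" using tS by (simp add: quad_between_def)
  then show ?thesis using SS by blast
qed

lemma trace_congruence_eq_sum:
  "trace (D ** S ** D) = (\<Sum>i\<in>UNIV. (transpose D *v axis i 1) \<bullet> (S *v (D *v axis i 1)))"
  for D S :: "real ^ 'n ^ 'n"
proof -
  have "(D ** S ** D) $ i $ i = axis i 1 \<bullet> ((D ** S ** D) *v axis i 1)" for i
    by (simp add: inner_axis' matrix_vector_mul_component inner_axis)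
  also have "\<dots> i = (transpose D *v axis i 1) \<bullet> (S *v (D *v axis i 1))" for i
    by (simp add: matrix_vector_mul_assoc[symmetric] dot_lmul_matrix)
  finally show ?thesis by (simp add: trace_def)
qed

text \<open>For \<open>D = S - T\<close> the equation \<open>S\<^sup>2 = T\<^sup>2\<close> says \<open>S D + D T = 0\<close>. Multiplying by \<open>D\<close> and taking the
  trace gives a sum of values of the two quadratic forms at the columns of \<open>D\<close>.\<close>
lemma spd_sqrt_unique:
  fixes S T :: "real ^ 'n ^ 'n"
  assumes S: "S \<in> spd" and T: "T \<in> spd" and eq: "S ** S = T ** T"
  shows "S = T"
proof -
  define D where "D = S - T"
  have tS: "transpose S = S" and tT: "transpose T = T" using S T by (auto simp: spd_def)
  have "transpose D = transpose S - transpose T" by (simp add: D_def transpose_def vec_eq_iff)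
  then have tD: "transpose D = D" by (simp add: tS tT D_def)
  have "S ** D + D ** T = 0"
    using eq by (simp add: D_def matrix_diff_ldistrib matrix_diff_rdistrib)
  then have "D ** (S ** D + D ** T) = 0" by simp
  then have "D ** S ** D + D ** (D ** T) = 0"
    by (simp add: matrix_add_ldistrib matrix_mul_assoc)
  then have "trace (D ** S ** D) + trace (D ** (D ** T)) = 0"
    by (metis trace_add trace_0 mat_0 trace_def sum.neutral zero_index)
  moreover have "trace (D ** (D ** T)) = trace (D ** T ** D)" by (rule trace_mul_sym)
  ultimately have "(\<Sum>i\<in>UNIV. (D *v axis i 1) \<bullet> (S *v (D *v axis i 1)) + (D *v axis i 1) \<bullet> (T *v (D *v axis i 1))) = 0"
    by (simp add: trace_congruence_eq_sum tD sum.distrib)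
  moreover have nn: "0 \<le> x \<bullet> (S *v x)" "0 \<le> x \<bullet> (T *v x)" for x
    using S T by (cases "x = 0"; force simp: spd_def)+
  ultimately have z: "(D *v axis i 1) \<bullet> (S *v (D *v axis i 1)) + (D *v axis i 1) \<bullet> (T *v (D *v axis i 1)) = 0" for i
    by (subst (asm) sum_nonneg_eq_0_iff) (auto intro: add_nonneg_nonneg)
  have "D *v axis i 1 = 0" for i
  proof (rule ccontr)
    assume "D *v axis i 1 \<noteq> 0"
    then have "0 < (D *v axis i 1) \<bullet> (S *v (D *v axis i 1))" using S by (simp add: spd_def)
    with z[of i] nn(2)[of "D *v axis i 1"] show False by linarith
  qed
  then have "D = 0"
    by (metis matrix_eq matrix_vector_mult_basis matrix_vector_mult_0 column_def vec_eq_iff vec_lambda_beta zero_index)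
  then show ?thesis by (simp add: D_def)
qed

lemma spd_sqrt_eqI:
  assumes "S \<in> spd" "S ** S = X"
  shows "spd_sqrt X = S"
  unfolding spd_sqrt_def using assms spd_sqrt_unique by (intro the_equality) auto

lemma spd_sqrt_between:
  assumes "X \<in> quad_between a b" "0 < a" "a \<le> b"
  shows "spd_sqrt X \<in> quad_between (sqrt a) (sqrt b)"
  using spd_sqrt_exists[OF assms] quad_between_spd[of "sqrt a"] spd_sqrt_eqI assms(2)
  by (metis real_sqrt_gt_0_iff)

lemma spd_sqrt:
  assumes "X \<in> spd"
  shows spd_sqrt_spd: "spd_sqrt X \<in> spd" and spd_sqrt_square: "spd_sqrt X ** spd_sqrt X = X"
proof -
  obtain a b where "0 < a" "a \<le> b" "X \<in> quad_between a b"
    using spd_quad_between[OF assms] by blast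
  then obtain S where "S \<in> quad_between (sqrt a) (sqrt b)" "S ** S = X" "S \<in> spd"
    using spd_sqrt_exists quad_between_spd[of "sqrt a"] by (metis real_sqrt_gt_0_iff)
  then show "spd_sqrt X \<in> spd" "spd_sqrt X ** spd_sqrt X = X"
    using spd_sqrt_eqI by metis+
qed

text \<open>The square root is the inverse of the continuous injection \<open>S \<mapsto> S\<^sup>2\<close> on a compact set.\<close>
lemma continuous_on_spd_sqrt:
  assumes "0 < a" "a \<le> b"
  shows "continuous_on (quad_between a b :: (real ^ 'n ^ 'n) set) spd_sqrt"
proof -
  let ?K = "quad_between (sqrt a) (sqrt b) :: (real ^ 'n ^ 'n) set"
  have spd: "?K \<subseteq> spd" using quad_between_spd[of "sqrt a"] assms by auto
  have "continuous_on ((\<lambda>S. S ** S) ` ?K) spd_sqrt"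
  proof (rule continuous_on_inv)
    show "continuous_on ?K (\<lambda>S. S ** S)" by (intro continuous_intros)
    show "compact ?K" using assms by (intro compact_quad_between) simp
    show "\<forall>S\<in>?K. spd_sqrt (S ** S) = S" using spd by (auto intro: spd_sqrt_eqI)
  qed
  moreover have "quad_between a b \<subseteq> (\<lambda>S. S ** S) ` ?K"
    using spd_sqrt_exists assms by (metis (no_types, lifting) image_eqI subsetI)
  ultimately show ?thesis by (rule continuous_on_subset)
qed

section \<open>Congruences, inverses and determinants\<close>

lemma matrix_inv_mult:
  assumes "invertible (A :: real ^ 'n ^ 'n)"
  shows matrix_inv_right: "A ** matrix_inv A = mat 1" and matrix_inv_left: "matrix_inv A ** A = mat 1"
proof -
  have "A ** matrix_inv A = mat 1 \<and> matrix_inv A ** A = mat 1"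
    unfolding matrix_inv_def by (rule someI_ex) (use assms in \<open>auto simp: invertible_def\<close>)
  then show "A ** matrix_inv A = mat 1" "matrix_inv A ** A = mat 1" by auto
qed

lemma matrix_inv_eqI:
  fixes A B :: "real ^ 'n ^ 'n"
  assumes "A ** B = mat 1"
  shows "matrix_inv A = B"
proof -
  have "B ** A = mat 1" using assms matrix_left_right_inverse by blast
  then have "invertible A" using assms invertible_def by blast
  then have "matrix_inv A = matrix_inv A ** (A ** B)" using assms by simp
  also have "\<dots> = B" using matrix_inv_left[OF \<open>invertible A\<close>] by (simp add: matrix_mul_assoc)
  finally show ?thesis .
qed

lemma spd_invertible:
  assumes "(V :: real ^ 'n ^ 'n) \<in> spd"
  shows "invertible V"
proof -
  have "\<forall>x. V *v x = 0 \<longrightarrow> x = 0"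
    using assms unfolding spd_def by (metis (mono_tags, lifting) inner_zero_right mem_Collect_eq less_irrefl)
  then show ?thesis
    by (simp add: invertible_left_inverse matrix_left_invertible_ker)
qed

lemma spd_matrix_inv:
  assumes V: "(V :: real ^ 'n ^ 'n) \<in> spd"
  shows "matrix_inv V \<in> spd"
proof -
  note inv = matrix_inv_right[OF spd_invertible[OF V]] matrix_inv_left[OF spd_invertible[OF V]]
  have tV: "transpose V = V" using V by (simp add: spd_def)
  have "transpose (matrix_inv V ** V) = mat 1" using inv by (simp add: transpose_mat)
  then have "V ** transpose (matrix_inv V) = mat 1" by (simp add: matrix_transpose_mul tV)
  then have t: "transpose (matrix_inv V) = matrix_inv V" by (metis matrix_inv_eqI)
  have "0 < x \<bullet> (matrix_inv V *v x)" if "x \<noteq> 0" for x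
  proof -
    define y where "y = matrix_inv V *v x"
    have x: "V *v y = x" by (simp add: y_def matrix_vector_mul_assoc inv)
    then have "y \<noteq> 0" using that by auto
    then have "0 < y \<bullet> (V *v y)" using V by (simp add: spd_def)
    then show ?thesis unfolding x by (simp add: y_def inner_commute)
  qed
  then show ?thesis using t by (simp add: spd_def)
qed

lemma spd_congruence:
  fixes S A :: "real ^ 'n ^ 'n"
  assumes S: "S \<in> spd" and A: "A \<in> spd"
  shows "S ** A ** S \<in> spd"
proof -
  have t: "transpose S = S" "transpose A = A" using assms by (auto simp: spd_def)
  have q: "x \<bullet> ((S ** A ** S) *v x) = (S *v x) \<bullet> (A *v (S *v x))" for x
    using inner_symmetric_matrix[OF t(1)] by (simp add: matrix_vector_mul_assoc[symmetric])
  have "S *v x \<noteq> 0" if "x \<noteq> 0" for x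
    using S that unfolding spd_def by (metis (mono_tags, lifting) inner_zero_right mem_Collect_eq less_irrefl)
  then show ?thesis
    using A by (simp add: spd_def q) (simp add: matrix_transpose_mul t matrix_mul_assoc)
qed

lemma sqrt_congruence_between:
  fixes X A :: "real ^ 'n ^ 'n"
  assumes X: "X \<in> quad_between a b" and A: "A \<in> quad_between a' b'" and pos: "0 < a" "0 < a'" "a' \<le> b'"
  shows "spd_sqrt X ** A ** spd_sqrt X \<in> quad_between (a' * a) (b' * b)"
proof -
  define S where "S = spd_sqrt X"
  have Xs: "X \<in> spd" using X pos quad_between_spd by blast
  have tS: "transpose S = S" and SS: "S ** S = X" using spd_sqrt[OF Xs] by (auto simp: S_def spd_def)
  have tA: "transpose A = A" using A by (simp add: quad_between_def)
  have q: "x \<bullet> ((S ** A ** S) *v x) = (S *v x) \<bullet> (A *v (S *v x))" for x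
    using inner_symmetric_matrix[OF tS] by (simp add: matrix_vector_mul_assoc[symmetric])
  have Sx: "(S *v x) \<bullet> (S *v x) = x \<bullet> (X *v x)" for x
    using inner_symmetric_matrix[OF tS] by (simp add: matrix_vector_mul_assoc[symmetric] SS[symmetric])
  have "a' * a * (x \<bullet> x) \<le> x \<bullet> ((S ** A ** S) *v x) \<and> x \<bullet> ((S ** A ** S) *v x) \<le> b' * b * (x \<bullet> x)" for x
  proof
    have "a' * (a * (x \<bullet> x)) \<le> a' * (x \<bullet> (X *v x))"
      using X pos by (intro mult_left_mono) (auto simp: quad_between_def)
    also have "\<dots> \<le> (S *v x) \<bullet> (A *v (S *v x))"
      using A by (auto simp: quad_between_def Sx[symmetric])
    finally show "a' * a * (x \<bullet> x) \<le> x \<bullet> ((S ** A ** S) *v x)" by (simp add: q mult.assoc)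
    have "(S *v x) \<bullet> (A *v (S *v x)) \<le> b' * (x \<bullet> (X *v x))"
      using A by (auto simp: quad_between_def Sx[symmetric])
    also have "\<dots> \<le> b' * (b * (x \<bullet> x))"
      using X pos by (intro mult_left_mono) (auto simp: quad_between_def)
    finally show "x \<bullet> ((S ** A ** S) *v x) \<le> b' * b * (x \<bullet> x)" by (simp add: q mult.assoc)
  qed
  then show ?thesis
    by (simp add: quad_between_def S_def[symmetric] matrix_transpose_mul tS tA matrix_mul_assoc)
qed

lemma spd_det_pos:
  assumes "(V :: real ^ 'n ^ 'n) \<in> spd"
  shows "0 < det V"
proof -
  have "det V = (det (spd_sqrt V))\<^sup>2"
    using spd_sqrt_square[OF assms] by (metis det_mul power2_eq_square)
  moreover have "det V \<noteq> 0" using spd_invertible[OF assms] invertible_det_nz by blast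
  ultimately show ?thesis by (metis zero_less_power2 zero_power2)
qed

lemma continuous_on_det [continuous_intros]:
  fixes f :: "'a::topological_space \<Rightarrow> real ^ 'n ^ 'n"
  assumes "continuous_on U f"
  shows "continuous_on U (\<lambda>x. det (f x))"
  unfolding det_def by (intro continuous_intros assms)

lemma det_scaleR: "det (c *\<^sub>R A) = c ^ CARD('n) * det (A :: real ^ 'n ^ 'n)"
proof -
  have "c *\<^sub>R A = (\<chi> i. c *s (A $ i))" by (simp add: vec_eq_iff)
  then have "det (c *\<^sub>R A) = (\<Prod>i\<in>(UNIV :: 'n set). c) * det (\<chi> i. A $ i)"
    using det_rows_mul[of "\<lambda>_. c" "\<lambda>i. A $ i"] by simp
  then show ?thesis by simp
qed

text \<open>By homogeneity both bounds reduce to the maximum \<open>C\<close> of the determinant on the compact set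
  \<open>{0 \<le> X \<le> I}\<close>; the lower one is the upper one for \<open>X\<^sup>-\<^sup>1 \<le> (1 / a) I\<close>.\<close>
lemma det_bounds:
  "\<exists>C>0. (\<forall>b>0. \<forall>X \<in> (quad_between 0 b :: (real ^ 'n ^ 'n) set). det X \<le> C * b ^ CARD('n)) \<and>
     (\<forall>a>0. \<forall>b. \<forall>X \<in> (quad_between a b :: (real ^ 'n ^ 'n) set). a ^ CARD('n) / C \<le> det X)"
proof -
  have ne: "mat 1 \<in> (quad_between 0 1 :: (real ^ 'n ^ 'n) set)" by (rule mat_1_quad_between) auto
  have cont: "continuous_on (quad_between 0 1 :: (real ^ 'n ^ 'n) set) (\<lambda>X. det X)"
    by (intro continuous_intros)
  have ne': "quad_between 0 1 \<noteq> ({} :: (real ^ 'n ^ 'n) set)" using ne by blast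
  have "\<exists>M\<in>(quad_between 0 1 :: (real ^ 'n ^ 'n) set). \<forall>X\<in>(quad_between 0 1 :: (real ^ 'n ^ 'n) set). det X \<le> det M"
    by (rule continuous_attains_sup[OF compact_quad_between[OF order_refl] ne' cont])
  then obtain M :: "real ^ 'n ^ 'n" where M0: "\<forall>X\<in>(quad_between 0 1 :: (real ^ 'n ^ 'n) set). det X \<le> det M"
    by (rule bexE)
  define C where "C = det M"
  have M: "X \<in> quad_between 0 1 \<Longrightarrow> det X \<le> C" for X :: "real ^ 'n ^ 'n"
    using M0 by (simp add: C_def)
  have C: "0 < C" using M[OF ne] by simp
  have up: "det X \<le> C * b ^ CARD('n)" if "0 < b" "X \<in> quad_between 0 b" for b and X :: "real ^ 'n ^ 'n"
  proof -
    have "transpose ((1 / b) *\<^sub>R X) = (1 / b) *\<^sub>R transpose X"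
      by (simp add: transpose_def vec_eq_iff)
    then have "(1 / b) *\<^sub>R X \<in> quad_between 0 1"
      using that by (simp add: quad_between_def scaleR_matrix_vector pos_divide_le_eq mult.commute)
    then have "det ((1 / b) *\<^sub>R X) \<le> C" by (rule M)
    then show ?thesis using that by (simp add: det_scaleR power_divide field_simps)
  qed
  have "a ^ CARD('n) / C \<le> det X" if a: "0 < a" and X: "X \<in> quad_between a b" for a b and X :: "real ^ 'n ^ 'n"
  proof -
    have Xs: "X \<in> spd" using quad_between_spd[OF a X] .
    note inv = matrix_inv_right[OF spd_invertible[OF Xs]]
    have "y \<bullet> (matrix_inv X *v y) \<le> (1 / a) * (y \<bullet> y)" for y
    proof -
      define x where "x = matrix_inv X *v y"
      have y: "y = X *v x" by (simp add: x_def matrix_vector_mul_assoc inv)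
      define s where "s = x \<bullet> y"
      have s: "a * (x \<bullet> x) \<le> s" "0 \<le> s"
        using X a Xs unfolding s_def y quad_between_def spd_def
        by (auto, smt (verit) inner_ge_zero mult_nonneg_nonneg)
      have "s * s \<le> (x \<bullet> x) * (y \<bullet> y)"
        using Cauchy_Schwarz_ineq[of x y] by (simp add: s_def power2_eq_square)
      then have "a * (s * s) \<le> a * ((x \<bullet> x) * (y \<bullet> y))" using a by (simp add: mult_left_mono)
      also have "\<dots> = (a * (x \<bullet> x)) * (y \<bullet> y)" by simp
      also have "\<dots> \<le> s * (y \<bullet> y)" by (intro mult_right_mono s) simp
      finally have "s * (a * s) \<le> s * (y \<bullet> y)" by (simp add: algebra_simps)
      then have "a * s \<le> y \<bullet> y"
        using s(2) by (cases "s = 0") auto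
      then show ?thesis using a by (simp add: s_def x_def inner_commute field_simps)
    qed
    moreover have "0 \<le> y \<bullet> (matrix_inv X *v y)" for y
      using spd_matrix_inv[OF Xs] unfolding spd_def by (cases "y = 0") (auto intro: less_imp_le)
    ultimately have "matrix_inv X \<in> quad_between 0 (1 / a)"
      using spd_matrix_inv[OF Xs] by (auto simp: quad_between_def spd_def)
    then have "det (matrix_inv X) \<le> C * (1 / a) ^ CARD('n)" using up a by simp
    moreover have "det X * det (matrix_inv X) = 1"
      using inv by (metis det_mul det_I)
    then have "det (matrix_inv X) = 1 / det X"
      by (metis mult_zero_left nonzero_mult_div_cancel_left zero_neq_one)
    ultimately have "1 / det X \<le> C / a ^ CARD('n)" by (simp add: power_divide)
    then show ?thesis using spd_det_pos[OF Xs] C a by (simp add: field_simps)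
  qed
  then show ?thesis using C up by blast
qed

section \<open>The matrix equation of the barycenter\<close>

lemma finite_spd_quad_between:
  fixes A :: "'i \<Rightarrow> real ^ 'n ^ 'n"
  assumes "finite I" "\<And>i. i \<in> I \<Longrightarrow> A i \<in> spd"
  shows "\<exists>a b. 0 < a \<and> a \<le> b \<and> (\<forall>i\<in>I. A i \<in> quad_between a b)"
  using assms
proof (induction I rule: finite_induct)
  case empty then show ?case by (intro exI[of _ 1]) auto
next
  case (insert j I)
  then obtain a b where ab: "0 < a" "a \<le> b" "\<forall>i\<in>I. A i \<in> quad_between a b" by auto
  obtain a' b' where ab': "0 < a'" "a' \<le> b'" "A j \<in> quad_between a' b'"
    using spd_quad_between insert.prems by blast
  have "\<forall>i\<in>insert j I. A i \<in> quad_between (min a a') (max b b')"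
    using ab(3) ab'(3) quad_between_subset[of "min a a'" a b "max b b'"]
      quad_between_subset[of "min a a'" a' b' "max b b'"] by auto
  then show ?case using ab ab' by (intro exI[of _ "min a a'"] exI[of _ "max b b'"]) auto
qed

lemma quad_between_add_mat:
  "S \<in> quad_between a b \<Longrightarrow> S + k *\<^sub>R mat 1 \<in> quad_between (a + k) (b + k)"
proof -
  assume S: "S \<in> quad_between a b"
  then have "transpose (S + k *\<^sub>R mat 1) = S + k *\<^sub>R mat 1"
    by (auto simp: quad_between_def transpose_def vec_eq_iff mat_def)
  moreover have "x \<bullet> ((S + k *\<^sub>R mat 1) *v x) = x \<bullet> (S *v x) + k * (x \<bullet> x)" for x
    by (simp add: matrix_vector_mult_add_rdistrib scaleR_matrix_vector inner_add_right)
  ultimately show ?thesis using S by (simp add: quad_between_def distrib_right)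
qed

text \<open>On the interval \<open>a I \<le> X \<le> B I\<close>, where \<open>a\<close> is a common lower bound of the \<open>A\<^sub>i\<close>, the square roots are at
  least \<open>sqrt (a a) = a\<close> and at most \<open>sqrt (b B)\<close>. The determinant term is bounded by a multiple of
  \<open>B\<^sup>\<theta>\<close>, where \<open>\<theta> < 1\<close> is the assumption on \<open>p\<close>. Hence for large \<open>B\<close> each summand is at most \<open>B / 2\<close>, the
  interval is invariant, and Brouwer's theorem gives a fixed point.\<close>
theorem spd_fixed_point:
  fixes A :: "'i \<Rightarrow> real ^ 'n ^ 'n" and c p :: real
  assumes I: "finite I" and w: "\<And>i. i \<in> I \<Longrightarrow> 0 \<le> w i" "sum w I = 1"
    and A: "\<And>i. i \<in> I \<Longrightarrow> A i \<in> spd" and c: "0 \<le> c" and p: "p * CARD('n) < 1"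
  shows "\<exists>X\<in>spd. X = (\<Sum>i\<in>I. w i *\<^sub>R spd_sqrt (spd_sqrt X ** A i ** spd_sqrt X))
           + (c * det X powr p) *\<^sub>R mat 1"
proof -
  let ?d = "CARD('n)"
  obtain a b where ab: "0 < a" "a \<le> b" and Ab: "\<And>i. i \<in> I \<Longrightarrow> A i \<in> quad_between a b"
    using finite_spd_quad_between[OF I] A by metis
  obtain C where C: "0 < C"
    and Cup: "\<And>b X. 0 < b \<Longrightarrow> X \<in> (quad_between 0 b :: (real ^ 'n ^ 'n) set) \<Longrightarrow> det X \<le> C * b ^ ?d"
    and Clo: "\<And>a b X. 0 < a \<Longrightarrow> X \<in> (quad_between a b :: (real ^ 'n ^ 'n) set) \<Longrightarrow> a ^ ?d / C \<le> det X"
    using det_bounds[where 'n = 'n] by metis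
  \<comment> \<open>For \<open>p \<ge> 0\<close> the first summand bounds \<open>(det X)\<^sup>p / B\<^sup>\<theta>\<close>, for \<open>p < 0\<close> the second one does.\<close>
  define K where "K = (C powr p + (a ^ ?d / C) powr p) * c"
  define \<theta> where "\<theta> = max 0 (p * ?d)"
  have \<theta>: "0 \<le> \<theta>" "\<theta> < 1" using p by (auto simp: \<theta>_def)
  \<comment> \<open>The two bounds ensure \<open>sqrt (b B) \<le> B / 2\<close> and \<open>K B\<^sup>\<theta> \<le> B / 2\<close>.\<close>
  define B where "B = max (max 1 (4 * b)) ((2 * K) powr (1 / (1 - \<theta>)))"
  have B: "1 \<le> B" "4 * b \<le> B" "(2 * K) powr (1 / (1 - \<theta>)) \<le> B" by (auto simp: B_def)
  have aB: "a \<le> B" using ab B by linarith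
  have K: "0 \<le> K" using c by (simp add: K_def)
  have KB: "K * B powr \<theta> \<le> B / 2"
  proof -
    have "2 * K = ((2 * K) powr (1 / (1 - \<theta>))) powr (1 - \<theta>)"
      using K \<theta> by (simp add: powr_powr)
    also have "\<dots> \<le> B powr (1 - \<theta>)" using B \<theta> by (intro powr_mono2) auto
    finally have "2 * K * B powr \<theta> \<le> B powr (1 - \<theta>) * B powr \<theta>" by (simp add: mult_right_mono)
    also have "\<dots> = B" using B by (simp add: powr_add[symmetric])
    finally show ?thesis by simp
  qed
  have det: "c * det X powr p \<le> B / 2" if X: "X \<in> quad_between a B" for X :: "real ^ 'n ^ 'n"
  proof -
    have X0: "X \<in> quad_between 0 B" using X quad_between_subset[of 0 a B B] ab by auto
    have dlo: "a ^ ?d / C \<le> det X" using Clo X ab by blast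
    have dup: "det X \<le> C * B ^ ?d" using Cup X0 B by simp
    have pos: "0 < a ^ ?d / C" using ab C by simp
    have Bt: "1 \<le> B powr \<theta>" using B \<theta> by (simp add: ge_one_powr_ge_zero)
    have "det X powr p \<le> (C powr p + (a ^ ?d / C) powr p) * B powr \<theta>"
    proof (cases "0 \<le> p")
      case True
      then have "det X powr p \<le> (C * B ^ ?d) powr p" using dlo dup pos by (intro powr_mono2) auto
      also have "\<dots> = C powr p * B powr \<theta>"
        using True B C by (simp add: \<theta>_def powr_mult powr_realpow[symmetric] powr_powr mult.commute)
      also have "\<dots> \<le> (C powr p + (a ^ ?d / C) powr p) * B powr \<theta>"
        by (intro mult_right_mono) auto
      finally show ?thesis .
    next
      case False
      then have "det X powr p \<le> (a ^ ?d / C) powr p"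
        using dlo pos by (intro powr_mono2') auto
      also have "\<dots> \<le> (C powr p + (a ^ ?d / C) powr p) * 1" by simp
      also have "\<dots> \<le> (C powr p + (a ^ ?d / C) powr p) * B powr \<theta>"
        using Bt by (intro mult_left_mono) auto
      finally show ?thesis .
    qed
    then have "c * det X powr p \<le> c * ((C powr p + (a ^ ?d / C) powr p) * B powr \<theta>)"
      using c by (rule mult_left_mono)
    also have "\<dots> = K * B powr \<theta>" by (simp add: K_def)
    finally show ?thesis using KB by linarith
  qed
  define G where "G X = (\<Sum>i\<in>I. w i *\<^sub>R spd_sqrt (spd_sqrt X ** A i ** spd_sqrt X))" for X
  define F where "F X = G X + (c * det X powr p) *\<^sub>R mat 1" for X
  let ?K = "quad_between a B :: (real ^ 'n ^ 'n) set"
  have inner: "spd_sqrt X ** A i ** spd_sqrt X \<in> quad_between (a * a) (b * B)"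
    if "X \<in> ?K" "i \<in> I" for X i
    using sqrt_congruence_between[OF that(1) Ab[OF that(2)]] ab by (simp add: mult.commute)
  have aabB: "0 < a * a" "a * a \<le> b * B" using ab aB by (auto intro: mult_mono)
  have G: "G X \<in> quad_between a (B / 2)" if "X \<in> ?K" for X
  proof -
    have "spd_sqrt (spd_sqrt X ** A i ** spd_sqrt X) \<in> quad_between a (B / 2)" if "i \<in> I" for i
    proof -
      have "spd_sqrt (spd_sqrt X ** A i ** spd_sqrt X) \<in> quad_between (sqrt (a * a)) (sqrt (b * B))"
        using inner \<open>X \<in> ?K\<close> that aabB by (intro spd_sqrt_between) auto
      moreover have "sqrt (b * B) \<le> B / 2"
        using B ab by (intro real_le_lsqrt) (auto simp: power2_eq_square field_simps intro: mult_right_mono)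
      moreover have "sqrt (a * a) = a" using ab by simp
      ultimately show ?thesis using quad_between_subset[of a a "sqrt (b * B)" "B / 2"] by auto
    qed
    then show ?thesis
      unfolding G_def using I w by (intro convex_sum convex_quad_between) auto
  qed
  obtain X where X: "X \<in> ?K" "F X = X"
  proof (rule brouwer[of ?K F])
    show "compact ?K" using ab by (intro compact_quad_between) auto
    show "convex ?K" by (rule convex_quad_between)
    have "a *\<^sub>R mat 1 \<in> ?K"
    proof -
      have "(0 :: real ^ 'n ^ 'n) \<in> quad_between 0 0"
        by (simp add: quad_between_def transpose_def vec_eq_iff)
      from quad_between_add_mat[OF this, of a] show ?thesis
        using quad_between_subset[of a a a B] aB by auto
    qed
    then show "?K \<noteq> {}" by blast
    have detne: "det X \<noteq> 0" if "X \<in> ?K" for X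
      using spd_det_pos[OF quad_between_spd[OF ab(1) that]] by simp
    have s: "continuous_on ?K spd_sqrt" using ab aB by (intro continuous_on_spd_sqrt) auto
    have "continuous_on ?K (\<lambda>X. spd_sqrt (spd_sqrt X ** A i ** spd_sqrt X))" if "i \<in> I" for i
      by (rule continuous_on_compose2[OF continuous_on_spd_sqrt[OF aabB]])
        (use inner that in \<open>auto intro!: continuous_intros s\<close>)
    then show "continuous_on ?K F"
      unfolding F_def G_def using detne by (intro continuous_intros) auto
    show "F \<in> ?K \<rightarrow> ?K"
    proof
      fix X assume X: "X \<in> ?K"
      have "F X \<in> quad_between (a + c * det X powr p) (B / 2 + c * det X powr p)"
        unfolding F_def by (intro quad_between_add_mat G X)
      moreover have "0 \<le> c * det X powr p" using c by simp
      ultimately show "F X \<in> ?K"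
        using det[OF X] quad_between_subset[of a "a + c * det X powr p" "B / 2 + c * det X powr p" B] by auto
    qed
  qed
  show ?thesis
  proof (rule bexI)
    show "X = (\<Sum>i\<in>I. w i *\<^sub>R spd_sqrt (spd_sqrt X ** A i ** spd_sqrt X)) + (c * det X powr p) *\<^sub>R mat 1"
      using X(2) by (simp add: F_def G_def)
    show "X \<in> spd" using quad_between_spd[OF ab(1) X(1)] .
  qed
qed

text \<open>The optimal map between the centered Gaussians with covariances \<open>X\<close> and \<open>A\<^sub>i\<close> is
  \<open>T\<^sub>i = X\<^sup>-\<^sup>1\<^sup>/\<^sup>2 (X\<^sup>1\<^sup>/\<^sup>2 A\<^sub>i X\<^sup>1\<^sup>/\<^sup>2)\<^sup>1\<^sup>/\<^sup>2 X\<^sup>-\<^sup>1\<^sup>/\<^sup>2\<close>. Multiplying the matrix equation by \<open>X\<^sup>-\<^sup>1\<^sup>/\<^sup>2\<close> on both sides turns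
  it into a statement about the average of these maps.\<close>
lemma spd_transport_maps:
  fixes A :: "'i \<Rightarrow> real ^ 'n ^ 'n"
  assumes X: "X \<in> spd" and A: "\<And>i. i \<in> I \<Longrightarrow> A i \<in> spd"
    and eq: "X - k *\<^sub>R mat 1 = (\<Sum>i\<in>I. w i *\<^sub>R spd_sqrt (spd_sqrt X ** A i ** spd_sqrt X))"
  shows "\<exists>T. (\<forall>i\<in>I. T i \<in> spd \<and> T i ** X ** T i = A i) \<and>
    (\<Sum>i\<in>I. w i *\<^sub>R T i) = mat 1 - k *\<^sub>R matrix_inv X"
proof -
  define S where "S = spd_sqrt X"
  define J where "J = matrix_inv S"
  have S: "S \<in> spd" "S ** S = X" using spd_sqrt[OF X] by (auto simp: S_def)
  have J: "J \<in> spd" "S ** J = mat 1" "J ** S = mat 1"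
    using spd_matrix_inv[OF S(1)] matrix_inv_mult[OF spd_invertible[OF S(1)]] by (auto simp: J_def)
  define R where "R i = spd_sqrt (S ** A i ** S)" for i
  have R: "R i \<in> spd" "R i ** R i = S ** A i ** S" if "i \<in> I" for i
    using spd_sqrt[OF spd_congruence[OF S(1) A[OF that]]] by (auto simp: R_def)
  have cancel: "P ** J ** S = P" "P ** S ** J = P" for P :: "real ^ 'n ^ 'n"
    by (simp_all add: matrix_mul_assoc[symmetric] J)
  show ?thesis
  proof (intro exI[of _ "\<lambda>i. J ** R i ** J"] conjI ballI)
    show "J ** R i ** J \<in> spd" if "i \<in> I" for i using spd_congruence[OF J(1)] R that by blast
    show "(J ** R i ** J) ** X ** (J ** R i ** J) = A i" if "i \<in> I" for i
    proof -
      have "(J ** R i ** J) ** X ** (J ** R i ** J) = J ** (R i ** R i) ** J"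
        by (simp add: S(2)[symmetric] matrix_mul_assoc cancel)
      also have "\<dots> = A i" by (simp add: R[OF that] matrix_mul_assoc cancel J)
      finally show ?thesis .
    qed
    have inv: "matrix_inv X = J ** J"
      by (rule matrix_inv_eqI) (simp add: S(2)[symmetric] matrix_mul_assoc cancel J)
    have JXJ: "J ** X ** J = mat 1" by (simp add: S(2)[symmetric] matrix_mul_assoc cancel J)
    have lin: "linear (\<lambda>Y. J ** Y ** J)"
      by (rule linearI) (simp_all add: matrix_add_ldistrib matrix_add_rdistrib' matrix_scalar_ac scalar_matrix_assoc[symmetric])
    have "(\<Sum>i\<in>I. w i *\<^sub>R (J ** R i ** J)) = J ** (\<Sum>i\<in>I. w i *\<^sub>R R i) ** J"
      using linear_sum[OF lin, of "\<lambda>i. w i *\<^sub>R R i" I] linear_scale[OF lin] by simp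
    also have "\<dots> = J ** (X - k *\<^sub>R mat 1) ** J" using eq by (simp add: R_def S_def)
    also have "\<dots> = J ** X ** J - k *\<^sub>R (J ** J)"
      using linear_diff[OF lin, of X "k *\<^sub>R mat 1"] linear_scale[OF lin, of k "mat 1"] by simp
    also have "\<dots> = mat 1 - k *\<^sub>R matrix_inv X" by (simp add: inv JXJ)
    finally show "(\<Sum>i\<in>I. w i *\<^sub>R (J ** R i ** J)) = mat 1 - k *\<^sub>R matrix_inv X" .
  qed
qed

section \<open>Wasserstein distance and linear maps\<close>

lemma matrix_vector_mult_measurable [measurable (raw)]:
  fixes M :: "real ^ 'n ^ 'm"
  assumes "f \<in> borel_measurable L"
  shows "(\<lambda>x. M *v f x) \<in> borel_measurable L"
  using assms by (rule borel_measurable_continuous_on[OF matrix_vector_mult_linear_continuous_on])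

lemma integrable_quadratic_form:
  fixes M :: "real ^ 'n ^ 'n"
  assumes "\<mu> \<in> P2"
  shows "integrable \<mu> (\<lambda>x. x \<bullet> (M *v x))"
proof -
  have [measurable_cong]: "sets \<mu> = sets borel" and int: "integrable \<mu> (\<lambda>x. (norm x)\<^sup>2)"
    using assms by (auto simp: P2_def)
  obtain K where K: "\<And>x. norm (M *v x) \<le> norm x * K"
    using bounded_linear.bounded[OF matrix_vector_mul_bounded_linear[of M]] by blast
  have "\<bar>x \<bullet> (M *v x)\<bar> \<le> \<bar>K * (norm x)\<^sup>2\<bar>" for x
  proof -
    have "\<bar>x \<bullet> (M *v x)\<bar> \<le> norm x * norm (M *v x)" by (rule Cauchy_Schwarz_ineq2)
    also have "\<dots> \<le> norm x * (norm x * K)" by (intro mult_left_mono K) simp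
    also have "\<dots> = K * (norm x)\<^sup>2" by (simp add: power2_eq_square)
    finally show ?thesis by simp
  qed
  then show ?thesis
    by (intro Bochner_Integration.integrable_bound[OF integrable_mult_right[OF int, of K]]) auto
qed

lemma P2_distr_linear:
  fixes T :: "real ^ 'n ^ 'n"
  assumes "\<mu> \<in> P2"
  shows "distr \<mu> borel ((*v) T) \<in> P2"
proof -
  have [measurable_cong]: "sets \<mu> = sets borel" and p: "prob_space \<mu>"
    using assms by (auto simp: P2_def)
  have "integrable \<mu> (\<lambda>x. x \<bullet> ((transpose T ** T) *v x))"
    by (rule integrable_quadratic_form[OF assms])
  moreover have "x \<bullet> ((transpose T ** T) *v x) = (norm (T *v x))\<^sup>2" for x
    by (simp add: matrix_vector_mul_assoc[symmetric] power2_norm_eq_inner dot_lmul_matrix[symmetric] inner_commute)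
  ultimately show ?thesis
    using p by (auto simp: P2_def integrable_distr_eq prob_space.prob_space_distr)
qed

lemma coupling_measurable:
  assumes "\<pi> \<in> couplings \<mu> \<nu>"
  shows "fst \<in> borel_measurable \<pi>" "snd \<in> borel_measurable \<pi>"
  using assms by (auto simp: couplings_def cong: measurable_cong_sets)

lemma coupling_integral:
  fixes f :: "real ^ 'n \<Rightarrow> real"
  assumes "\<pi> \<in> couplings \<mu> \<nu>" and f: "f \<in> borel_measurable borel"
  shows "integrable \<pi> (\<lambda>z. f (fst z)) \<longleftrightarrow> integrable \<mu> f"
    "integrable \<pi> (\<lambda>z. f (snd z)) \<longleftrightarrow> integrable \<nu> f"
    "(\<integral>z. f (fst z) \<partial>\<pi>) = (\<integral>x. f x \<partial>\<mu>)" "(\<integral>z. f (snd z) \<partial>\<pi>) = (\<integral>x. f x \<partial>\<nu>)"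
proof -
  have \<mu>: "\<mu> = distr \<pi> borel fst" and \<nu>: "\<nu> = distr \<pi> borel snd"
    using assms by (auto simp: couplings_def)
  note m = coupling_measurable[OF assms(1)]
  show "integrable \<pi> (\<lambda>z. f (fst z)) \<longleftrightarrow> integrable \<mu> f" "(\<integral>z. f (fst z) \<partial>\<pi>) = (\<integral>x. f x \<partial>\<mu>)"
    unfolding \<mu> using m f by (simp_all add: integrable_distr_eq integral_distr)
  show "integrable \<pi> (\<lambda>z. f (snd z)) \<longleftrightarrow> integrable \<nu> f" "(\<integral>z. f (snd z) \<partial>\<pi>) = (\<integral>x. f x \<partial>\<nu>)"
    unfolding \<nu> using m f by (simp_all add: integrable_distr_eq integral_distr)
qed

text \<open>The amount by which the Fenchel--Young inequality
  \<open>2 \<langle>x, y\<rangle> \<le> \<langle>x, T x\<rangle> + \<langle>y, T\<^sup>-\<^sup>1 y\<rangle>\<close> fails to be an equality.\<close>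
definition transport_gap :: "real ^ 'n ^ 'n \<Rightarrow> real ^ 'n \<Rightarrow> real ^ 'n \<Rightarrow> real" where
  "transport_gap T x y = (y - T *v x) \<bullet> (matrix_inv T *v (y - T *v x))"

text \<open>The Kantorovich dual functional at the pair of potentials \<open>\<langle>x, (I - T) x\<rangle>\<close>, \<open>\<langle>y, (I - T\<^sup>-\<^sup>1) y\<rangle>\<close>.\<close>
definition dual_value ::
  "real ^ 'n ^ 'n \<Rightarrow> (real ^ 'n) measure \<Rightarrow> (real ^ 'n) measure \<Rightarrow> real" where
  "dual_value T \<mu> \<nu> = (\<integral>x. x \<bullet> ((mat 1 - T) *v x) \<partial>\<mu>) + (\<integral>y. y \<bullet> ((mat 1 - matrix_inv T) *v y) \<partial>\<nu>)"

lemma square_distance_split: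
  fixes T :: "real ^ 'n ^ 'n"
  assumes T: "T \<in> spd"
  shows "(norm (x - y))\<^sup>2 = x \<bullet> ((mat 1 - T) *v x) + y \<bullet> ((mat 1 - matrix_inv T) *v y) + transport_gap T x y"
proof -
  define J where "J = matrix_inv T"
  have J: "J ** T = mat 1" using matrix_inv_mult[OF spd_invertible[OF T]] by (simp add: J_def)
  have sym: "u \<bullet> (J *v v) = (J *v u) \<bullet> v" for u v
    using spd_matrix_inv[OF T] by (intro inner_symmetric_matrix) (simp add: J_def spd_def)
  have JT: "J *v (T *v x) = x" by (simp add: matrix_vector_mul_assoc J)
  have c: "(T *v x) \<bullet> (J *v y) = x \<bullet> y"
    using sym[of "T *v x" y] by (simp add: JT)
  then have c': "(J *v y) \<bullet> (T *v x) = x \<bullet> y" by (simp add: inner_commute)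
  show ?thesis
    unfolding transport_gap_def J_def[symmetric] power2_norm_eq_inner
    by (simp add: matrix_vector_mult_diff_distrib matrix_vector_mult_diff_rdistrib inner_diff_left
        inner_diff_right JT c c' inner_commute)
qed

lemma transport_gap_coercive:
  fixes T :: "real ^ 'n ^ 'n"
  assumes T: "T \<in> spd"
  shows "\<exists>a>0. \<forall>x y. a * (norm (T *v x - y))\<^sup>2 \<le> transport_gap T x y"
proof -
  obtain a b where "0 < a" "matrix_inv T \<in> quad_between a b"
    using spd_quad_between[OF spd_matrix_inv[OF T]] by blast
  then show ?thesis
    by (intro exI[of _ a]) (auto simp: transport_gap_def quad_between_def norm_minus_commute power2_norm_eq_inner)
qed

lemma coupling_cost_split:
  fixes T :: "real ^ 'n ^ 'n"
  assumes T: "T \<in> spd" and \<mu>: "\<mu> \<in> P2" and \<nu>: "\<nu> \<in> P2" and \<pi>: "\<pi> \<in> couplings \<mu> \<nu>"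
  shows "integrable \<pi> (\<lambda>z. transport_gap T (fst z) (snd z))"
    and "(\<integral>z. (norm (fst z - snd z))\<^sup>2 \<partial>\<pi>) =
      dual_value T \<mu> \<nu> + (\<integral>z. transport_gap T (fst z) (snd z) \<partial>\<pi>)"
    and "(\<integral>\<^sup>+ (x, y). ennreal ((norm (x - y))\<^sup>2) \<partial>\<pi>) = ennreal (\<integral>z. (norm (fst z - snd z))\<^sup>2 \<partial>\<pi>)"
proof -
  note [measurable] = coupling_measurable[OF \<pi>]
  have q: "integrable \<pi> (\<lambda>z. fst z \<bullet> (M *v fst z))" "integrable \<pi> (\<lambda>z. snd z \<bullet> (M *v snd z))" for M
    using coupling_integral[OF \<pi>, of "\<lambda>x. x \<bullet> (M *v x)"] integrable_quadratic_form[OF \<mu>]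
      integrable_quadratic_form[OF \<nu>] by auto
  have "integrable \<pi> (\<lambda>z. 2 * (fst z \<bullet> fst z) + 2 * (snd z \<bullet> snd z))"
    using q[of "mat 1"] by (intro Bochner_Integration.integrable_add integrable_mult_right) auto
  then have d: "integrable \<pi> (\<lambda>z. (norm (fst z - snd z))\<^sup>2)"
  proof (rule Bochner_Integration.integrable_bound)
    have "(norm (x - y))\<^sup>2 \<le> 2 * (x \<bullet> x) + 2 * (y \<bullet> y)" for x y :: "real ^ 'n"
      using inner_ge_zero[of "x + y"]
      by (simp add: power2_norm_eq_inner inner_add_left inner_add_right inner_diff_left inner_diff_right inner_commute)
    then show "AE z in \<pi>. norm ((norm (fst z - snd z))\<^sup>2) \<le> norm (2 * (fst z \<bullet> fst z) + 2 * (snd z \<bullet> snd z))"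
      by auto
  qed measurable
  have gap: "transport_gap T (fst z) (snd z) = (norm (fst z - snd z))\<^sup>2 - fst z \<bullet> ((mat 1 - T) *v fst z)
      - snd z \<bullet> ((mat 1 - matrix_inv T) *v snd z)" for z
    using square_distance_split[OF T, of "fst z" "snd z"] by simp
  show int: "integrable \<pi> (\<lambda>z. transport_gap T (fst z) (snd z))"
    unfolding gap using q d by (intro Bochner_Integration.integrable_diff) auto
  show "(\<integral>z. (norm (fst z - snd z))\<^sup>2 \<partial>\<pi>) =
      dual_value T \<mu> \<nu> + (\<integral>z. transport_gap T (fst z) (snd z) \<partial>\<pi>)"
    using q int coupling_integral(3)[OF \<pi>, of "\<lambda>x. x \<bullet> ((mat 1 - T) *v x)"]
      coupling_integral(4)[OF \<pi>, of "\<lambda>x. x \<bullet> ((mat 1 - matrix_inv T) *v x)"]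
    by (simp add: square_distance_split[OF T] dual_value_def)
  show "(\<integral>\<^sup>+ (x, y). ennreal ((norm (x - y))\<^sup>2) \<partial>\<pi>) = ennreal (\<integral>z. (norm (fst z - snd z))\<^sup>2 \<partial>\<pi>)"
    using nn_integral_eq_integral[OF d] by (simp add: case_prod_beta')
qed

lemma transport_gap_nonneg: "T \<in> spd \<Longrightarrow> 0 \<le> transport_gap T x y"
proof -
  assume "T \<in> spd"
  then obtain a where "0 < a" "a * (norm (T *v x - y))\<^sup>2 \<le> transport_gap T x y"
    using transport_gap_coercive by blast
  then show ?thesis by (smt (verit) mult_nonneg_nonneg zero_le_power2)
qed

lemma W2_sq_ge_dual_value:
  fixes T :: "real ^ 'n ^ 'n"
  assumes T: "T \<in> spd" and \<mu>: "\<mu> \<in> P2" and \<nu>: "\<nu> \<in> P2"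
  shows "ereal (dual_value T \<mu> \<nu>) \<le> enn2ereal (W2_sq \<mu> \<nu>)"
proof (cases "0 \<le> dual_value T \<mu> \<nu>")
  case True
  have "ennreal (dual_value T \<mu> \<nu>) \<le> W2_sq \<mu> \<nu>"
    unfolding W2_sq_def
    using coupling_cost_split(2,3)[OF T \<mu> \<nu>] transport_gap_nonneg[OF T]
    by (intro INF_greatest) (auto intro!: ennreal_leI Bochner_Integration.integral_nonneg)
  then have "enn2ereal (ennreal (dual_value T \<mu> \<nu>)) \<le> enn2ereal (W2_sq \<mu> \<nu>)"
    by (simp add: less_eq_ennreal.rep_eq)
  then show ?thesis using True by (simp add: enn2ereal_ennreal)
next
  case False
  then have "ereal (dual_value T \<mu> \<nu>) \<le> 0" by simp
  then show ?thesis using enn2ereal_nonneg order_trans by blast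
qed

text \<open>The coupling \<open>(x, T x)\<close> has transport gap \<open>0\<close>, so it attains the dual bound.\<close>
lemma W2_sq_linear_image:
  fixes T :: "real ^ 'n ^ 'n"
  assumes T: "T \<in> spd" and \<mu>: "\<mu> \<in> P2"
  shows "enn2ereal (W2_sq \<mu> (distr \<mu> borel ((*v) T))) = ereal (dual_value T \<mu> (distr \<mu> borel ((*v) T)))"
proof -
  let ?\<nu> = "distr \<mu> borel ((*v) T)"
  define \<pi> where "\<pi> = distr \<mu> (borel \<Otimes>\<^sub>M borel) (\<lambda>x. (x, T *v x))"
  have [measurable_cong]: "sets \<mu> = sets borel" and p: "prob_space \<mu>"
    using \<mu> by (auto simp: P2_def)
  have \<nu>: "?\<nu> \<in> P2" by (rule P2_distr_linear[OF \<mu>])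
  have \<pi>: "\<pi> \<in> couplings \<mu> ?\<nu>"
    using p distr_id2[of borel \<mu>, OF \<open>sets \<mu> = sets borel\<close>[symmetric]]
    by (auto simp: couplings_def \<pi>_def prob_space.prob_space_distr distr_distr o_def)
  have "(\<integral>z. transport_gap T (fst z) (snd z) \<partial>\<pi>) = (\<integral>x. transport_gap T x (T *v x) \<partial>\<mu>)"
    unfolding \<pi>_def by (subst integral_distr) (auto simp: transport_gap_def)
  then have total: "(\<integral>z. (norm (fst z - snd z))\<^sup>2 \<partial>\<pi>) = dual_value T \<mu> ?\<nu>"
    using coupling_cost_split(2)[OF T \<mu> \<nu> \<pi>] by (simp add: transport_gap_def)
  have nn: "0 \<le> dual_value T \<mu> ?\<nu>" unfolding total[symmetric] by simp
  have cost: "(\<integral>\<^sup>+ (x, y). ennreal ((norm (x - y))\<^sup>2) \<partial>\<pi>) = ennreal (dual_value T \<mu> ?\<nu>)"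
    using coupling_cost_split(3)[OF T \<mu> \<nu> \<pi>] total by simp
  have "W2_sq \<mu> ?\<nu> \<le> ennreal (dual_value T \<mu> ?\<nu>)"
    unfolding W2_sq_def cost[symmetric] by (rule INF_lower[OF \<pi>])
  then have "enn2ereal (W2_sq \<mu> ?\<nu>) \<le> ereal (dual_value T \<mu> ?\<nu>)"
    using nn by (metis enn2ereal_ennreal less_eq_ennreal.rep_eq)
  then show ?thesis using W2_sq_ge_dual_value[OF T \<mu> \<nu>] by (simp add: antisym)
qed

lemma measure_closed_le_of_thickenings:
  fixes N :: "(real ^ 'n) measure"
  assumes N: "prob_space N" "sets N = sets borel" and C: "closed C" "C \<noteq> {}"
    and le: "\<And>\<delta>. 0 < \<delta> \<Longrightarrow> m \<le> measure N {z. infdist z C \<le> \<delta>}"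
  shows "m \<le> measure N C"
proof -
  interpret N: prob_space N by (rule N)
  define D where "D \<delta> = {z. infdist z C \<le> \<delta>}" for \<delta>
  have D: "D \<delta> \<in> sets borel" for \<delta>
    unfolding D_def by (intro borel_closed closed_Collect_le continuous_intros)
  have "(\<lambda>n. measure N (D (1 / real (Suc n)))) \<longlonglongrightarrow> measure N (\<Inter>n. D (1 / real (Suc n)))"
    by (intro N.finite_Lim_measure_decseq)
      (auto simp: decseq_def D_def D[unfolded D_def] N intro: order_trans[OF _ divide_left_mono])
  moreover have "(\<Inter>n. D (1 / real (Suc n))) = C"
  proof (intro set_eqI iffI)
    fix z assume "z \<in> (\<Inter>n. D (1 / real (Suc n)))"
    then have "infdist z C \<le> 1 / real (Suc n)" for n by (auto simp: D_def)
    then have "infdist z C \<le> 0"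
      by (intro LIMSEQ_le_const[OF LIMSEQ_Suc[OF lim_1_over_n]]) auto
    then show "z \<in> C" using in_closed_iff_infdist_zero[OF C] infdist_nonneg[of z C] by simp
  next
    fix z assume "z \<in> C"
    then show "z \<in> (\<Inter>n. D (1 / real (Suc n)))" by (simp add: D_def)
  qed
  ultimately show ?thesis using le by (intro LIMSEQ_le_const) (auto simp: D_def)
qed

text \<open>Where \<open>u\<close> lies in \<open>C\<close>, either \<open>v\<close> is \<open>\<delta>\<close>-close to \<open>C\<close> or \<open>|u - v| \<ge> \<delta>\<close>; the second event is
  controlled by Markov's inequality.\<close>
lemma measure_closed_le_thickening:
  fixes u v :: "'a \<Rightarrow> real ^ 'n"
  assumes \<pi>: "prob_space \<pi>" and [measurable]: "u \<in> borel_measurable \<pi>" "v \<in> borel_measurable \<pi>"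
    and int: "integrable \<pi> (\<lambda>z. (norm (u z - v z))\<^sup>2)" and C: "closed C" and \<delta>: "0 < \<delta>"
  shows "measure (distr \<pi> borel u) C \<le>
    measure (distr \<pi> borel v) {z. infdist z C \<le> \<delta>} + (\<integral>z. (norm (u z - v z))\<^sup>2 \<partial>\<pi>) / \<delta>\<^sup>2"
proof -
  interpret \<pi>: prob_space \<pi> by (rule \<pi>)
  let ?D = "{z. infdist z C \<le> \<delta>}"
  have [measurable]: "C \<in> sets borel" "?D \<in> sets borel"
    using C by (auto intro!: borel_closed closed_Collect_le continuous_intros)
  let ?B = "{z \<in> space \<pi>. \<delta>\<^sup>2 \<le> (norm (u z - v z))\<^sup>2}"
  have "measure (distr \<pi> borel u) C = measure \<pi> (u -` C \<inter> space \<pi>)"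
    by (rule measure_distr) measurable
  also have "\<dots> \<le> measure \<pi> ((v -` ?D \<inter> space \<pi>) \<union> ?B)"
  proof (rule \<pi>.finite_measure_mono)
    show "u -` C \<inter> space \<pi> \<subseteq> (v -` ?D \<inter> space \<pi>) \<union> ?B"
    proof
      fix z assume z: "z \<in> u -` C \<inter> space \<pi>"
      show "z \<in> (v -` ?D \<inter> space \<pi>) \<union> ?B"
      proof (cases "norm (u z - v z) < \<delta>")
        case True
        have "infdist (v z) C \<le> dist (v z) (u z)" using z by (intro infdist_le) auto
        then have "infdist (v z) C \<le> \<delta>" using True by (simp add: dist_norm norm_minus_commute)
        then show ?thesis using z by auto
      next
        case False
        then show ?thesis using z \<delta> by (auto intro: power_mono)
      qed
    qed
  qed measurable
  also have "\<dots> \<le> measure \<pi> (v -` ?D \<inter> space \<pi>) + measure \<pi> ?B"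
    by (rule measure_Un_le) measurable
  also have "measure \<pi> (v -` ?D \<inter> space \<pi>) = measure (distr \<pi> borel v) ?D"
    by (rule measure_distr[symmetric]) measurable
  also have "measure \<pi> ?B \<le> (\<integral>z. (norm (u z - v z))\<^sup>2 \<partial>\<pi>) / \<delta>\<^sup>2"
    using \<delta> by (intro integral_Markov_inequality_measure[OF int, where A = "{}"]) auto
  finally show ?thesis by simp
qed

lemma borel_measure_eqI_closed:
  fixes M N :: "('a :: topological_space) measure"
  assumes M: "prob_space M" "sets M = sets borel" and N: "prob_space N" "sets N = sets borel"
    and eq: "\<And>C. closed C \<Longrightarrow> measure M C = measure N C"
  shows "M = N"
proof (rule measure_eqI_generator_eq[where E = "Collect closed" and \<Omega> = UNIV and A = "\<lambda>_. UNIV"])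
  interpret M: prob_space M by (rule M)
  interpret N: prob_space N by (rule N)
  show "emeasure M X = emeasure N X" if "X \<in> Collect closed" for X
    using eq that by (simp add: M.emeasure_eq_measure N.emeasure_eq_measure)
  show "sets M = sigma_sets UNIV (Collect closed)" "sets N = sigma_sets UNIV (Collect closed)"
    using M N borel_eq_closed by (metis sets_measure_of top_greatest Pow_UNIV)+
  show "emeasure M UNIV \<noteq> \<infinity>" by (simp add: M.emeasure_eq_measure)
qed (auto simp: Int_stable_def)

theorem W2_sq_eq_0_imp_eq:
  fixes \<mu> \<nu> :: "(real ^ 'n) measure"
  assumes \<mu>: "\<mu> \<in> P2" and \<nu>: "\<nu> \<in> P2" and W: "W2_sq \<mu> \<nu> = 0"
  shows "\<mu> = \<nu>"
proof (rule borel_measure_eqI_closed)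
  show P: "prob_space \<mu>" "sets \<mu> = sets borel" "prob_space \<nu>" "sets \<nu> = sets borel"
    using \<mu> \<nu> by (auto simp: P2_def)
  fix C :: "(real ^ 'n) set" assume C: "closed C"
  have le: "measure \<mu> C \<le> measure \<nu> {z. infdist z C \<le> \<delta>} \<and> measure \<nu> C \<le> measure \<mu> {z. infdist z C \<le> \<delta>}"
    if \<delta>: "0 < \<delta>" for \<delta>
  proof -
    have "measure \<mu> C \<le> measure \<nu> {z. infdist z C \<le> \<delta>} + e \<and> measure \<nu> C \<le> measure \<mu> {z. infdist z C \<le> \<delta>} + e"
      if e: "0 < e" for e
    proof -
      have "W2_sq \<mu> \<nu> < ennreal (e * \<delta>\<^sup>2)" using W e \<delta> by simp
      then obtain \<pi> where \<pi>: "\<pi> \<in> couplings \<mu> \<nu>"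
        and "(\<integral>\<^sup>+ (x, y). ennreal ((norm (x - y))\<^sup>2) \<partial>\<pi>) < ennreal (e * \<delta>\<^sup>2)"
        unfolding W2_sq_def INF_less_iff by blast
      then have small: "(\<integral>\<^sup>+ z. ennreal ((norm (fst z - snd z))\<^sup>2) \<partial>\<pi>) < ennreal (e * \<delta>\<^sup>2)"
        by (simp add: case_prod_beta')
      note [measurable] = coupling_measurable[OF \<pi>]
      have int: "integrable \<pi> (\<lambda>z. (norm (fst z - snd z))\<^sup>2)"
        using small by (intro integrableI_bounded) (auto intro: less_trans[OF _ ennreal_less_top])
      have "(\<integral>z. (norm (fst z - snd z))\<^sup>2 \<partial>\<pi>) < e * \<delta>\<^sup>2"
        using small nn_integral_eq_integral[OF int] by (simp add: ennreal_less_iff)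
      then have I: "(\<integral>z. (norm (fst z - snd z))\<^sup>2 \<partial>\<pi>) / \<delta>\<^sup>2 \<le> e" using \<delta> by (simp add: field_simps)
      have int': "integrable \<pi> (\<lambda>z. (norm (snd z - fst z))\<^sup>2)" using int by (simp add: norm_minus_commute)
      have \<pi>': "prob_space \<pi>" "distr \<pi> borel fst = \<mu>" "distr \<pi> borel snd = \<nu>"
        using \<pi> by (auto simp: couplings_def)
      show ?thesis
        using measure_closed_le_thickening[OF \<pi>'(1) _ _ int C \<delta>] measure_closed_le_thickening[OF \<pi>'(1) _ _ int' C \<delta>]
          I coupling_measurable[OF \<pi>] by (simp add: \<pi>' norm_minus_commute)
    qed
    then show ?thesis by (meson field_le_epsilon)
  qed
  show "measure \<mu> C = measure \<nu> C"
  proof (cases "C = {}")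
    case False
    then show ?thesis
      using measure_closed_le_of_thickenings[OF P(3,4) C False] measure_closed_le_of_thickenings[OF P(1,2) C False] le
      by (metis antisym)
  qed simp
qed

text \<open>If the dual bound is attained, there are couplings with arbitrarily small integral of the transport
  gap. The gap dominates a multiple of \<open>|T x - y|\<^sup>2\<close>, so these couplings, pushed forward by \<open>T\<close> in the first
  component, show that the image of \<open>\<mu>\<close> under \<open>T\<close> is at distance \<open>0\<close> from \<open>\<nu>\<close>.\<close>
lemma W2_sq_eq_dual_value_imp:
  fixes T :: "real ^ 'n ^ 'n"
  assumes T: "T \<in> spd" and \<mu>: "\<mu> \<in> P2" and \<nu>: "\<nu> \<in> P2"
    and eq: "enn2ereal (W2_sq \<mu> \<nu>) = ereal (dual_value T \<mu> \<nu>)"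
  shows "distr \<mu> borel ((*v) T) = \<nu>"
proof (rule W2_sq_eq_0_imp_eq[OF P2_distr_linear[OF \<mu>] \<nu>])
  have nn: "0 \<le> dual_value T \<mu> \<nu>" using eq enn2ereal_nonneg[of "W2_sq \<mu> \<nu>"] by simp
  then have W: "W2_sq \<mu> \<nu> = ennreal (dual_value T \<mu> \<nu>)"
    using eq by (metis enn2ereal_ennreal enn2ereal_inject)
  obtain a where a: "0 < a" "\<And>x y. a * (norm (T *v x - y))\<^sup>2 \<le> transport_gap T x y"
    using transport_gap_coercive[OF T] by blast
  have "W2_sq (distr \<mu> borel ((*v) T)) \<nu> \<le> ennreal \<epsilon>" if \<epsilon>: "0 < \<epsilon>" for \<epsilon>
  proof -
    have "W2_sq \<mu> \<nu> < ennreal (dual_value T \<mu> \<nu> + a * \<epsilon>)"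
      unfolding W using nn a \<epsilon> by (intro ennreal_lessI) (auto intro: add_nonneg_pos)
    then obtain \<pi> where \<pi>: "\<pi> \<in> couplings \<mu> \<nu>"
      and "(\<integral>\<^sup>+ (x, y). ennreal ((norm (x - y))\<^sup>2) \<partial>\<pi>) < ennreal (dual_value T \<mu> \<nu> + a * \<epsilon>)"
      unfolding W2_sq_def INF_less_iff by blast
    then have g: "(\<integral>z. transport_gap T (fst z) (snd z) \<partial>\<pi>) < a * \<epsilon>"
      unfolding coupling_cost_split(2,3)[OF T \<mu> \<nu> \<pi>]
      by (subst (asm) ennreal_less_iff)
        (auto intro!: add_nonneg_nonneg nn Bochner_Integration.integral_nonneg transport_gap_nonneg[OF T])
    note [measurable] = coupling_measurable[OF \<pi>]
    note gap = coupling_cost_split(1)[OF T \<mu> \<nu> \<pi>]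
    have int: "integrable \<pi> (\<lambda>z. a * (norm (T *v fst z - snd z))\<^sup>2)"
      using a transport_gap_nonneg[OF T] by (intro Bochner_Integration.integrable_bound[OF gap]) auto
    then have int': "integrable \<pi> (\<lambda>z. (norm (T *v fst z - snd z))\<^sup>2)"
      using a by simp
    have "a * (\<integral>z. (norm (T *v fst z - snd z))\<^sup>2 \<partial>\<pi>) = (\<integral>z. a * (norm (T *v fst z - snd z))\<^sup>2 \<partial>\<pi>)" by simp
    also have "\<dots> \<le> (\<integral>z. transport_gap T (fst z) (snd z) \<partial>\<pi>)"
      by (intro integral_mono int gap a)
    finally have small: "(\<integral>z. (norm (T *v fst z - snd z))\<^sup>2 \<partial>\<pi>) < \<epsilon>"
      using g a by (smt (verit) mult_le_cancel_left_pos)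
    define \<sigma> where "\<sigma> = distr \<pi> (borel \<Otimes>\<^sub>M borel) (\<lambda>z. (T *v fst z, snd z))"
    have \<mu>\<pi>: "\<mu> = distr \<pi> borel fst" "\<nu> = distr \<pi> borel snd" "prob_space \<pi>" using \<pi> by (auto simp: couplings_def)
    have \<sigma>: "\<sigma> \<in> couplings (distr \<mu> borel ((*v) T)) \<nu>"
      unfolding couplings_def \<sigma>_def \<mu>\<pi>(1,2)
      by (simp add: prob_space.prob_space_distr[OF \<mu>\<pi>(3)] distr_distr o_def)
    have "W2_sq (distr \<mu> borel ((*v) T)) \<nu> \<le> (\<integral>\<^sup>+ (x, y). ennreal ((norm (x - y))\<^sup>2) \<partial>\<sigma>)"
      unfolding W2_sq_def by (rule INF_lower[OF \<sigma>])
    also have "\<dots> = (\<integral>\<^sup>+ z. ennreal ((norm (T *v fst z - snd z))\<^sup>2) \<partial>\<pi>)"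
      unfolding \<sigma>_def by (subst nn_integral_distr) (simp_all add: case_prod_beta')
    also have "\<dots> = ennreal (\<integral>z. (norm (T *v fst z - snd z))\<^sup>2 \<partial>\<pi>)"
      by (rule nn_integral_eq_integral[OF int']) simp
    also have "\<dots> \<le> ennreal \<epsilon>" using small by (intro ennreal_leI) simp
    finally show ?thesis .
  qed
  then have "W2_sq (distr \<mu> borel ((*v) T)) \<nu> \<le> 0" by - (rule ennreal_le_epsilon[where y = 0], simp)
  then show "W2_sq (distr \<mu> borel ((*v) T)) \<nu> = 0" by simp
qed

section \<open>Optimality from linear transport maps\<close>

lemma ereal_sum_eq_imp_terms_eq:
  fixes f :: "'i \<Rightarrow> ereal" and r :: "'i \<Rightarrow> real"
  assumes "finite I" and le: "\<And>i. i \<in> I \<Longrightarrow> ereal (r i) \<le> f i" and eq: "sum f I = ereal (sum r I)" and j: "j \<in> I"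
  shows "f j = ereal (r j)"
proof -
  have fin: "f i \<noteq> \<infinity>" if "i \<in> I" for i
  proof
    assume "f i = \<infinity>"
    then have "sum f I = \<infinity>" using \<open>finite I\<close> that sum_Pinfty by blast
    then show False using eq by simp
  qed
  define g where "g i = real_of_ereal (f i)" for i
  have f: "f i = ereal (g i)" if "i \<in> I" for i
    using fin[OF that] le[OF that] unfolding g_def by (cases "f i") auto
  then have "sum f I = (\<Sum>i\<in>I. ereal (g i))" by simp
  then have "sum g I = sum r I" using eq by simp
  then have "(\<Sum>i\<in>I. g i - r i) = 0" by (simp add: sum_subtractf)
  moreover have "\<And>i. i \<in> I \<Longrightarrow> 0 \<le> g i - r i" using f le by fastforce
  ultimately have "g j - r j = 0" using \<open>finite I\<close> j by (simp add: sum_nonneg_eq_0_iff)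
  then show ?thesis using f[OF j] by simp
qed

text \<open>The assumption on \<open>E\<close> says that \<open>- \<langle>x, K x\<rangle> / 2\<close> is a subgradient of \<open>E\<close> at \<open>\<mu>\<close>. The dual bounds for
  the transport terms add up to \<open>\<integral>\<langle>x, K x\<rangle> d\<nu> / 2\<close> plus a constant \<open>\<beta>\<close>, because \<open>\<Sum> w\<^sub>i (I - T\<^sub>i) = K\<close>. The
  two quadratic terms cancel in the total cost.\<close>
theorem linear_transport_barycenter:
  fixes T :: "nat \<Rightarrow> real ^ 'n ^ 'n" and w :: "nat \<Rightarrow> real" and e :: real
  assumes \<mu>: "\<mu> \<in> P2"
    and w: "\<And>i. i \<in> {1..n} \<Longrightarrow> 0 \<le> w i" "(\<Sum>i = 1..n. w i) = 1"
    and T: "\<And>i. i \<in> {1..n} \<Longrightarrow> T i \<in> spd"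
    and \<mu>s: "\<And>i. i \<in> {1..n} \<Longrightarrow> \<mu>s i = distr \<mu> borel ((*v) (T i))"
    and sumT: "(\<Sum>i = 1..n. w i *\<^sub>R T i) = mat 1 - K"
    and E\<mu>: "E \<mu> = ereal e"
    and E: "\<And>\<nu>. \<nu> \<in> P2 \<Longrightarrow>
      ereal (e + (\<integral>x. x \<bullet> (K *v x) \<partial>\<mu>) / 2 - (\<integral>x. x \<bullet> (K *v x) \<partial>\<nu>) / 2) \<le> E \<nu>"
  shows "is_arg_min (\<lambda>\<nu>. barycenter_cost n w \<mu>s \<nu> + E \<nu>) (\<lambda>\<nu>. \<nu> \<in> P2) \<mu>"
    and "is_arg_min (\<lambda>\<nu>. barycenter_cost n w \<mu>s \<nu> + E \<nu>) (\<lambda>\<nu>. \<nu> \<in> P2) \<nu>' \<Longrightarrow> \<nu>' = \<mu>"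
proof -
  let ?I = "{1..n}"
  let ?cost = "\<lambda>\<nu>. barycenter_cost n w \<mu>s \<nu> + E \<nu>"
  define D where "D \<nu> = (\<Sum>i = 1..n. 1 / 2 * w i * dual_value (T i) \<nu> (\<mu>s i))" for \<nu>
  define Q where "Q \<nu> = (\<integral>x. x \<bullet> (K *v x) \<partial>\<nu>) / 2" for \<nu>
  have \<mu>sP: "\<mu>s i \<in> P2" if "i \<in> ?I" for i using \<mu>s[OF that] P2_distr_linear[OF \<mu>] by simp
  have Ksum: "K = (\<Sum>i = 1..n. w i *\<^sub>R (mat 1 - T i))"
    using sumT by (simp add: scaleR_diff_right sum_subtractf scaleR_left.sum[symmetric] w(2) del: One_nat_def)
  define \<beta> where "\<beta> = (\<Sum>i = 1..n. 1 / 2 * w i * (\<integral>y. y \<bullet> ((mat 1 - matrix_inv (T i)) *v y) \<partial>\<mu>s i))"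
  have DQ: "D \<nu> = Q \<nu> + \<beta>" if \<nu>: "\<nu> \<in> P2" for \<nu>
  proof -
    have Kx: "K *v x = (\<Sum>i = 1..n. w i *\<^sub>R ((mat 1 - T i) *v x))" for x
      unfolding Ksum by (induction n) (simp_all add: matrix_vector_mult_add_rdistrib scaleR_matrix_vector del: scaleR_scaleR)
    have "(\<integral>x. x \<bullet> (K *v x) \<partial>\<nu>) = (\<integral>x. (\<Sum>i = 1..n. w i * (x \<bullet> ((mat 1 - T i) *v x))) \<partial>\<nu>)"
      by (simp add: Kx inner_sum_right)
    also have "\<dots> = (\<Sum>i = 1..n. w i * (\<integral>x. x \<bullet> ((mat 1 - T i) *v x) \<partial>\<nu>))"
      by (subst Bochner_Integration.integral_sum) (auto intro: integrable_quadratic_form[OF \<nu>])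
    finally show ?thesis
      by (simp add: D_def Q_def \<beta>_def dual_value_def distrib_left sum.distrib sum_divide_distrib)
  qed
  have term_le: "ereal (1 / 2 * w i * dual_value (T i) \<nu> (\<mu>s i)) \<le> ereal (1 / 2 * w i) * enn2ereal (W2_sq \<nu> (\<mu>s i))"
    if \<nu>: "\<nu> \<in> P2" and i: "i \<in> ?I" for \<nu> i
    using ereal_mult_left_mono[OF W2_sq_ge_dual_value[OF T[OF i] \<nu> \<mu>sP[OF i]], of "ereal (1 / 2 * w i)"] w(1)[OF i]
    by simp
  have bary: "ereal (D \<nu>) \<le> barycenter_cost n w \<mu>s \<nu>" if "\<nu> \<in> P2" for \<nu>
  proof -
    have "ereal (D \<nu>) = (\<Sum>i = 1..n. ereal (1 / 2 * w i * dual_value (T i) \<nu> (\<mu>s i)))" by (simp add: D_def)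
    also have "\<dots> \<le> barycenter_cost n w \<mu>s \<nu>" unfolding barycenter_cost_def by (intro sum_mono term_le that)
    finally show ?thesis .
  qed
  have bary\<mu>: "barycenter_cost n w \<mu>s \<mu> = ereal (D \<mu>)"
  proof -
    have "barycenter_cost n w \<mu>s \<mu> = (\<Sum>i = 1..n. ereal (1 / 2 * w i * dual_value (T i) \<mu> (\<mu>s i)))"
      unfolding barycenter_cost_def
      by (intro sum.cong refl) (simp add: \<mu>s W2_sq_linear_image[OF T \<mu>] del: One_nat_def)
    then show ?thesis by (simp add: D_def)
  qed
  have cost\<mu>: "?cost \<mu> = ereal (\<beta> + e + Q \<mu>)"
    using bary\<mu> E\<mu> DQ[OF \<mu>] by (simp add: algebra_simps)
  have E': "ereal (e + Q \<mu> - Q \<nu>) \<le> E \<nu>" if "\<nu> \<in> P2" for \<nu> using E[OF that] by (simp add: Q_def)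
  have lower: "ereal (\<beta> + e + Q \<mu>) \<le> ?cost \<nu>" if "\<nu> \<in> P2" for \<nu>
    using add_mono[OF bary[OF that] E'[OF that]] DQ[OF that] by (simp add: algebra_simps)
  show min: "is_arg_min ?cost (\<lambda>\<nu>. \<nu> \<in> P2) \<mu>"
    using lower cost\<mu> \<mu> by (auto simp: is_arg_min_def not_less)
  assume "is_arg_min ?cost (\<lambda>\<nu>. \<nu> \<in> P2) \<nu>'"
  then have \<nu>': "\<nu>' \<in> P2" and "?cost \<nu>' \<le> ?cost \<mu>" using \<mu> by (auto simp: is_arg_min_def not_less)
  then have "barycenter_cost n w \<mu>s \<nu>' + E \<nu>' \<le> ereal (D \<nu>' + (e + Q \<mu> - Q \<nu>'))"
    using cost\<mu> DQ[OF \<nu>'] by (simp add: algebra_simps)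
  \<comment> \<open>Both summands of the cost are bounded below, and the bounds add up to the minimum, so both are attained.\<close>
  then have "barycenter_cost n w \<mu>s \<nu>' = ereal (D \<nu>')"
    using bary[OF \<nu>'] E'[OF \<nu>']
    by (cases "barycenter_cost n w \<mu>s \<nu>'"; cases "E \<nu>'") auto
  then have eq: "(\<Sum>i = 1..n. ereal (1 / 2 * w i) * enn2ereal (W2_sq \<nu>' (\<mu>s i))) =
      ereal (\<Sum>i = 1..n. 1 / 2 * w i * dual_value (T i) \<nu>' (\<mu>s i))"
    by (simp add: barycenter_cost_def D_def)
  obtain j where j: "j \<in> ?I" "0 < w j"
  proof -
    have "\<exists>j\<in>?I. w j \<noteq> 0"
    proof (rule ccontr)
      assume "\<not> ?thesis"
      then have "(\<Sum>i = 1..n. w i) = 0" by (intro sum.neutral) auto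
      then show False using w(2) by simp
    qed
    then show ?thesis using that w(1) by (metis less_eq_real_def)
  qed
  have "ereal (1 / 2 * w j) * enn2ereal (W2_sq \<nu>' (\<mu>s j)) = ereal (1 / 2 * w j * dual_value (T j) \<nu>' (\<mu>s j))"
    by (rule ereal_sum_eq_imp_terms_eq[OF _ term_le[OF \<nu>'] eq j(1)]) simp_all
  then have "enn2ereal (W2_sq \<nu>' (\<mu>s j)) = ereal (dual_value (T j) \<nu>' (\<mu>s j))"
    using j(2) by (cases "enn2ereal (W2_sq \<nu>' (\<mu>s j))") auto
  then have "distr \<nu>' borel ((*v) (T j)) = distr \<mu> borel ((*v) (T j))"
    using W2_sq_eq_dual_value_imp[OF T[OF j(1)] \<nu>' \<mu>sP[OF j(1)]] \<mu>s[OF j(1)] by simp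
  then have "distr (distr \<nu>' borel ((*v) (T j))) borel ((*v) (matrix_inv (T j))) =
      distr (distr \<mu> borel ((*v) (T j))) borel ((*v) (matrix_inv (T j)))" by simp
  moreover have "distr (distr \<nu> borel ((*v) (T j))) borel ((*v) (matrix_inv (T j))) = \<nu>" if "\<nu> \<in> P2" for \<nu>
  proof -
    have [measurable_cong]: "sets \<nu> = sets borel" using that by (simp add: P2_def)
    have "distr (distr \<nu> borel ((*v) (T j))) borel ((*v) (matrix_inv (T j))) = distr \<nu> borel (\<lambda>x. x)"
      using matrix_inv_left[OF spd_invertible[OF T[OF j(1)]]]
      by (subst distr_distr) (auto simp: o_def matrix_vector_mul_assoc)
    then show ?thesis using distr_id2[OF \<open>sets \<nu> = sets borel\<close>[symmetric]] by simp
  qed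
  ultimately show "\<nu>' = \<mu>" using \<nu>' \<mu> by simp
qed

section \<open>Linear images of Lebesgue measure\<close>

lemma matrix_vector_mult_borel [measurable]: "(*v) (M :: real ^ 'n ^ 'm) \<in> borel_measurable borel"
  using matrix_vector_mult_linear_continuous_on borel_measurable_continuous_onI by auto

lemma lborel_distr_translation: "distr lborel borel (\<lambda>x :: 'a::euclidean_space. a + x) = lborel"
  using lborel_affine[of 1 a] by (simp add: density_1)

lemma lborel_distr_reflect: "distr lborel borel (\<lambda>x :: 'a::euclidean_space. a - x) = lborel"
  using lborel_affine[of "-1" a] by (simp add: density_1)

text \<open>Uniqueness of Haar measure. Both sides equal the integral of \<open>1\<^sub>A(x) 1\<^sub>B(x - y)\<close> with respect to
  \<open>\<mu>(dx) dy\<close>: integrating over \<open>y\<close> first gives the left-hand side; after exchanging the order of integration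
  and translating \<open>x\<close> by \<open>y\<close>, it gives the right-hand side.\<close>
lemma translation_invariant_proportional:
  fixes \<mu> :: "('a :: euclidean_space) measure"
  assumes sf: "sigma_finite_measure \<mu>" and [measurable_cong]: "sets \<mu> = sets borel"
    and inv: "\<And>a. distr \<mu> borel (\<lambda>x. a + x) = \<mu>"
    and A [measurable]: "A \<in> sets borel" and B [measurable]: "B \<in> sets borel"
  shows "emeasure \<mu> A * emeasure lborel B = emeasure \<mu> B * emeasure lborel A"
proof -
  interpret sigma_finite_measure \<mu> by (rule sf)
  interpret pair_sigma_finite \<mu> "lborel :: 'a measure"
    by (simp add: pair_sigma_finite_def sf sigma_finite_lborel)
  have lr: "(\<integral>\<^sup>+ y. f y \<partial>lborel) = (\<integral>\<^sup>+ y. f (a - y) \<partial>lborel)" if "f \<in> borel_measurable borel" for f :: "'a \<Rightarrow> ennreal" and a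
  proof -
    have "(\<integral>\<^sup>+ y. f y \<partial>lborel) = (\<integral>\<^sup>+ y. f y \<partial>distr lborel borel (\<lambda>x. a - x))"
      by (simp add: lborel_distr_reflect)
    also have "\<dots> = (\<integral>\<^sup>+ y. f (a - y) \<partial>lborel)"
      by (rule nn_integral_distr) (use that in measurable)
    finally show ?thesis .
  qed
  have mt: "(\<integral>\<^sup>+ x. f x \<partial>\<mu>) = (\<integral>\<^sup>+ x. f (a + x) \<partial>\<mu>)" if "f \<in> borel_measurable borel" for f :: "'a \<Rightarrow> ennreal" and a
  proof -
    have "(\<integral>\<^sup>+ x. f x \<partial>\<mu>) = (\<integral>\<^sup>+ x. f x \<partial>distr \<mu> borel (\<lambda>x. a + x))"
      by (simp add: inv)
    also have "\<dots> = (\<integral>\<^sup>+ x. f (a + x) \<partial>\<mu>)"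
      by (rule nn_integral_distr) (use that in measurable)
    finally show ?thesis .
  qed
  let ?i = "indicator :: 'a set \<Rightarrow> 'a \<Rightarrow> ennreal"
  have "emeasure \<mu> A * emeasure lborel B = (\<integral>\<^sup>+ x. ?i A x * emeasure lborel B \<partial>\<mu>)"
    by (simp add: nn_integral_multc)
  also have "\<dots> = (\<integral>\<^sup>+ x. (\<integral>\<^sup>+ y. ?i A x * ?i B y \<partial>lborel) \<partial>\<mu>)"
    by (simp add: nn_integral_cmult)
  also have "\<dots> = (\<integral>\<^sup>+ x. (\<integral>\<^sup>+ y. ?i A x * ?i B (x - y) \<partial>lborel) \<partial>\<mu>)"
    by (intro nn_integral_cong lr) measurable
  also have "\<dots> = (\<integral>\<^sup>+ y. (\<integral>\<^sup>+ x. ?i A x * ?i B (x - y) \<partial>\<mu>) \<partial>lborel)"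
    by (rule Fubini'[symmetric]) measurable
  also have "\<dots> = (\<integral>\<^sup>+ y. (\<integral>\<^sup>+ x. ?i A (y + x) * ?i B ((y + x) - y) \<partial>\<mu>) \<partial>lborel)"
    by (intro nn_integral_cong mt) measurable
  also have "\<dots> = (\<integral>\<^sup>+ x. (\<integral>\<^sup>+ y. ?i A (y + x) * ?i B x \<partial>lborel) \<partial>\<mu>)"
    by (subst Fubini') (simp_all, measurable)
  also have "\<dots> = (\<integral>\<^sup>+ x. emeasure lborel A * ?i B x \<partial>\<mu>)"
  proof (rule nn_integral_cong)
    fix x
    have "(\<integral>\<^sup>+ y. ?i A (y + x) * ?i B x \<partial>lborel) = (\<integral>\<^sup>+ y. ?i A (x + y) \<partial>lborel) * ?i B x"
      by (simp add: nn_integral_multc add.commute)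
    also have "(\<integral>\<^sup>+ y. ?i A (x + y) \<partial>lborel) = (\<integral>\<^sup>+ y. ?i A y \<partial>distr lborel borel (\<lambda>y. x + y))"
      by (rule nn_integral_distr[symmetric]) measurable
    also have "\<dots> = emeasure lborel A" by (simp add: lborel_distr_translation)
    finally show "(\<integral>\<^sup>+ y. ?i A (y + x) * ?i B x \<partial>lborel) = emeasure lborel A * ?i B x" .
  qed
  also have "\<dots> = emeasure \<mu> B * emeasure lborel A" by (simp add: nn_integral_cmult) (simp add: mult.commute)
  finally show ?thesis .
qed

text \<open>The density of the image of Lebesgue measure under \<open>M\<close>, that is, the reciprocal of the factor by which
  \<open>M\<close> scales volumes. Since the image is a multiple of Lebesgue measure, one test set is enough.\<close>
definition image_density :: "real ^ 'n ^ 'n \<Rightarrow> real" where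
  "image_density M = measure lborel ((*v) M -` ball 0 1) / measure lborel (ball (0 :: real ^ 'n) 1)"

text \<open>The image of Lebesgue measure is translation invariant and hence a multiple of Lebesgue measure.\<close>
lemma lborel_distr_matrix_density:
  fixes M :: "real ^ 'n ^ 'n"
  assumes M: "invertible M"
  shows "distr lborel borel ((*v) M) = density lborel (\<lambda>_. ennreal (image_density M))" and "0 < image_density M"
proof -
  let ?\<mu> = "distr lborel borel ((*v) M)"
  let ?J = "matrix_inv M"
  note J = matrix_inv_mult[OF M]
  have MJ [simp]: "M *v (?J *v x) = x" "?J *v (M *v x) = x" for x by (simp_all add: matrix_vector_mul_assoc J)
  have pre: "(*v) M -` A = (*v) ?J ` A" for A
  proof (intro set_eqI iffI)
    fix x assume "x \<in> (*v) M -` A"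
    then show "x \<in> (*v) ?J ` A" using MJ(2)[of x] by (intro image_eqI[of _ _ "M *v x"]) auto
  qed auto
  have m: "(*v) M \<in> borel_measurable borel" "(*v) M \<in> borel_measurable lborel" by simp_all
  have fin: "emeasure ?\<mu> (ball 0 r) < \<infinity>" for r
  proof -
    have "emeasure ?\<mu> (ball 0 r) = emeasure lborel ((*v) ?J ` ball 0 r)"
      using m by (simp add: emeasure_distr pre)
    moreover have "bounded ((*v) ?J ` ball 0 r)"
      by (rule bounded_linear_image) (auto intro: matrix_vector_mul_bounded_linear)
    ultimately show ?thesis using emeasure_bounded_finite[of "(*v) ?J ` ball 0 r"] by simp
  qed
  have sf: "sigma_finite_measure ?\<mu>"
  proof
    show "\<exists>A. countable A \<and> A \<subseteq> sets ?\<mu> \<and> \<Union> A = space ?\<mu> \<and> (\<forall>a\<in>A. emeasure ?\<mu> a \<noteq> \<infinity>)"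
    proof (intro exI[of _ "range (\<lambda>n::nat. ball 0 (real n))"] conjI)
      show "\<Union> (range (\<lambda>n::nat. ball 0 (real n))) = space ?\<mu>"
        using reals_Archimedean2 by (auto simp: space_distr)
      show "\<forall>a\<in>range (\<lambda>n::nat. ball 0 (real n)). emeasure ?\<mu> a \<noteq> \<infinity>"
        using fin by (auto simp: less_top)
    qed auto
  qed
  have inv: "distr ?\<mu> borel (\<lambda>x. a + x) = ?\<mu>" for a
  proof -
    have "distr ?\<mu> borel (\<lambda>x. a + x) = distr lborel borel (\<lambda>x. a + M *v x)"
      using m by (subst distr_distr) (auto simp: o_def)
    also have "\<dots> = distr lborel borel (\<lambda>x. M *v (?J *v a + x))"
      by (simp add: matrix_vector_right_distrib)
    also have "\<dots> = distr (distr lborel borel (\<lambda>x. ?J *v a + x)) borel ((*v) M)"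
      using m by (subst distr_distr) (auto simp: o_def)
    finally show ?thesis by (simp add: lborel_distr_translation)
  qed
  let ?B = "ball (0 :: real ^ 'n) 1"
  have B: "emeasure lborel ?B = ennreal (measure lborel ?B)" "0 < measure lborel ?B"
    using emeasure_bounded_finite[OF bounded_ball[of "0 :: real ^ 'n" 1]]
    by (simp_all add: emeasure_eq_ennreal_measure content_ball_pos)
  have MB: "emeasure ?\<mu> ?B = ennreal (measure lborel ((*v) M -` ?B))"
  proof -
    have "emeasure ?\<mu> ?B = emeasure lborel ((*v) M -` ?B)" using m by (simp add: emeasure_distr)
    then show ?thesis using fin[of 1] by (simp add: emeasure_eq_ennreal_measure)
  qed
  have eq: "emeasure ?\<mu> A = ennreal (image_density M) * emeasure lborel A" if A: "A \<in> sets borel" for A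
  proof -
    have "emeasure ?\<mu> A * emeasure lborel ?B = emeasure ?\<mu> ?B * emeasure lborel A"
      by (rule translation_invariant_proportional[OF sf _ inv A]) auto
    then have "emeasure ?\<mu> A * ennreal (measure lborel ?B) * ennreal (1 / measure lborel ?B) =
        ennreal (measure lborel ((*v) M -` ?B)) * ennreal (1 / measure lborel ?B) * emeasure lborel A"
      by (simp add: B MB mult.commute mult.left_commute)
    then show ?thesis
      using B(2) by (simp add: image_density_def mult.assoc ennreal_mult[symmetric])
  qed
  show "?\<mu> = density lborel (\<lambda>_. ennreal (image_density M))"
    by (rule measure_eqI) (simp_all add: emeasure_density_const eq)
  have "image_density M \<noteq> 0"
  proof
    assume "image_density M = 0"
    then have "emeasure ?\<mu> UNIV = 0" using eq[of UNIV] by simp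
    moreover have "emeasure ?\<mu> UNIV = emeasure lborel (UNIV :: (real ^ 'n) set)" using m by (simp add: emeasure_distr)
    ultimately show False by simp
  qed
  moreover have "0 \<le> image_density M" by (simp add: image_density_def)
  ultimately show "0 < image_density M" by simp
qed

lemma image_density_eqI:
  fixes M :: "real ^ 'n ^ 'n"
  assumes "distr lborel borel ((*v) M) = density lborel (\<lambda>_. ennreal c)" "0 \<le> c"
  shows "image_density M = c"
proof -
  have m: "(*v) M \<in> borel_measurable borel" "(*v) M \<in> borel_measurable lborel" by simp_all
  have "measure (distr lborel borel ((*v) M)) (ball 0 1) = measure (density lborel (\<lambda>_. ennreal c)) (ball (0 :: real ^ 'n) 1)"
    using assms by simp
  then have "measure lborel ((*v) M -` ball 0 1) = c * measure lborel (ball (0 :: real ^ 'n) 1)"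
    using m assms(2) by (simp add: measure_distr measure_density_const)
  then show ?thesis by (simp add: image_density_def content_ball_pos less_imp_neq[symmetric])
qed

lemma invertible_matrix_mult: "invertible (A :: real ^ 'n ^ 'n) \<Longrightarrow> invertible B \<Longrightarrow> invertible (A ** (B :: real ^ 'n ^ 'n))"
  by (auto simp add: invertible_det_nz det_mul)

lemma image_density_mult:
  fixes A B :: "real ^ 'n ^ 'n"
  assumes A: "invertible A" and B: "invertible B"
  shows "image_density (A ** B) = image_density A * image_density B"
proof (rule image_density_eqI)
  show "distr lborel borel ((*v) (A ** B)) = density lborel (\<lambda>_. ennreal (image_density A * image_density B))"
  proof (rule measure_eqI)
    fix X assume "X \<in> sets (distr lborel borel ((*v) (A ** B)))"
    then have X [measurable]: "X \<in> sets borel" by simp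
    have dA: "emeasure lborel ((*v) A -` X) = ennreal (image_density A) * emeasure lborel X" if "X \<in> sets borel" "invertible A"
      for X and A :: "real ^ 'n ^ 'n"
    proof -
      have "emeasure (distr lborel borel ((*v) A)) X = emeasure (density lborel (\<lambda>_. ennreal (image_density A))) X"
        using lborel_distr_matrix_density[OF that(2)] by simp
      then show ?thesis using that(1) by (simp add: emeasure_distr emeasure_density_const)
    qed
    have AX: "(*v) A -` X \<in> sets borel"
      by (rule measurable_sets_borel[OF matrix_vector_mult_borel X])
    have "emeasure (distr lborel borel ((*v) (A ** B))) X = emeasure lborel ((*v) B -` ((*v) A -` X))"
      by (simp add: emeasure_distr vimage_def matrix_vector_mul_assoc)
    also have "\<dots> = ennreal (image_density B) * (ennreal (image_density A) * emeasure lborel X)"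
      using dA[of "(*v) A -` X" B] dA[of X A] A B X AX by simp
    finally show "emeasure (distr lborel borel ((*v) (A ** B))) X =
        emeasure (density lborel (\<lambda>_. ennreal (image_density A * image_density B))) X"
      using lborel_distr_matrix_density(2)[OF A] lborel_distr_matrix_density(2)[OF B]
      by (simp add: emeasure_density_const ennreal_mult mult_ac)
  qed simp
qed (use lborel_distr_matrix_density(2)[OF A] lborel_distr_matrix_density(2)[OF B] in simp)

lemma image_density_1: "image_density (mat 1 :: real ^ 'n ^ 'n) = 1"
proof (rule image_density_eqI)
  have "(*v) (mat 1) = (\<lambda>x :: real ^ 'n. x)" by auto
  then show "distr lborel borel ((*v) (mat 1 :: real ^ 'n ^ 'n)) = density lborel (\<lambda>_. ennreal 1)"
    by (simp add: density_1 distr_id2)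
qed simp

lemma image_density_diagonal:
  fixes A :: "real ^ 'n ^ 'n"
  assumes d: "\<And>i j. i \<noteq> j \<Longrightarrow> A $ i $ j = 0" and inv: "invertible A"
  shows "image_density A = 1 / \<bar>det A\<bar>"
proof (rule image_density_eqI)
  have det: "det A = (\<Prod>i\<in>UNIV. A $ i $ i)" using d by (rule det_diagonal)
  have nz: "A $ i $ i \<noteq> 0" for i using inv by (auto simp: invertible_det_nz det)
  define c where "c b = b \<bullet> (A *v b)" for b :: "real ^ 'n"
  have Bas: "(Basis :: (real ^ 'n) set) = range (\<lambda>i. axis i 1)" and inj: "inj (\<lambda>i :: 'n. axis i (1 :: real))"
    by (auto simp: Basis_vec_def inj_on_def axis_eq_axis)
  have cA: "c (axis i 1) = A $ i $ i" for i
    by (simp add: c_def inner_axis' matrix_vector_mult_basis column_def)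
  have Ax: "A *v x = (\<Sum>j\<in>Basis. (c j * (x \<bullet> j)) *\<^sub>R j)" for x
  proof -
    have "(A *v x) $ i = A $ i $ i * x $ i" for i
    proof -
      have "(A *v x) $ i = (\<Sum>j\<in>UNIV. if j = i then A $ i $ i * x $ i else 0)"
        unfolding matrix_vector_mult_def vec_lambda_beta by (intro sum.cong) (auto simp: d)
      then show ?thesis by simp
    qed
    moreover have "(\<Sum>j\<in>Basis. (c j * (x \<bullet> j)) *\<^sub>R j) $ i = A $ i $ i * x $ i" for i
    proof -
      have "(\<Sum>j\<in>Basis. (c j * (x \<bullet> j)) *\<^sub>R j) = (\<Sum>k\<in>UNIV. (A $ k $ k * x $ k) *\<^sub>R axis k 1)"
        unfolding Bas by (subst sum.reindex[OF inj]) (simp add: cA inner_axis)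
      also have "\<dots> $ i = (\<Sum>k\<in>UNIV. if k = i then A $ i $ i * x $ i else 0)"
        unfolding sum_component by (intro sum.cong) (auto simp: axis_def)
      finally show ?thesis by simp
    qed
    ultimately show ?thesis by (simp add: vec_eq_iff)
  qed
  have "(\<Prod>j\<in>Basis. \<bar>c j\<bar>) = \<bar>det A\<bar>"
    unfolding Bas by (subst prod.reindex[OF inj]) (simp add: cA det abs_prod)
  moreover have "\<And>j. j \<in> Basis \<Longrightarrow> c j \<noteq> 0" unfolding Bas using nz cA by auto
  moreover have "(\<lambda>x. 0 + (\<Sum>j\<in>Basis. (c j * (x \<bullet> j)) *\<^sub>R j)) = (*v) A" by (simp add: Ax fun_eq_iff)
  ultimately have eq: "lborel = density (distr lborel borel ((*v) A)) (\<lambda>_. ennreal \<bar>det A\<bar>)"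
    using lborel_affine_euclidean[of c 0] by metis
  have dnz: "det A \<noteq> 0" using inv by (simp add: invertible_det_nz)
  have "density lborel (\<lambda>_. ennreal (1 / \<bar>det A\<bar>)) =
      density (density (distr lborel borel ((*v) A)) (\<lambda>_. ennreal \<bar>det A\<bar>)) (\<lambda>_. ennreal (1 / \<bar>det A\<bar>))"
    using eq by simp
  also have "\<dots> = density (distr lborel borel ((*v) A)) (\<lambda>_. ennreal \<bar>det A\<bar> * ennreal (1 / \<bar>det A\<bar>))"
    by (rule density_density_eq) auto
  also have "\<dots> = distr lborel borel ((*v) A)"
    using dnz by (simp add: ennreal_mult[symmetric] density_1)
  finally show "distr lborel borel ((*v) A) = density lborel (\<lambda>_. ennreal (1 / \<bar>det A\<bar>))" by simp
qed simp

text \<open>Both sides are multiplicative and agree on diagonal matrices, so it suffices to compare them on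
  transpositions and shears, where both are \<open>1\<close>. A transposition is an involution. A shear \<open>E\<^sub>c\<close> is
  conjugate to \<open>E\<^sub>2\<^sub>c = E\<^sub>c\<^sup>2\<close> by a diagonal matrix, so the value \<open>z\<close> of a multiplicative function at \<open>E\<^sub>c\<close>
  satisfies \<open>z = z\<^sup>2\<close>.\<close>
theorem image_density_eq_det:
  fixes A :: "real ^ 'n ^ 'n"
  assumes "invertible A"
  shows "image_density A = 1 / \<bar>det A\<bar>"
proof -
  have "invertible A \<longrightarrow> image_density A = 1 / \<bar>det A\<bar>"
  proof (rule induct_matrix_elementary[of "\<lambda>A. invertible A \<longrightarrow> image_density A = 1 / \<bar>det A\<bar>"])
    fix A B :: "real ^ 'n ^ 'n"
    assume P: "invertible A \<longrightarrow> image_density A = 1 / \<bar>det A\<bar>" "invertible B \<longrightarrow> image_density B = 1 / \<bar>det B\<bar>"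
    show "invertible (A ** B) \<longrightarrow> image_density (A ** B) = 1 / \<bar>det (A ** B)\<bar>"
    proof
      assume "invertible (A ** B)"
      then have "invertible A" "invertible B" by (auto simp: invertible_det_nz det_mul)
      then show "image_density (A ** B) = 1 / \<bar>det (A ** B)\<bar>"
        using P by (simp add: image_density_mult det_mul abs_mult)
    qed
  next
    fix A :: "real ^ 'n ^ 'n" and i assume "row i A = 0"
    then have "det A = 0" by (rule det_zero_row)
    then show "invertible A \<longrightarrow> image_density A = 1 / \<bar>det A\<bar>" by (simp add: invertible_det_nz)
  next
    fix A :: "real ^ 'n ^ 'n" assume "\<And>i j. i \<noteq> j \<Longrightarrow> A $ i $ j = 0"
    then show "invertible A \<longrightarrow> image_density A = 1 / \<bar>det A\<bar>" using image_density_diagonal by blast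
  next
    fix m n :: 'n assume "m \<noteq> n"
    define S :: "real ^ 'n ^ 'n" where "S = (\<chi> i j. mat 1 $ i $ Transposition.transpose m n j)"
    have "(S ** S) $ i $ j = mat 1 $ i $ j" for i j
    proof -
      have "(S ** S) $ i $ j = (\<Sum>k\<in>UNIV. if k = Transposition.transpose m n j then (if i = Transposition.transpose m n k then 1 else 0) else 0)"
        unfolding S_def matrix_matrix_mult_def mat_def vec_lambda_beta by (intro sum.cong) auto
      then show ?thesis by (simp add: mat_def)
    qed
    then have SS: "S ** S = mat 1" by (simp add: vec_eq_iff)
    then have inv: "invertible S" by (auto simp: invertible_def)
    have "image_density S * image_density S = 1" "det S * det S = 1"
      using image_density_mult[OF inv inv] det_mul[of S S] by (simp_all add: SS image_density_1)
    moreover have "0 < image_density S" by (rule lborel_distr_matrix_density(2)[OF inv])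
    ultimately have "image_density S = 1" "\<bar>det S\<bar> = 1"
      by (auto simp: square_eq_1_iff)
    then have "invertible S \<longrightarrow> image_density S = 1 / \<bar>det S\<bar>" by simp
    then show "invertible ((\<chi> i j. mat 1 $ i $ Transposition.transpose m n j) :: real ^ 'n ^ 'n) \<longrightarrow>
        image_density ((\<chi> i j. mat 1 $ i $ Transposition.transpose m n j) :: real ^ 'n ^ 'n) =
        1 / \<bar>det ((\<chi> i j. mat 1 $ i $ Transposition.transpose m n j) :: real ^ 'n ^ 'n)\<bar>"
      unfolding S_def .
  next
    fix m n :: 'n and c :: real assume mn: "m \<noteq> n"
    define E :: "real \<Rightarrow> real ^ 'n ^ 'n" where "E c = (\<chi> i j. if i = m \<and> j = n then c else of_bool (i = j))" for c
    define D :: "real \<Rightarrow> real ^ 'n ^ 'n" where "D a = (\<chi> i j. if i = j then (if i = n then a else 1) else 0)" for a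
    have EE: "E a ** E b = E (a + b)" for a b
    proof -
      have "(E a ** E b) $ i $ j = E (a + b) $ i $ j" for i j
      proof -
        have "(E a ** E b) $ i $ j = (\<Sum>k\<in>UNIV. (if k = i then E b $ k $ j else 0) + (if k = n then (if i = m then a * E b $ n $ j else 0) else 0))"
          unfolding E_def matrix_matrix_mult_def vec_lambda_beta using mn by (intro sum.cong) auto
        also have "\<dots> = E b $ i $ j + (if i = m then a * E b $ n $ j else 0)" by (simp add: sum.distrib)
        also have "\<dots> = E (a + b) $ i $ j" using mn by (auto simp: E_def)
        finally show ?thesis .
      qed
      then show ?thesis by (simp add: vec_eq_iff)
    qed
    have E0: "E 0 = mat 1" using mn by (auto simp: E_def mat_def vec_eq_iff)
    have invE: "invertible (E a)" for a
      using EE[of a "-a"] EE[of "-a" a] by (auto simp: invertible_def E0)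
    have DM: "(D a ** M) $ i $ j = (if i = n then a * M $ i $ j else M $ i $ j)" for a M i j
    proof -
      have "(D a ** M) $ i $ j = (\<Sum>k\<in>UNIV. if k = i then (if i = n then a * M $ i $ j else M $ i $ j) else 0)"
        unfolding D_def matrix_matrix_mult_def vec_lambda_beta by (intro sum.cong) auto
      then show ?thesis by simp
    qed
    have MD: "(M ** D a) $ i $ j = (if j = n then a * M $ i $ j else M $ i $ j)" for a M i j
    proof -
      have "(M ** D a) $ i $ j = (\<Sum>k\<in>UNIV. if k = j then (if j = n then a * M $ i $ j else M $ i $ j) else 0)"
        unfolding D_def matrix_matrix_mult_def vec_lambda_beta by (intro sum.cong) auto
      then show ?thesis by simp
    qed
    have DD: "D (1 / 2) ** D 2 = mat 1" "D 2 ** D (1 / 2) = mat 1"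
      by (auto simp: vec_eq_iff DM) (auto simp: D_def mat_def)
    then have invD: "invertible (D 2)" "invertible (D (1 / 2))" by (auto simp: invertible_def)
    have "(D (1 / 2) ** (E c ** D 2)) $ i $ j = E (c + c) $ i $ j" for i j
      unfolding DM MD E_def vec_lambda_beta using mn by (cases "i = n"; cases "j = n"; simp)
    then have conj: "E (c + c) = D (1 / 2) ** (E c ** D 2)" by (simp add: vec_eq_iff)
    have "image_density (D (1 / 2)) * image_density (D 2) = 1" "det (D (1 / 2)) * det (D 2) = 1"
      using image_density_mult[OF invD(2,1)] det_mul[of "D (1 / 2)" "D 2"] by (simp_all add: DD image_density_1)
    moreover have "image_density (E (c + c)) = image_density (D (1 / 2)) * (image_density (E c) * image_density (D 2))"
      unfolding conj by (simp add: image_density_mult invD invE invertible_matrix_mult)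
    moreover have "det (E (c + c)) = det (D (1 / 2)) * (det (E c) * det (D 2))"
      unfolding conj by (simp add: det_mul)
    ultimately have "image_density (E (c + c)) = image_density (E c)" "det (E (c + c)) = det (E c)"
      by (metis mult.commute mult.left_commute mult.right_neutral)+
    then have "image_density (E c) * image_density (E c) = image_density (E c)" "det (E c) * det (E c) = det (E c)"
      unfolding EE[symmetric] by (simp_all add: image_density_mult invE det_mul)
    moreover have "image_density (E c) \<noteq> 0" "det (E c) \<noteq> 0"
      using lborel_distr_matrix_density(2)[OF invE[of c]] invE[of c] by (auto simp: invertible_det_nz)
    ultimately have "image_density (E c) = 1" "det (E c) = 1" by simp_all
    then have "invertible (E c) \<longrightarrow> image_density (E c) = 1 / \<bar>det (E c)\<bar>" by simp
    then show "invertible ((\<chi> i j. if i = m \<and> j = n then c else of_bool (i = j)) :: real ^ 'n ^ 'n) \<longrightarrow>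
        image_density ((\<chi> i j. if i = m \<and> j = n then c else of_bool (i = j)) :: real ^ 'n ^ 'n) =
        1 / \<bar>det ((\<chi> i j. if i = m \<and> j = n then c else of_bool (i = j)) :: real ^ 'n ^ 'n)\<bar>"
      unfolding E_def .
  qed
  then show ?thesis using assms by blast
qed

corollary lborel_distr_matrix:
  fixes M :: "real ^ 'n ^ 'n"
  assumes "invertible M"
  shows "distr lborel borel ((*v) M) = density lborel (\<lambda>_. ennreal (1 / \<bar>det M\<bar>))"
  using lborel_distr_matrix_density(1)[OF assms] image_density_eq_det[OF assms] by simp

section \<open>Elliptic measures\<close>

definition elliptic :: "(real \<Rightarrow> ennreal) \<Rightarrow> real ^ 'n ^ 'n \<Rightarrow> (real ^ 'n) measure" where
  "elliptic f V = density lborel (\<lambda>x. f (x \<bullet> (matrix_inv V *v x)) * ennreal (det V powr (- 1 / 2)))"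

lemma sets_elliptic [simp, measurable_cong]: "sets (elliptic f V) = sets borel"
  by (simp add: elliptic_def)

text \<open>The factor \<open>(det V)\<^sup>-\<^sup>1\<^sup>/\<^sup>2\<close> of the density absorbs the Jacobian determinant.\<close>
lemma distr_elliptic:
  fixes V T :: "real ^ 'n ^ 'n"
  assumes f [measurable]: "f \<in> borel_measurable borel" and V: "V \<in> spd" and T: "invertible T"
  shows "distr (elliptic f V) borel ((*v) T) = elliptic f (T ** V ** transpose T)"
proof -
  define J where "J = matrix_inv T"
  note J = matrix_inv_mult[OF T, folded J_def]
  have JT [simp]: "J *v (T *v x) = x" for x by (simp add: matrix_vector_mul_assoc J)
  define k where "k = ennreal (det V powr (- 1 / 2))"
  define h where "h y = f ((J *v y) \<bullet> (matrix_inv V *v (J *v y))) * k" for y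
  have [measurable]: "h \<in> borel_measurable borel" unfolding h_def by measurable
  have tJ: "transpose T ** transpose J = mat 1"
    using J by (metis matrix_transpose_mul transpose_mat)
  have inv: "matrix_inv (T ** V ** transpose T) = transpose J ** matrix_inv V ** J"
  proof (rule matrix_inv_eqI)
    have "T ** V ** transpose T ** (transpose J ** matrix_inv V ** J) =
        T ** V ** (transpose T ** transpose J) ** matrix_inv V ** J" by (simp add: matrix_mul_assoc)
    also have "\<dots> = T ** (V ** matrix_inv V) ** J" by (simp add: tJ matrix_mul_assoc)
    also have "\<dots> = mat 1" by (simp add: matrix_inv_right[OF spd_invertible[OF V]] J)
    finally show "T ** V ** transpose T ** (transpose J ** matrix_inv V ** J) = mat 1" .
  qed
  have q: "y \<bullet> (matrix_inv (T ** V ** transpose T) *v y) = (J *v y) \<bullet> (matrix_inv V *v (J *v y))" for y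
    using dot_lmul_matrix[of "matrix_inv V *v (J *v y)" J y]
    unfolding inv by (simp add: matrix_vector_mul_assoc[symmetric] inner_commute)
  have dT: "det T \<noteq> 0" using T by (simp add: invertible_det_nz)
  have "det (T ** V ** transpose T) = (det T)\<^sup>2 * det V"
    by (simp add: det_mul det_transpose power2_eq_square)
  then have "det (T ** V ** transpose T) powr (- 1 / 2) = ((det T)\<^sup>2) powr (- 1 / 2) * det V powr (- 1 / 2)"
    using spd_det_pos[OF V] by (simp add: powr_mult)
  also have "((det T)\<^sup>2) powr (- 1 / 2) = 1 / \<bar>det T\<bar>"
  proof -
    have "((det T)\<^sup>2) powr (- 1 / 2) = (\<bar>det T\<bar> powr 2) powr (- 1 / 2)"
      using dT by simp
    also have "\<dots> = \<bar>det T\<bar> powr (-1)" by (subst powr_powr) simp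
    finally show ?thesis using dT by (simp add: powr_minus field_simps)
  qed
  finally have det: "ennreal (det (T ** V ** transpose T) powr (- 1 / 2)) = k * ennreal (1 / \<bar>det T\<bar>)"
    by (simp add: k_def ennreal_mult[symmetric] mult.commute)
  have "elliptic f V = density lborel (\<lambda>x. h (T *v x))"
    by (simp add: elliptic_def h_def k_def)
  then have "distr (elliptic f V) borel ((*v) T) = density (distr lborel borel ((*v) T)) h"
    by (simp add: density_distr)
  also have "\<dots> = density (density lborel (\<lambda>_. ennreal (1 / \<bar>det T\<bar>))) h"
    by (simp add: lborel_distr_matrix[OF T])
  also have "\<dots> = density lborel (\<lambda>y. ennreal (1 / \<bar>det T\<bar>) * h y)"
    by (rule density_density_eq) measurable
  also have "\<dots> = elliptic f (T ** V ** transpose T)"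
    unfolding elliptic_def q det by (simp add: h_def mult_ac)
  finally show ?thesis .
qed

lemma matrix_inv_mat_1: "matrix_inv (mat 1 :: real ^ 'n ^ 'n) = mat 1"
  by (rule matrix_inv_eqI) simp

lemma spd_mat_1: "(mat 1 :: real ^ 'n ^ 'n) \<in> spd"
  by (simp add: spd_def transpose_mat)

lemma elliptic_mat_1: "elliptic f (mat 1 :: real ^ 'n ^ 'n) = density lborel (\<lambda>x. f (x \<bullet> x))"
  by (simp add: elliptic_def matrix_inv_mat_1)

lemma elliptic_eq_distr_mat_1:
  fixes V :: "real ^ 'n ^ 'n"
  assumes "f \<in> borel_measurable borel" "V \<in> spd"
  shows "elliptic f V = distr (elliptic f (mat 1)) borel ((*v) (spd_sqrt V))"
  using distr_elliptic[OF assms(1) spd_mat_1 spd_invertible[OF spd_sqrt_spd[OF assms(2)]]]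
    spd_sqrt[OF assms(2)] by (simp add: spd_def)

lemma distr_elliptic_spd:
  fixes V T :: "real ^ 'n ^ 'n"
  assumes "f \<in> borel_measurable borel" "V \<in> spd" "T \<in> spd"
  shows "distr (elliptic f V) borel ((*v) T) = elliptic f (T ** V ** T)"
  using distr_elliptic[OF assms(1,2) spd_invertible[OF assms(3)]] assms(3) by (simp add: spd_def)

lemma nn_integral_elliptic_mat_1:
  fixes g :: "real ^ 'n \<Rightarrow> ennreal"
  assumes [measurable]: "f \<in> borel_measurable borel" "g \<in> borel_measurable borel"
  shows "(\<integral>\<^sup>+ x. g x \<partial>elliptic f (mat 1)) = (\<integral>\<^sup>+ x. f (x \<bullet> x) * g x \<partial>lborel)"
  unfolding elliptic_mat_1 by (rule nn_integral_density) measurable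

lemma integrable_norm_square_iff:
  fixes \<mu> :: "(real ^ 'n) measure"
  assumes [measurable_cong]: "sets \<mu> = sets borel"
  shows "integrable \<mu> (\<lambda>x. (norm x)\<^sup>2) \<longleftrightarrow> (\<integral>\<^sup>+ x. ennreal (x \<bullet> x) \<partial>\<mu>) < \<infinity>"
  by (auto simp: integrable_iff_bounded power2_norm_eq_inner)

lemma elliptic_P2:
  fixes V :: "real ^ 'n ^ 'n"
  assumes f [measurable]: "f \<in> borel_measurable borel" and V: "V \<in> spd"
    and mass: "(\<integral>\<^sup>+ (x :: real ^ 'n). f (x \<bullet> x) \<partial>lborel) = 1"
    and moment: "(\<integral>\<^sup>+ (x :: real ^ 'n). f (x \<bullet> x) * ennreal (x \<bullet> x) \<partial>lborel) < \<infinity>"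
  shows "elliptic f V \<in> P2"
proof -
  let ?\<rho> = "elliptic f (mat 1) :: (real ^ 'n) measure"
  have "emeasure ?\<rho> (space ?\<rho>) = 1"
    using mass by (simp add: elliptic_mat_1 emeasure_density)
  then have "prob_space ?\<rho>" by (rule prob_spaceI)
  moreover have "integrable ?\<rho> (\<lambda>x. (norm x)\<^sup>2)"
    using moment by (subst integrable_norm_square_iff) (simp_all add: nn_integral_elliptic_mat_1)
  ultimately have "?\<rho> \<in> P2" by (simp add: P2_def)
  then show ?thesis
    unfolding elliptic_eq_distr_mat_1[OF f V] by (rule P2_distr_linear)
qed

section \<open>Radial integrals\<close>

lemma distr_norm_square:
  fixes p \<kappa> :: real
  defines "p \<equiv> real CARD('n) / 2" and "\<kappa> \<equiv> real CARD('n) / 2 * unit_ball_vol (real CARD('n))"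
  shows "distr lborel borel (\<lambda>x :: real ^ 'n. x \<bullet> x) =
     density lborel (\<lambda>r. ennreal (indicator {0..} r * (\<kappa> * r powr (p - 1))))"
proof (rule measure_eqI_generator_eq[where E = "range (\<lambda>a::real. {..a})" and \<Omega> = UNIV and A = "\<lambda>n. {..real n}"])
  let ?L = "distr lborel borel (\<lambda>x :: real ^ 'n. x \<bullet> x)"
  let ?R = "density lborel (\<lambda>r. ennreal (indicator {0..} r * (\<kappa> * r powr (p - 1))))"
  have p: "0 < p" by (simp add: p_def)
  have \<kappa>: "0 \<le> \<kappa>" by (simp add: \<kappa>_def)
  have L: "emeasure ?L {..a} = (if a < 0 then 0 else ennreal (\<kappa> * (a powr p / p)))" for a
  proof -
    have e: "emeasure ?L {..a} = emeasure lborel {x :: real ^ 'n. x \<bullet> x \<le> a}"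
      by (subst emeasure_distr) (auto simp: vimage_def)
    show ?thesis
    proof (cases "a < 0")
      case True
      then have "{x :: real ^ 'n. x \<bullet> x \<le> a} = {}" using inner_ge_zero by (auto simp: not_le intro: less_le_trans)
      then show ?thesis using e True by simp
    next
      case False
      then have "{x :: real ^ 'n. x \<bullet> x \<le> a} = cball 0 (sqrt a)"
        by (auto simp: norm_eq_sqrt_inner)
      moreover have "sqrt a ^ CARD('n) = a powr p"
      proof (cases "a = 0")
        case False
        then have "sqrt a ^ CARD('n) = (a powr (1/2)) powr (real CARD('n))"
          using \<open>\<not> a < 0\<close> by (simp add: powr_half_sqrt powr_realpow)
        then show ?thesis by (simp add: powr_powr p_def)
      qed (simp add: zero_power)
      moreover have "\<kappa> * (a powr p / p) = unit_ball_vol (real CARD('n)) * a powr p"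
        by (simp add: \<kappa>_def p_def)
      ultimately show ?thesis using False by (simp add: e emeasure_cball)
    qed
  qed
  have R: "emeasure ?R {..a} = (if a < 0 then 0 else ennreal (\<kappa> * (a powr p / p)))" for a
  proof -
    have e: "emeasure ?R {..a} = (\<integral>\<^sup>+ r. ennreal (indicator {0..a} r * (\<kappa> * r powr (p - 1))) \<partial>lborel)"
      by (simp add: emeasure_density) (auto intro!: nn_integral_cong simp: indicator_def)
    show ?thesis
    proof (cases "a < 0")
      case False
      have "((\<lambda>r. r powr (p - 1)) has_integral (a powr (p - 1 + 1) / (p - 1 + 1))) {0..a}"
        using False p by (intro has_integral_powr_from_0) auto
      then have "((\<lambda>r. \<kappa> * r powr (p - 1)) has_integral (\<kappa> * (a powr p / p))) {0..a}"
        using has_integral_mult_right[of "\<lambda>r. r powr (p - 1)" "a powr p / p" "{0..a}" \<kappa>] by simp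
      then have "((\<lambda>r. indicator {0..a} r * (\<kappa> * r powr (p - 1))) has_integral (\<kappa> * (a powr p / p))) UNIV"
        by (subst (asm) has_integral_restrict_UNIV[symmetric]) (simp add: indicator_def of_bool_def if_distrib if_distribR cong: if_cong)
      then have "(\<integral>\<^sup>+ r. ennreal (indicator {0..a} r * (\<kappa> * r powr (p - 1))) \<partial>lborel) = ennreal (\<kappa> * (a powr p / p))"
        using \<kappa> by (intro nn_integral_has_integral_lborel) auto
      then show ?thesis using False e by simp
    qed (simp add: e)
  qed
  show "emeasure ?L X = emeasure ?R X" if "X \<in> range (\<lambda>a::real. {..a})" for X
    using that L R by auto
  show "sets ?L = sigma_sets UNIV (range (\<lambda>a::real. {..a}))" "sets ?R = sigma_sets UNIV (range (\<lambda>a::real. {..a}))"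
    by (simp_all add: borel_eq_atMost[where 'a = real])
  show "emeasure ?L {..real n} \<noteq> \<infinity>" for n using L by simp
  show "\<Union> (range (\<lambda>n. {..real n})) = UNIV" using real_arch_simple by auto
qed (auto simp: Int_stable_def)

lemma nn_integral_radial:
  fixes g :: "real \<Rightarrow> ennreal"
  assumes [measurable]: "g \<in> borel_measurable borel"
  shows "(\<integral>\<^sup>+ (x :: real ^ 'n). g (x \<bullet> x) \<partial>lborel) =
    ennreal (real CARD('n) / 2 * unit_ball_vol (real CARD('n))) *
    (\<integral>\<^sup>+ r. ennreal (indicator {0..} r * r powr (real CARD('n) / 2 - 1)) * g r \<partial>lborel)"
proof -
  have "(\<integral>\<^sup>+ (x :: real ^ 'n). g (x \<bullet> x) \<partial>lborel) = (\<integral>\<^sup>+ r. g r \<partial>distr lborel borel (\<lambda>x :: real ^ 'n. x \<bullet> x))"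
    by (subst nn_integral_distr) auto
  also have "\<dots> = (\<integral>\<^sup>+ r. ennreal (indicator {0..} r * (real CARD('n) / 2 * unit_ball_vol (real CARD('n)) * r powr (real CARD('n) / 2 - 1))) * g r \<partial>lborel)"
    unfolding distr_norm_square by (rule nn_integral_density) measurable
  also have "\<dots> = (\<integral>\<^sup>+ r. ennreal (real CARD('n) / 2 * unit_ball_vol (real CARD('n))) * (ennreal (indicator {0..} r * r powr (real CARD('n) / 2 - 1)) * g r) \<partial>lborel)"
  proof (intro nn_integral_cong)
    fix r
    define k where "k = real CARD('n) / 2 * unit_ball_vol (real CARD('n))"
    have "0 \<le> k" by (simp add: k_def)
    moreover have "indicator {0..} r * (k * r powr (real CARD('n) / 2 - 1)) = k * (indicator {0..} r * r powr (real CARD('n) / 2 - 1))"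
      by simp
    ultimately have "ennreal (indicator {0..} r * (k * r powr (real CARD('n) / 2 - 1))) * g r =
        ennreal k * (ennreal (indicator {0..} r * r powr (real CARD('n) / 2 - 1)) * g r)"
      by (simp add: ennreal_mult mult.assoc mult.left_commute)
    then show "ennreal (indicator {0..} r * (real CARD('n) / 2 * unit_ball_vol (real CARD('n)) * r powr (real CARD('n) / 2 - 1))) * g r =
        ennreal (real CARD('n) / 2 * unit_ball_vol (real CARD('n))) * (ennreal (indicator {0..} r * r powr (real CARD('n) / 2 - 1)) * g r)"
      unfolding k_def .
  qed
  also have "\<dots> = ennreal (real CARD('n) / 2 * unit_ball_vol (real CARD('n))) *
    (\<integral>\<^sup>+ r. ennreal (indicator {0..} r * r powr (real CARD('n) / 2 - 1)) * g r \<partial>lborel)"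
    by (rule nn_integral_cmult) measurable
  finally show ?thesis .
qed

text \<open>Up to a constant, the \<open>d\<close>-dimensional mass of \<open>x \<mapsto> g(|x|\<^sup>2)\<close> for \<open>b = d / 2\<close>, and its second moment for
  \<open>b = d / 2 + 1\<close>.\<close>
definition radial_moment :: "(real \<Rightarrow> ennreal) \<Rightarrow> real \<Rightarrow> ennreal" where
  "radial_moment g b = (\<integral>\<^sup>+ r. ennreal (indicator {0..} r * r powr (b - 1)) * g r \<partial>lborel)"

lemma half_dim_unit_ball_vol:
  assumes "0 < d"
  shows "d / 2 * unit_ball_vol d = pi powr (d / 2) / Gamma (d / 2)"
  using assms Gamma_plus1[of "d / 2"] by (simp add: unit_ball_vol_def add.commute nonpos_Ints_def field_simps)

lemma nn_integral_radial_mass: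
  fixes g :: "real \<Rightarrow> ennreal"
  assumes [measurable]: "g \<in> borel_measurable borel"
  shows "(\<integral>\<^sup>+ (x :: real ^ 'n). g (x \<bullet> x) \<partial>lborel) =
    ennreal (pi powr (real CARD('n) / 2) / Gamma (real CARD('n) / 2)) * radial_moment g (real CARD('n) / 2)"
  unfolding nn_integral_radial[OF assms] radial_moment_def by (subst half_dim_unit_ball_vol) simp_all

lemma nn_integral_radial_square:
  fixes g :: "real \<Rightarrow> ennreal"
  assumes [measurable]: "g \<in> borel_measurable borel"
  shows "(\<integral>\<^sup>+ (x :: real ^ 'n). g (x \<bullet> x) * ennreal (x \<bullet> x) \<partial>lborel) =
    ennreal (pi powr (real CARD('n) / 2) / Gamma (real CARD('n) / 2)) * radial_moment g (real CARD('n) / 2 + 1)"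
proof -
  have "(\<integral>\<^sup>+ (x :: real ^ 'n). g (x \<bullet> x) * ennreal (x \<bullet> x) \<partial>lborel) =
    ennreal (pi powr (real CARD('n) / 2) / Gamma (real CARD('n) / 2)) * radial_moment (\<lambda>r. g r * ennreal r) (real CARD('n) / 2)"
    by (rule nn_integral_radial_mass) measurable
  also have "radial_moment (\<lambda>r. g r * ennreal r) (real CARD('n) / 2) = radial_moment g (real CARD('n) / 2 + 1)"
    unfolding radial_moment_def
  proof (intro nn_integral_cong)
    fix r :: real
    have "ennreal (indicator {0..} r * r powr (real CARD('n) / 2 - 1)) * ennreal r = ennreal (indicator {0..} r * r powr (real CARD('n) / 2 + 1 - 1))"
    proof (cases "0 < r")
      case True
      then have "r powr (real CARD('n) / 2 - 1) * r = r powr (real CARD('n) / 2 - 1) * r powr 1" by simp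
      also have "\<dots> = r powr (real CARD('n) / 2 + 1 - 1)" by (simp only: powr_add[symmetric]) simp
      finally show ?thesis using True by (simp add: ennreal_mult[symmetric])
    next
      case False
      then show ?thesis by (cases "r = 0") (auto simp: indicator_def)
    qed
    then show "ennreal (indicator {0..} r * r powr (real CARD('n) / 2 - 1)) * (g r * ennreal r) =
         ennreal (indicator {0..} r * r powr (real CARD('n) / 2 + 1 - 1)) * g r"
      by (metis mult.assoc mult.commute)
  qed
  finally show ?thesis .
qed

lemma radial_moment_scale:
  assumes [measurable]: "g \<in> borel_measurable borel" and s: "0 < s"
  shows "radial_moment (\<lambda>r. g (s * r)) b = ennreal (s powr (- b)) * radial_moment g b"
proof -
  let ?F = "\<lambda>r. ennreal (indicator {0..} r * r powr (b - 1)) * g r"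
  have eq: "?F (s * r) = ennreal (s powr (b - 1)) * (ennreal (indicator {0..} r * r powr (b - 1)) * g (s * r))" for r
  proof -
    have "indicator {0..} (s * r) * (s * r) powr (b - 1) = s powr (b - 1) * (indicator {0..} r * r powr (b - 1))"
      using s by (cases "0 \<le> r") (simp_all add: powr_mult zero_le_mult_iff)
    then have "ennreal (indicator {0..} (s * r) * (s * r) powr (b - 1)) = ennreal (s powr (b - 1)) * ennreal (indicator {0..} r * r powr (b - 1))"
      by (simp only: ennreal_mult[symmetric] powr_ge_zero indicator_pos_le mult_nonneg_nonneg)
    then show ?thesis by (simp only: mult.assoc)
  qed
  have "radial_moment g b = ennreal s * (\<integral>\<^sup>+ r. ?F (s * r) \<partial>lborel)"
    unfolding radial_moment_def using nn_integral_real_affine[of ?F s 0] s by simp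
  also have "\<dots> = ennreal s * (\<integral>\<^sup>+ r. ennreal (s powr (b - 1)) * (ennreal (indicator {0..} r * r powr (b - 1)) * g (s * r)) \<partial>lborel)"
    by (simp only: eq)
  also have "\<dots> = ennreal (s powr b) * radial_moment (\<lambda>r. g (s * r)) b"
  proof -
    have "s * s powr (b - 1) = s powr b" using s by (simp add: powr_diff)
    then show ?thesis
      unfolding radial_moment_def using s
      by (subst nn_integral_cmult) (auto simp: mult.assoc[symmetric] ennreal_mult[symmetric])
  qed
  finally have "ennreal (s powr (- b)) * radial_moment g b = ennreal (s powr (- b)) * ennreal (s powr b) * radial_moment (\<lambda>r. g (s * r)) b"
    by (simp add: mult.assoc)
  also have "ennreal (s powr (- b)) * ennreal (s powr b) = 1"
    using s by (simp add: ennreal_mult[symmetric] powr_add[symmetric])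
  finally show ?thesis by simp
qed

lemma radial_moment_exp:
  assumes b: "0 < b" and s: "0 < s"
  shows "radial_moment (\<lambda>r. ennreal (exp (- (s * r)))) b = ennreal (Gamma b * s powr (- b))"
proof -
  have "radial_moment (\<lambda>r. ennreal (exp (- r))) b = ennreal (Gamma b)"
    unfolding Gamma_conv_nn_integral_real[OF b] radial_moment_def
    by (intro nn_integral_cong) (simp add: ennreal_mult[symmetric] exp_minus field_simps)
  then show ?thesis
    using radial_moment_scale[of "\<lambda>r. ennreal (exp (- r))" s b] s b Gamma_real_pos[of b]
    by (simp add: ennreal_mult[symmetric] mult.commute)
qed

text \<open>By the Gamma integral, \<open>(1 + \<beta> r)\<^sup>-\<^sup>a\<close> is a mixture of the exponentials \<open>exp (- (1 + \<beta> r) s)\<close> with weight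
  \<open>s\<^sup>a\<^sup>-\<^sup>1 / \<Gamma>(a)\<close>, so its moment is a mixture of the moments of exponentials. The truncation \<open>max 0 r\<close>
  keeps the base positive on the whole line.\<close>
lemma radial_moment_powr_neg:
  assumes b: "0 < b" and a: "b < a" and \<beta>: "0 < \<beta>"
  shows "radial_moment (\<lambda>r. ennreal ((1 + \<beta> * max 0 r) powr (- a))) b = ennreal (Gamma b * Gamma (a - b) / Gamma a * \<beta> powr (- b))"
proof -
  have Ga: "0 < Gamma a" using a b by (intro Gamma_real_pos) linarith
  have mix: "ennreal ((1 + \<beta> * max 0 r) powr (- a)) =
      ennreal (1 / Gamma a) * (\<integral>\<^sup>+ s. ennreal (indicator {0..} s * s powr (a - 1)) * ennreal (exp (- ((1 + \<beta> * max 0 r) * s))) \<partial>lborel)" for r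
  proof -
    have pos: "0 < 1 + \<beta> * max 0 r" using \<beta> by (auto intro: add_pos_nonneg)
    then have "radial_moment (\<lambda>s. ennreal (exp (- ((1 + \<beta> * max 0 r) * s)))) a =
        ennreal (Gamma a * (1 + \<beta> * max 0 r) powr (- a))"
      using a b by (intro radial_moment_exp) auto
    then show ?thesis
      using Ga unfolding radial_moment_def by (simp add: ennreal_mult[symmetric])
  qed
  define E where "E r s = ennreal (indicator {0..} r * r powr (b - 1)) *
     (ennreal (indicator {0..} s * s powr (a - 1)) * ennreal (exp (- ((1 + \<beta> * max 0 r) * s))))" for r s :: real
  have [measurable]: "case_prod E \<in> borel_measurable (borel \<Otimes>\<^sub>M borel)"
    unfolding E_def by measurable
  have "radial_moment (\<lambda>r. ennreal ((1 + \<beta> * max 0 r) powr (- a))) b =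
      (\<integral>\<^sup>+ r. ennreal (1 / Gamma a) * (\<integral>\<^sup>+ s. E r s \<partial>lborel) \<partial>lborel)"
    unfolding radial_moment_def
  proof (intro nn_integral_cong)
    fix r
    have "(\<integral>\<^sup>+ s. E r s \<partial>lborel) = ennreal (indicator {0..} r * r powr (b - 1)) *
       (\<integral>\<^sup>+ s. ennreal (indicator {0..} s * s powr (a - 1)) * ennreal (exp (- ((1 + \<beta> * max 0 r) * s))) \<partial>lborel)"
      unfolding E_def by (rule nn_integral_cmult) measurable
    then show "ennreal (indicator {0..} r * r powr (b - 1)) * ennreal ((1 + \<beta> * max 0 r) powr (- a)) =
       ennreal (1 / Gamma a) * (\<integral>\<^sup>+ s. E r s \<partial>lborel)"
      unfolding mix by (simp only: mult.left_commute)
  qed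
  also have "\<dots> = ennreal (1 / Gamma a) * (\<integral>\<^sup>+ r. (\<integral>\<^sup>+ s. E r s \<partial>lborel) \<partial>lborel)"
    by (rule nn_integral_cmult) measurable
  also have "(\<integral>\<^sup>+ r. (\<integral>\<^sup>+ s. E r s \<partial>lborel) \<partial>lborel) = (\<integral>\<^sup>+ s. (\<integral>\<^sup>+ r. E r s \<partial>lborel) \<partial>lborel)"
    by (rule lborel_pair.Fubini'[symmetric]) measurable
  also have "\<dots> = (\<integral>\<^sup>+ s. ennreal (Gamma b * \<beta> powr (- b)) * (ennreal (indicator {0..} s * s powr (a - b - 1)) * ennreal (exp (- (1 * s)))) \<partial>lborel)"
  proof (rule nn_integral_cong_AE)
    have "AE s in lborel. s \<noteq> (0::real)" by (rule AE_lborel_singleton)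
    then show "AE s in lborel. (\<integral>\<^sup>+ r. E r s \<partial>lborel) =
       ennreal (Gamma b * \<beta> powr (- b)) * (ennreal (indicator {0..} s * s powr (a - b - 1)) * ennreal (exp (- (1 * s))))"
    proof eventually_elim
      fix s :: real assume s0: "s \<noteq> 0"
      show "(\<integral>\<^sup>+ r. E r s \<partial>lborel) =
         ennreal (Gamma b * \<beta> powr (- b)) * (ennreal (indicator {0..} s * s powr (a - b - 1)) * ennreal (exp (- (1 * s))))"
      proof (cases "0 < s")
        case True
        have "E r s = ennreal (s powr (a - 1) * exp (- s)) * (ennreal (indicator {0..} r * r powr (b - 1)) * ennreal (exp (- ((\<beta> * s) * r))))" for r
        proof (cases "0 \<le> r")
          case r: True
          then have "exp (- ((1 + \<beta> * max 0 r) * s)) = exp (- s) * exp (- ((\<beta> * s) * r))"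
            by (simp add: exp_add[symmetric] algebra_simps)
          then show ?thesis using True r by (simp add: E_def ennreal_mult[symmetric] mult_ac)
        qed (simp add: E_def)
        then have "(\<integral>\<^sup>+ r. E r s \<partial>lborel) = ennreal (s powr (a - 1) * exp (- s)) * radial_moment (\<lambda>r. ennreal (exp (- ((\<beta> * s) * r)))) b"
          unfolding radial_moment_def by (simp add: nn_integral_cmult)
        also have "\<dots> = ennreal (s powr (a - 1) * exp (- s)) * ennreal (Gamma b * (\<beta> * s) powr (- b))"
          using True \<beta> b by (subst radial_moment_exp) auto
        also have "\<dots> = ennreal (s powr (a - 1) * exp (- s) * (Gamma b * (\<beta> * s) powr (- b)))"
          using Gamma_real_pos[OF b] by (simp add: ennreal_mult)
        also have "s powr (a - 1) * exp (- s) * (Gamma b * (\<beta> * s) powr (- b)) = Gamma b * \<beta> powr (- b) * (s powr (a - b - 1) * exp (- s))"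
        proof -
          have "s powr (a - 1) * s powr (- b) = s powr (a - b - 1)"
            by (simp only: powr_add[symmetric]) (simp add: algebra_simps)
          then show ?thesis using True \<beta> by (simp add: powr_mult mult_ac)
        qed
        finally show ?thesis
          using True Gamma_real_pos[OF b] by (simp add: ennreal_mult)
      next
        case False
        then show ?thesis using s0 by (simp add: E_def)
      qed
    qed
  qed
  also have "\<dots> = ennreal (Gamma b * \<beta> powr (- b)) * radial_moment (\<lambda>s. ennreal (exp (- (1 * s)))) (a - b)"
    unfolding radial_moment_def by (rule nn_integral_cmult) measurable
  also have "radial_moment (\<lambda>s. ennreal (exp (- (1 * s)))) (a - b) = ennreal (Gamma (a - b))"
    using a by (subst radial_moment_exp) auto
  finally show ?thesis
    using Ga Gamma_real_pos[OF b] Gamma_real_pos[of "a - b"] a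
    by (simp add: ennreal_mult[symmetric] field_simps)
qed

text \<open>The substitution \<open>t = \<beta> r\<close> leads to the Beta integral.\<close>
lemma radial_moment_powr_pos:
  assumes b: "0 < b" and c: "0 < c" and \<beta>: "0 < \<beta>"
  shows "radial_moment (\<lambda>r. ennreal (max 0 (1 - \<beta> * r) powr c)) b = ennreal (Gamma b * Gamma (c + 1) / Gamma (b + c + 1) * \<beta> powr (- b))"
proof -
  have "((\<lambda>t. t powr (b - 1) * (1 - t) powr (c + 1 - 1)) has_integral Beta b (c + 1)) {0..1}"
    using b c by (intro has_integral_Beta_real) auto
  then have "((\<lambda>t. if t \<in> {0..1} then t powr (b - 1) * (1 - t) powr (c + 1 - 1) else 0) has_integral Beta b (c + 1)) UNIV"
    by (subst has_integral_restrict_UNIV)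
  moreover have "(\<lambda>t. if t \<in> {0..1} then t powr (b - 1) * (1 - t) powr (c + 1 - 1) else 0) =
      (\<lambda>t. indicator {0..} t * t powr (b - 1) * max 0 (1 - t) powr c)"
    by (auto simp: fun_eq_iff indicator_def max_def)
  ultimately have "(\<integral>\<^sup>+ t. ennreal (indicator {0..} t * t powr (b - 1) * max 0 (1 - t) powr c) \<partial>lborel) = ennreal (Beta b (c + 1))"
    by (intro nn_integral_has_integral_lborel) auto
  then have "radial_moment (\<lambda>r. ennreal (max 0 (1 - r) powr c)) b = ennreal (Beta b (c + 1))"
    unfolding radial_moment_def by (simp add: ennreal_mult[symmetric])
  moreover have "Beta b (c + 1) = Gamma b * Gamma (c + 1) / Gamma (b + c + 1)" by (simp add: Beta_def add.assoc)
  ultimately show ?thesis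
    using radial_moment_scale[of "\<lambda>r. ennreal (max 0 (1 - r) powr c)" \<beta> b] \<beta> b c
      Gamma_real_pos[of b] Gamma_real_pos[of "c + 1"] Gamma_real_pos[of "b + c + 1"]
    by (simp add: ennreal_mult[symmetric] mult.commute)
qed

section \<open>The q-Gaussian measures\<close>

lemma radial_moment_cong:
  assumes "\<And>r. 0 \<le> r \<Longrightarrow> f r = g r"
  shows "radial_moment f b = radial_moment g b"
  unfolding radial_moment_def
proof (intro nn_integral_cong)
  fix r
  show "ennreal (indicator {0..} r * r powr (b - 1)) * f r = ennreal (indicator {0..} r * r powr (b - 1)) * g r"
    using assms[of r] by (cases "0 \<le> r") auto
qed

definition q_profile :: "real \<Rightarrow> nat \<Rightarrow> real \<Rightarrow> ennreal" where
  "q_profile q d r = ennreal (C0 q d * exp_q q (- (1 / 2) * C1 q d * r))"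

lemma q_profile_measurable [measurable]: "q_profile q d \<in> borel_measurable borel"
  unfolding q_profile_def exp_q_def by measurable

context
  fixes q :: real and d :: nat
  assumes q: "0 < q" "q < (real d + 4) / (real d + 2)"
begin

lemma q_range: "(q - 1) * (real d + 2) < 2" "q < 2"
proof -
  have "q * (real d + 2) < real d + 4" using q(2) by (simp add: pos_less_divide_eq)
  then show "(q - 1) * (real d + 2) < 2" by (simp add: algebra_simps)
  have "(real d + 4) / (real d + 2) \<le> 2" by (simp add: divide_simps)
  then show "q < 2" using q(2) by linarith
qed

lemma C1_pos: "0 < C1 q d"
  using q_range by (simp add: C1_def algebra_simps)

lemma q_gt_1_exponent: "1 < q \<Longrightarrow> real d / 2 + 1 < 1 / (q - 1)"
  using q_range by (simp add: pos_less_divide_eq field_simps)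

lemma C0_pos: "0 < C0 q d"
proof -
  consider "q < 1" | "q = 1" | "1 < q" by linarith
  then show ?thesis
  proof cases
    case 1
    then have "0 < (2 - q) / (1 - q)" using q_range by simp
    then show ?thesis using 1 C1_pos
      by (auto simp: C0_def intro!: mult_pos_pos divide_pos_pos Gamma_real_pos add_pos_nonneg)
  next
    case 2 then show ?thesis by (simp add: C0_def)
  next
    case 3
    then have "0 < 1 / (q - 1) - real d / 2" using q_gt_1_exponent by simp
    then show ?thesis using 3 C1_pos
      by (auto simp: C0_def intro!: mult_pos_pos divide_pos_pos Gamma_real_pos)
  qed
qed

lemma radial_moment_q_profile:
  assumes b: "0 < b" "b \<le> real d / 2 + 1"
  defines "K \<equiv> (if q < 1 then Gamma ((2 - q) / (1 - q)) / Gamma (b + (2 - q) / (1 - q)) * ((1 - q) * C1 q d / 2) powr (- b)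
       else if q = 1 then 2 powr b
       else Gamma (1 / (q - 1) - b) / Gamma (1 / (q - 1)) * ((q - 1) * C1 q d / 2) powr (- b))"
  shows "radial_moment (q_profile q d) b = ennreal (C0 q d * (Gamma b * K))"
proof -
  have C0: "radial_moment (q_profile q d) b = ennreal (C0 q d) * radial_moment (\<lambda>r. ennreal (exp_q q (- (1 / 2) * C1 q d * r))) b"
  proof -
    have "q_profile q d = (\<lambda>r. ennreal (C0 q d) * ennreal (exp_q q (- (1 / 2) * C1 q d * r)))"
      using C0_pos by (auto simp: q_profile_def fun_eq_iff ennreal_mult exp_q_def)
    moreover have "(\<lambda>r. exp_q q (- (1 / 2) * C1 q d * r)) \<in> borel_measurable borel"
      unfolding exp_q_def by measurable
    ultimately show ?thesis
      unfolding radial_moment_def by (simp add: mult.left_commute[of _ "ennreal (C0 q d)"] nn_integral_cmult)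
  qed
  consider "q < 1" | "q = 1" | "1 < q" by linarith
  then have "radial_moment (\<lambda>r. ennreal (exp_q q (- (1 / 2) * C1 q d * r))) b = ennreal (Gamma b * K)"
  proof cases
    case 1
    let ?\<beta> = "(1 - q) * C1 q d / 2"
    have "1 / (1 - q) + 1 = (2 - q) / (1 - q)" using 1 by (simp add: field_simps)
    moreover have "radial_moment (\<lambda>r. ennreal (max 0 (1 - ?\<beta> * r) powr (1 / (1 - q)))) b =
        ennreal (Gamma b * Gamma (1 / (1 - q) + 1) / Gamma (b + 1 / (1 - q) + 1) * ?\<beta> powr (- b))"
      using 1 b C1_pos by (intro radial_moment_powr_pos) auto
    moreover have "radial_moment (\<lambda>r. ennreal (exp_q q (- (1 / 2) * C1 q d * r))) b =
        radial_moment (\<lambda>r. ennreal (max 0 (1 - ?\<beta> * r) powr (1 / (1 - q)))) b"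
      using 1 by (intro radial_moment_cong) (simp add: exp_q_def algebra_simps)
    ultimately show ?thesis using 1 by (simp add: K_def add.assoc mult.assoc)
  next
    case 2
    have "C1 q d = 1" using 2 by (simp add: C1_def)
    then have "radial_moment (\<lambda>r. ennreal (exp_q q (- (1 / 2) * C1 q d * r))) b = radial_moment (\<lambda>r. ennreal (exp (- ((1/2) * r)))) b"
      using 2 by (simp add: exp_q_def)
    also have "\<dots> = ennreal (Gamma b * (1/2) powr (- b))" using b by (intro radial_moment_exp) auto
    also have "(1/2) powr (- b) = (2::real) powr b" by (simp add: powr_minus powr_divide)
    finally show ?thesis using 2 by (simp add: K_def)
  next
    case 3
    let ?\<beta> = "(q - 1) * C1 q d / 2"
    have "radial_moment (\<lambda>r. ennreal ((1 + ?\<beta> * max 0 r) powr (- (1 / (q - 1))))) b =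
        ennreal (Gamma b * Gamma (1 / (q - 1) - b) / Gamma (1 / (q - 1)) * ?\<beta> powr (- b))"
      using 3 b C1_pos q_gt_1_exponent by (intro radial_moment_powr_neg) auto
    moreover have "radial_moment (\<lambda>r. ennreal (exp_q q (- (1 / 2) * C1 q d * r))) b =
        radial_moment (\<lambda>r. ennreal ((1 + ?\<beta> * max 0 r) powr (- (1 / (q - 1))))) b"
    proof (rule radial_moment_cong)
      fix r :: real assume r: "0 \<le> r"
      have "0 \<le> ?\<beta> * r" using r 3 C1_pos by simp
      moreover have "1 + (1 - q) * (- (1 / 2) * C1 q d * r) = 1 + ?\<beta> * r" by (simp add: field_simps)
      moreover have "1 / (1 - q) = - (1 / (q - 1))" using 3 by (simp add: field_simps)
      ultimately show "ennreal (exp_q q (- (1 / 2) * C1 q d * r)) = ennreal ((1 + ?\<beta> * max 0 r) powr (- (1 / (q - 1))))"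
        using 3 r by (simp only: exp_q_def if_False max_absorb2 add_nonneg_nonneg zero_le_one) auto
    qed
    ultimately show ?thesis using 3 by (simp add: K_def mult.assoc)
  qed
  then show ?thesis unfolding C0 using C0_pos by (simp add: ennreal_mult')
qed

text \<open>The Gamma functions and powers in \<open>C0\<close> are those of the radial integral and of the volume of the ball.\<close>
lemma q_profile_mass:
  assumes d: "0 < d"
  shows "ennreal (pi powr (real d / 2) / Gamma (real d / 2)) * radial_moment (q_profile q d) (real d / 2) = 1"
proof -
  let ?p = "real d / 2"
  have p: "0 < ?p" using d by simp
  have Gp: "0 < Gamma ?p" by (rule Gamma_real_pos[OF p])
  have split: "x powr (- ?p) * pi powr ?p * (x / pi) powr ?p = 1" if "0 < x" for x
    using that by (simp add: powr_minus powr_divide)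
  \<comment> \<open>\<open>A / G\<close> is the constant of the radial formula, \<open>(H / K) P\<close> is \<open>C0\<close>, and \<open>G (K / H) X\<close> the radial integral.\<close>
  have alg: "A / G * (H / K * P * (G * (K / H * X))) = X * A * P"
    if "G \<noteq> 0" "H \<noteq> 0" "K \<noteq> 0" for A G H K P X :: real
    using that by (simp add: field_simps)
  consider "q < 1" | "q = 1" | "1 < q" by linarith
  then have "pi powr ?p / Gamma ?p * (C0 q d * (Gamma ?p * (if q < 1 then Gamma ((2 - q) / (1 - q)) / Gamma (?p + (2 - q) / (1 - q)) * ((1 - q) * C1 q d / 2) powr (- ?p)
       else if q = 1 then 2 powr ?p
       else Gamma (1 / (q - 1) - ?p) / Gamma (1 / (q - 1)) * ((q - 1) * C1 q d / 2) powr (- ?p)))) = 1"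
  proof cases
    case 1
    define c where "c = (2 - q) / (1 - q)"
    define x where "x = (1 - q) * C1 q d / 2"
    have x: "0 < x" using 1 C1_pos by (simp add: x_def)
    have "0 < c" using 1 q_range by (simp add: c_def)
    then have G: "Gamma c \<noteq> 0" "Gamma (?p + c) \<noteq> 0" using p by (simp_all add: Gamma_real_pos less_imp_neq[symmetric] add_pos_pos)
    have "C0 q d = Gamma (?p + c) / Gamma c * (x / pi) powr ?p"
      using 1 by (simp add: C0_def c_def x_def add.commute)
    then show ?thesis using 1 Gp G split[OF x] unfolding c_def[symmetric] x_def[symmetric]
      by (simp only: if_True alg less_imp_neq[symmetric] not_False_eq_True)
  next
    case 2
    then show ?thesis using Gp by (simp add: C0_def powr_minus powr_mult field_simps)
  next
    case 3
    define c where "c = 1 / (q - 1)"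
    define x where "x = (q - 1) * C1 q d / 2"
    have x: "0 < x" using 3 C1_pos by (simp add: x_def)
    have "0 < c" "0 < c - ?p" using 3 q_gt_1_exponent by (auto simp: c_def)
    then have G: "Gamma c \<noteq> 0" "Gamma (c - ?p) \<noteq> 0" by (simp_all add: Gamma_real_pos less_imp_neq[symmetric])
    have C0: "C0 q d = Gamma c / Gamma (c - ?p) * (x / pi) powr ?p"
      using 3 by (simp add: C0_def c_def x_def)
    have n: "(q < 1) = False" "(q = 1) = False" using 3 by auto
    show ?thesis
      unfolding n if_False c_def[symmetric] x_def[symmetric] C0
      using Gp G split[OF x] by (subst alg) auto
  qed
  then show ?thesis
    using radial_moment_q_profile[OF p] Gp by (simp add: ennreal_mult'[symmetric] del: times_divide_eq_left)
qed

lemma q_profile_second_moment: "radial_moment (q_profile q d) (real d / 2 + 1) < \<infinity>"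
  by (subst radial_moment_q_profile) auto

end

lemma q_gaussian_eq_elliptic:
  fixes V :: "real ^ 'n ^ 'n"
  assumes "0 < q" "q < (real CARD('n) + 4) / (real CARD('n) + 2)"
  shows "q_gaussian q 0 V = elliptic (q_profile q CARD('n)) V"
proof -
  have "ennreal (C0 q CARD('n) * k * y) = ennreal (C0 q CARD('n) * y) * ennreal k" if "0 \<le> k" "0 \<le> y" for k y
    using that C0_pos[OF assms] by (simp add: ennreal_mult[symmetric] mult_ac)
  moreover have "0 \<le> exp_q q t" for t by (simp add: exp_q_def)
  ultimately show ?thesis
    by (simp add: q_gaussian_def elliptic_def q_profile_def)
qed

lemma q_gaussian_P2:
  fixes V :: "real ^ 'n ^ 'n"
  assumes q: "0 < q" "q < (real CARD('n) + 4) / (real CARD('n) + 2)" and V: "V \<in> spd"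
  shows "q_gaussian q 0 V \<in> P2"
  unfolding q_gaussian_eq_elliptic[OF q]
proof (rule elliptic_P2[OF q_profile_measurable V])
  show "(\<integral>\<^sup>+ (x :: real ^ 'n). q_profile q CARD('n) (x \<bullet> x) \<partial>lborel) = 1"
    using q_profile_mass[OF q] by (simp add: nn_integral_radial_mass q_profile_measurable)
  show "(\<integral>\<^sup>+ (x :: real ^ 'n). q_profile q CARD('n) (x \<bullet> x) * ennreal (x \<bullet> x) \<partial>lborel) < \<infinity>"
    using q_profile_second_moment[OF q]
    by (simp add: nn_integral_radial_square q_profile_measurable ennreal_mult_less_top)
qed

lemma distr_q_gaussian:
  fixes V T :: "real ^ 'n ^ 'n"
  assumes q: "0 < q" "q < (real CARD('n) + 4) / (real CARD('n) + 2)" and V: "V \<in> spd" "T \<in> spd"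
  shows "distr (q_gaussian q 0 V) borel ((*v) T) = q_gaussian q 0 (T ** V ** T)"
  unfolding q_gaussian_eq_elliptic[OF q] by (rule distr_elliptic_spd[OF q_profile_measurable V])

section \<open>The tangent of the Tsallis entropy at a q-Gaussian\<close>

lemma ereal_integral_eq:
  assumes "integrable M f"
  shows "ereal_integral M f = ereal (\<integral>x. f x \<partial>M)"
proof -
  have "(\<integral>\<^sup>+ x. ennreal (f x) \<partial>M) \<noteq> \<infinity>" "(\<integral>\<^sup>+ x. ennreal (- f x) \<partial>M) \<noteq> \<infinity>"
    using assms unfolding real_integrable_def by auto
  then show ?thesis
    unfolding ereal_integral_def real_lebesgue_integral_def[OF assms]
    by (cases "\<integral>\<^sup>+ x. ennreal (f x) \<partial>M"; cases "\<integral>\<^sup>+ x. ennreal (- f x) \<partial>M") (auto simp: enn2ereal_ennreal)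
qed

lemma ereal_integral_ge:
  assumes [measurable]: "f \<in> borel_measurable M" and g: "integrable M g" and le: "AE x in M. g x \<le> f x"
  shows "ereal (\<integral>x. g x \<partial>M) \<le> ereal_integral M f"
proof -
  have [measurable]: "g \<in> borel_measurable M" using g by simp
  have "AE x in M. ennreal (- f x) \<le> ennreal (- g x)"
    using le by eventually_elim (auto intro: ennreal_leI)
  then have "(\<integral>\<^sup>+ x. ennreal (- f x) \<partial>M) \<le> (\<integral>\<^sup>+ x. ennreal (- g x) \<partial>M)"
    by (rule nn_integral_mono_AE)
  also have "\<dots> < \<infinity>" using g by (simp add: real_integrable_def less_top)
  finally have neg: "(\<integral>\<^sup>+ x. ennreal (- f x) \<partial>M) \<noteq> \<infinity>" by simp
  show ?thesis
  proof (cases "(\<integral>\<^sup>+ x. ennreal (f x) \<partial>M) = \<infinity>")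
    case True
    then show ?thesis using neg unfolding ereal_integral_def
      by (cases "\<integral>\<^sup>+ x. ennreal (- f x) \<partial>M") (auto simp: enn2ereal_ennreal)
  next
    case False
    then have "integrable M f" using neg by (simp add: real_integrable_def)
    then show ?thesis using g le by (simp add: ereal_integral_eq integral_mono_AE)
  qed
qed

lemma powr_le_affine:
  fixes x \<alpha> :: real
  assumes "0 \<le> x" "0 < \<alpha>" "\<alpha> < 1"
  shows "x powr \<alpha> \<le> \<alpha> * x + (1 - \<alpha>)"
proof -
  have "x powr \<alpha> * 1 \<le> (x powr \<alpha>) powr (1 / \<alpha>) / (1 / \<alpha>) + 1 powr (1 / (1 - \<alpha>)) / (1 / (1 - \<alpha>))"
    using assms by (intro Youngs_inequality) auto
  then show ?thesis using assms by (simp add: powr_powr mult.commute)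
qed

text \<open>The function \<open>t\<^sup>1\<^sup>+\<^sup>r / r\<close> is convex for \<open>r > -1\<close> and lies above its tangent at \<open>1\<close>.\<close>
lemma power_tangent:
  fixes t r :: real
  assumes t: "0 \<le> t" and r: "-1 < r" "r \<noteq> 0"
  shows "0 \<le> (t powr (1 + r) - (1 + r) * t + r) / r"
proof (cases "0 < r")
  case True
  have "(t powr (1 + r)) powr (1 / (1 + r)) \<le> 1 / (1 + r) * t powr (1 + r) + (1 - 1 / (1 + r))"
    using True by (intro powr_le_affine) auto
  moreover have "(t powr (1 + r)) powr (1 / (1 + r)) = t" using True t by (simp add: powr_powr)
  ultimately have "(1 + r) * t \<le> (1 + r) * (1 / (1 + r) * t powr (1 + r) + (1 - 1 / (1 + r)))"
    using True by (intro mult_left_mono) auto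
  also have "\<dots> = t powr (1 + r) + r"
  proof -
    have "(1 + r) * (1 / (1 + r)) = 1" using True by simp
    then show ?thesis by (simp only: distrib_left right_diff_distrib mult.assoc[symmetric]) simp
  qed
  finally show ?thesis using True by simp
next
  case False
  then have "t powr (1 + r) \<le> (1 + r) * t + (1 - (1 + r))"
    using r t by (intro powr_le_affine) auto
  then show ?thesis using False by (intro divide_nonpos_nonpos) auto
qed

text \<open>The tangent inequality for the convex function \<open>t ln\<^sub>q t\<close> at \<open>p\<close>, whose derivative there is
  \<open>1 + (2 - q) ln\<^sub>q p\<close>. For \<open>q < 1\<close> the density of a \<open>q\<close>-Gaussian vanishes outside an ellipsoid. There \<open>l\<close> is the
  continuation of \<open>ln\<^sub>q p\<close> as an affine function of \<open>\<langle>x, V\<^sup>-\<^sup>1 x\<rangle>\<close>; it is at most \<open>ln\<^sub>q 0 = - 1 / (1 - q)\<close>, so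
  the resulting slope is at most the derivative at \<open>0\<close>.\<close>
lemma tsallis_integrand_ge_tangent:
  fixes s p l q :: real
  assumes s: "0 \<le> s" and p: "0 \<le> p" and q: "q < 2"
    and pos: "0 < p \<Longrightarrow> ln_q q p = l"
    and zero: "p = 0 \<Longrightarrow> q < 1 \<and> 1 + (1 - q) * l \<le> 0"
  shows "p * l + (1 + (2 - q) * l) * (s - p) \<le> s * ln_q q s"
proof (cases "p = 0")
  case True
  then have q1: "q < 1" and l: "1 + (1 - q) * l \<le> 0" using zero by auto
  have "(1 + (2 - q) * l) * (1 - q) \<le> -1"
    using mult_left_mono[OF l, of "2 - q"] q by (simp add: algebra_simps)
  then have "1 + (2 - q) * l \<le> -1 / (1 - q)" by (subst pos_le_divide_eq) (use q1 in auto)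
  also have "-1 / (1 - q) \<le> (s powr (1 - q) - 1) / (1 - q)" using q1 by (intro divide_right_mono) auto
  also have "\<dots> = ln_q q s" using q1 by (simp add: ln_q_def)
  finally have "s * (1 + (2 - q) * l) \<le> s * ln_q q s" using s by (rule mult_left_mono)
  then show ?thesis using True by (simp add: mult.commute)
next
  case False
  then have p0: "0 < p" using p by simp
  show ?thesis
  proof (cases "q = 1")
    case True
    then have l: "l = ln p" using pos p0 by (simp add: ln_q_def)
    show ?thesis
    proof (cases "s = 0")
      case True
      then show ?thesis using p0 \<open>q = 1\<close> by (simp add: algebra_simps)
    next
      case False
      then have s0: "0 < s" using s by simp
      have "ln (p / s) \<le> p / s - 1" using p0 s0 by (intro ln_le_minus_one) simp
      then have "s * (ln p - ln s) \<le> s * (p / s - 1)" using s0 p0 by (intro mult_left_mono) (auto simp: ln_div)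
      then show ?thesis using s0 True by (simp add: ln_q_def l algebra_simps)
    qed
  next
    case q1: False
    define r where "r = 1 - q"
    have r: "-1 < r" "r \<noteq> 0" using q q1 by (auto simp: r_def)
    define P where "P = p powr r"
    have P: "0 < P" using p0 by (simp add: P_def)
    have l: "l = (P - 1) / r" using pos[OF p0] q1 by (simp add: ln_q_def r_def P_def)
    define t where "t = s / p"
    have t: "0 \<le> t" "s = t * p" using s p0 by (auto simp: t_def)
    have ss: "s * s powr r = t powr (1 + r) * (p * P)"
      using t p0 r by (cases "t = 0") (simp_all add: powr_mult powr_add P_def)
    have "0 \<le> (p * P) * ((t powr (1 + r) - (1 + r) * t + r) / r)"
      using power_tangent[OF t(1) r] p0 P by (intro mult_nonneg_nonneg) auto
    also have "\<dots> = s * ((s powr r - 1) / r) - (p * l + (1 + (1 + r) * l) * (s - p))"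
    proof -
      have "s * ((s powr r - 1) / r) = (t powr (1 + r) * (p * P) - t * p) / r"
        using ss t(2) by (simp add: right_diff_distrib)
      then show ?thesis
        using r by (simp add: l t(2)) (simp add: field_simps)
    qed
    finally show ?thesis using q1 by (simp add: ln_q_def r_def)
  qed
qed

lemma integrable_density_quadratic:
  fixes M :: "real ^ 'n ^ 'n" and p :: "real ^ 'n \<Rightarrow> real"
  assumes [measurable]: "p \<in> borel_measurable borel" and p: "AE x in lborel. 0 \<le> p x"
    and \<mu>: "density lborel (\<lambda>x. ennreal (p x)) \<in> P2"
  shows "integrable lborel p" "(\<integral>x. p x \<partial>lborel) = 1"
    "integrable lborel (\<lambda>x. p x * (x \<bullet> (M *v x)))"
    "(\<integral>x. p x * (x \<bullet> (M *v x)) \<partial>lborel) = (\<integral>x. x \<bullet> (M *v x) \<partial>density lborel (\<lambda>x. ennreal (p x)))"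
proof -
  let ?\<mu> = "density lborel (\<lambda>x. ennreal (p x))"
  interpret prob_space ?\<mu> using \<mu> by (simp add: P2_def)
  have [measurable]: "(\<lambda>x. x \<bullet> (M *v x)) \<in> borel_measurable borel" by measurable
  have "integrable ?\<mu> (\<lambda>_. 1::real)" by simp
  then show "integrable lborel p" by (subst (asm) integrable_density) (use p in auto)
  have "(\<integral>x. 1 \<partial>?\<mu>) = (\<integral>x. p x *\<^sub>R (1::real) \<partial>lborel)" by (rule integral_density) (use p in auto)
  moreover have "(\<integral>x. 1 \<partial>?\<mu>) = (1::real)" using prob_space by simp
  ultimately show "(\<integral>x. p x \<partial>lborel) = 1" by simp
  show "integrable lborel (\<lambda>x. p x * (x \<bullet> (M *v x)))"
    using integrable_quadratic_form[OF \<mu>, of M] p by (simp add: integrable_density)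
  show "(\<integral>x. p x * (x \<bullet> (M *v x)) \<partial>lborel) = (\<integral>x. x \<bullet> (M *v x) \<partial>?\<mu>)"
    using p by (simp add: integral_density)
qed

text \<open>On the support of the density \<open>p\<close> of the \<open>q\<close>-Gaussian, \<open>ln\<^sub>q p\<close> agrees with a function \<open>l\<close> that is affine in
  \<open>\<langle>x, X\<^sup>-\<^sup>1 x\<rangle>\<close>. Hence the slope \<open>1 + (2 - q) l\<close> of the tangent inequality is a constant \<open>c\<close> minus
  \<open>\<langle>x, K x\<rangle> / 2\<close>, and integrating the inequality against \<open>\<nu> - \<mu>\<close> removes \<open>c\<close>, because both measures have
  mass \<open>1\<close>.\<close>
theorem q_gaussian_entropy:
  fixes X :: "real ^ 'n ^ 'n"
  assumes q: "0 < q" "q < (real CARD('n) + 4) / (real CARD('n) + 2)" and X: "X \<in> spd"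
  defines "K \<equiv> (m_const q CARD('n) * det X powr ((q - 1) / 2)) *\<^sub>R matrix_inv X"
  shows "\<exists>e. tsallis_entropy q (q_gaussian q 0 X) = ereal e \<and>
     (\<forall>\<nu>\<in>P2. ereal (e + (\<integral>x. x \<bullet> (K *v x) \<partial>q_gaussian q 0 X) / 2 - (\<integral>x. x \<bullet> (K *v x) \<partial>\<nu>) / 2)
        \<le> tsallis_entropy q \<nu>)"
proof -
  let ?d = "CARD('n)"
  let ?\<mu> = "q_gaussian q 0 X"
  define Q where "Q x = x \<bullet> (matrix_inv X *v x)" for x
  define N where "N = C0 q ?d * det X powr (- 1 / 2)"
  define \<kappa> where "\<kappa> = N powr (1 - q)"
  define t where "t x = - (1 / 2) * C1 q ?d * Q x" for x
  define l where "l x = ln_q q N + \<kappa> * t x" for x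
  define p where "p x = N * exp_q q (t x)" for x
  have [measurable]: "Q \<in> borel_measurable borel" unfolding Q_def by measurable
  have [measurable]: "p \<in> borel_measurable borel" "l \<in> borel_measurable borel"
    unfolding p_def t_def l_def exp_q_def by measurable
  have N: "0 < N" using C0_pos[OF q] spd_det_pos[OF X] by (simp add: N_def)
  have C1: "0 < C1 q ?d" by (rule C1_pos[OF q])
  have q2: "q < 2" by (rule q_range(2)[OF q])
  have Q0: "0 \<le> Q x" for x
    using spd_matrix_inv[OF X] unfolding Q_def spd_def by (cases "x = 0") (auto intro: less_imp_le)
  have p0: "0 \<le> p x" for x using N by (simp add: p_def exp_q_def)
  have pos: "ln_q q (p x) = l x" if "0 < p x" for x
  proof (cases "q = 1")
    case True
    then show ?thesis using N by (simp add: p_def ln_q_def l_def \<kappa>_def exp_q_def ln_mult)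
  next
    case False
    have "0 < 1 + (1 - q) * t x"
    proof (rule ccontr)
      assume "\<not> ?thesis"
      then have "max 0 (1 + (1 - q) * t x) = 0" by simp
      then have "p x = 0" using False by (simp add: p_def exp_q_def)
      then show False using that by simp
    qed
    then have "p x powr (1 - q) = \<kappa> * (1 + (1 - q) * t x)"
      using False N by (simp add: p_def exp_q_def powr_mult powr_powr \<kappa>_def)
    then show ?thesis using False by (simp add: ln_q_def l_def \<kappa>_def divide_simps) (simp add: algebra_simps)
  qed
  have zero: "q < 1 \<and> 1 + (1 - q) * l x \<le> 0" if "p x = 0" for x
  proof -
    have e0: "exp_q q (t x) = 0" using that N by (simp add: p_def)
    then have q1: "q \<noteq> 1" and le: "1 + (1 - q) * t x \<le> 0" by (auto simp: exp_q_def max_def split: if_splits)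
    have "t x \<le> 0" using C1 Q0[of x] by (simp add: t_def)
    then have "q < 1" using le q1 by (smt (verit) mult_nonpos_nonpos)
    moreover have "1 + (1 - q) * l x = \<kappa> * (1 + (1 - q) * t x)"
    proof -
      have "(1 - q) * ln_q q N = \<kappa> - 1" using q1 by (simp add: ln_q_def \<kappa>_def)
      then show ?thesis by (simp add: l_def distrib_left)
    qed
    ultimately show ?thesis using le N by (simp add: \<kappa>_def mult_nonneg_nonpos)
  qed
  have pl: "p x * ln_q q (p x) = p x * l x" for x using pos[of x] p0[of x] by (cases "p x = 0") auto
  have \<mu>: "?\<mu> = density lborel (\<lambda>x. ennreal (p x))"
    by (simp add: q_gaussian_def p_def N_def t_def Q_def)
  have \<mu>P: "?\<mu> \<in> P2" by (rule q_gaussian_P2[OF q X])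
  have K: "(2 - q) * l x = (2 - q) * ln_q q N - (x \<bullet> (K *v x)) / 2" for x
  proof -
    have "\<kappa> = C0 q ?d powr (1 - q) * det X powr ((q - 1) / 2)"
      using C0_pos[OF q] spd_det_pos[OF X] by (simp add: \<kappa>_def N_def powr_mult powr_powr algebra_simps diff_divide_distrib)
    \<comment> \<open>This identity is the origin of the constant \<open>m(q,d)\<close>.\<close>
    then have m: "m_const q ?d * det X powr ((q - 1) / 2) = (2 - q) * \<kappa> * C1 q ?d"
      by (simp add: m_const_def C1_def)
    show ?thesis
      unfolding K_def m scaleR_matrix_vector inner_scaleR_right Q_def[symmetric]
      by (simp add: l_def t_def algebra_simps)
  qed
  define c where "c = 1 + (2 - q) * ln_q q N"
  have cl: "1 + (2 - q) * l x = c - (x \<bullet> (K *v x)) / 2" for x using K[of x] by (simp add: c_def)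
  have int_pl: "integrable lborel (\<lambda>x. p x * l x)"
  proof -
    have "integrable lborel (\<lambda>x. (ln_q q N) * p x - (\<kappa> * (1/2) * C1 q ?d) * (p x * (x \<bullet> (matrix_inv X *v x))))"
      using integrable_density_quadratic[of p] \<mu>P p0 unfolding \<mu>
      by (intro Bochner_Integration.integrable_diff integrable_mult_right) auto
    moreover have "(ln_q q N) * p x - (\<kappa> * (1/2) * C1 q ?d) * (p x * (x \<bullet> (matrix_inv X *v x))) = p x * l x" for x
      by (simp add: l_def t_def Q_def algebra_simps)
    ultimately show ?thesis by simp
  qed
  define e where "e = (\<integral>x. p x * l x \<partial>lborel)"
  have "tsallis_entropy q ?\<mu> = ereal e"
  proof -
    have "absolutely_continuous lborel ?\<mu>"
      unfolding \<mu> by (rule absolutely_continuousI_density) measurable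
    moreover have "AE x in lborel. ennreal (p x) = RN_deriv lborel ?\<mu> x"
      by (rule sigma_finite_measure.RN_deriv_unique[OF sigma_finite_lborel]) (simp_all add: \<mu>)
    then have ae: "AE x in lborel. enn2real (RN_deriv lborel ?\<mu> x) * ln_q q (enn2real (RN_deriv lborel ?\<mu> x)) = p x * l x"
    proof eventually_elim
      fix x assume "ennreal (p x) = RN_deriv lborel ?\<mu> x"
      then have "enn2real (RN_deriv lborel ?\<mu> x) = p x" using p0[of x] by (metis enn2real_ennreal)
      then show "enn2real (RN_deriv lborel ?\<mu> x) * ln_q q (enn2real (RN_deriv lborel ?\<mu> x)) = p x * l x"
        by (simp add: pl)
    qed
    moreover have "ereal_integral lborel (\<lambda>x. enn2real (RN_deriv lborel ?\<mu> x) * ln_q q (enn2real (RN_deriv lborel ?\<mu> x))) =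
        ereal_integral lborel (\<lambda>x. p x * l x)"
      unfolding ereal_integral_def using ae
      by (intro arg_cong2[where f = "(-)"] arg_cong[where f = enn2ereal] nn_integral_cong_AE) auto
    ultimately show ?thesis
      unfolding tsallis_entropy_def e_def using ereal_integral_eq[OF int_pl] by simp
  qed
  moreover have "ereal (e + (\<integral>x. x \<bullet> (K *v x) \<partial>?\<mu>) / 2 - (\<integral>x. x \<bullet> (K *v x) \<partial>\<nu>) / 2) \<le> tsallis_entropy q \<nu>"
    if \<nu>: "\<nu> \<in> P2" for \<nu>
  proof (cases "absolutely_continuous lborel \<nu>")
    case False
    then show ?thesis by (simp add: tsallis_entropy_def)
  next
    case True
    interpret \<nu>: prob_space \<nu> using \<nu> by (simp add: P2_def)
    have sets: "sets \<nu> = sets lborel" using \<nu> by (simp add: P2_def)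
    define \<rho> where "\<rho> x = enn2real (RN_deriv lborel \<nu> x)" for x
    have [measurable]: "\<rho> \<in> borel_measurable borel" unfolding \<rho>_def by measurable
    have "sigma_finite_measure \<nu>" by unfold_locales
    then have "AE x in lborel. RN_deriv lborel \<nu> x \<noteq> \<infinity>"
      by (intro sigma_finite_measure.RN_deriv_finite[OF sigma_finite_lborel] True sets)
    then have "AE x in lborel. ennreal (\<rho> x) = RN_deriv lborel \<nu> x"
      by eventually_elim (simp add: \<rho>_def less_top)
    then have "density lborel (\<lambda>x. ennreal (\<rho> x)) = density lborel (RN_deriv lborel \<nu>)"
      by (intro density_cong) auto
    then have \<nu>\<rho>: "density lborel (\<lambda>x. ennreal (\<rho> x)) = \<nu>"
      using sigma_finite_measure.density_RN_deriv[OF sigma_finite_lborel True sets] by simp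
    have \<rho>0: "0 \<le> \<rho> x" for x by (simp add: \<rho>_def)
    have \<rho>: "integrable lborel \<rho>" "(\<integral>x. \<rho> x \<partial>lborel) = 1"
      "integrable lborel (\<lambda>x. \<rho> x * (x \<bullet> (K *v x)))"
      "(\<integral>x. \<rho> x * (x \<bullet> (K *v x)) \<partial>lborel) = (\<integral>x. x \<bullet> (K *v x) \<partial>\<nu>)"
      using integrable_density_quadratic[of \<rho>] \<nu> \<rho>0 by (simp_all add: \<nu>\<rho>)
    have pp: "integrable lborel p" "(\<integral>x. p x \<partial>lborel) = 1"
      "integrable lborel (\<lambda>x. p x * (x \<bullet> (K *v x)))"
      "(\<integral>x. p x * (x \<bullet> (K *v x)) \<partial>lborel) = (\<integral>x. x \<bullet> (K *v x) \<partial>?\<mu>)"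
      using integrable_density_quadratic[of p] \<mu>P p0 by (simp_all add: \<mu>)
    define g where "g x = p x * l x + (c * \<rho> x - c * p x - (1/2) * (\<rho> x * (x \<bullet> (K *v x))) + (1/2) * (p x * (x \<bullet> (K *v x))))" for x
    have g: "g x = p x * l x + (1 + (2 - q) * l x) * (\<rho> x - p x)" for x
      unfolding g_def cl by (simp add: field_simps)
    have int_g: "integrable lborel g"
      unfolding g_def using int_pl \<rho> pp
      by (intro Bochner_Integration.integrable_add Bochner_Integration.integrable_diff integrable_mult_right)
    have "(\<integral>x. g x \<partial>lborel) = e + (\<integral>x. x \<bullet> (K *v x) \<partial>?\<mu>) / 2 - (\<integral>x. x \<bullet> (K *v x) \<partial>\<nu>) / 2"
      unfolding g_def using int_pl \<rho> pp by (simp add: e_def)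
    moreover have "ereal (\<integral>x. g x \<partial>lborel) \<le> ereal_integral lborel (\<lambda>x. \<rho> x * ln_q q (\<rho> x))"
    proof (rule ereal_integral_ge[OF _ int_g])
      show "(\<lambda>x. \<rho> x * ln_q q (\<rho> x)) \<in> borel_measurable lborel" unfolding ln_q_def by measurable
      show "AE x in lborel. g x \<le> \<rho> x * ln_q q (\<rho> x)"
        unfolding g using tsallis_integrand_ge_tangent[OF \<rho>0 p0 q2 pos zero] by simp
    qed
    ultimately show ?thesis using True by (simp add: tsallis_entropy_def \<rho>_def)
  qed
  ultimately show ?thesis by blast
qed

section \<open>Deformed logarithms and exponentials\<close>

locale deformation =
  fixes \<phi> :: "real \<Rightarrow> real"
  assumes mono: "mono_on {0<..} \<phi>" and pos: "\<And>s. 0 < s \<Longrightarrow> 0 < \<phi> s" and cont: "continuous_on {0<..} \<phi>"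
begin

lemma ln_phi_deriv:
  assumes x: "0 < x"
  shows "(ln_phi \<phi> has_real_derivative 1 / \<phi> x) (at x)"
proof -
  define a where "a = min x 1 / 2"
  define b where "b = max x 1 + 1"
  have ab: "0 < a" "a < x" "x < b" "a \<le> 1" "1 \<le> b" using x by (auto simp: a_def b_def min_def max_def)
  have c: "continuous_on {a..b} (\<lambda>s. 1 / \<phi> s)"
    using ab by (intro continuous_on_divide continuous_on_const continuous_on_subset[OF cont]) (auto simp: pos less_imp_neq[symmetric, OF pos])
  have "((\<lambda>u. LBINT y=ereal 1..ereal u. 1 / \<phi> y) has_vector_derivative 1 / \<phi> x) (at x within {a..b})"
    by (rule interval_integral_FTC2[OF ab(4,5) c]) (use ab in auto)
  then have "(ln_phi \<phi> has_vector_derivative 1 / \<phi> x) (at x within {a..b})"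
    by (simp add: ln_phi_def[abs_def])
  moreover have "at x within {a..b} = at x"
    using ab by (intro at_within_interior) auto
  ultimately show ?thesis by (simp add: has_real_derivative_iff_has_vector_derivative)
qed

lemma ln_phi_1: "ln_phi \<phi> 1 = 0"
  by (simp add: ln_phi_def)

lemma ln_phi_strict_mono: "0 < s \<Longrightarrow> s < t \<Longrightarrow> ln_phi \<phi> s < ln_phi \<phi> t"
proof (rule DERIV_pos_imp_increasing[of s t])
  fix x assume "0 < s" "s \<le> x"
  then have "0 < x" by simp
  then show "\<exists>y. (ln_phi \<phi> has_real_derivative y) (at x) \<and> 0 < y"
    using ln_phi_deriv[of x] pos[of x] by (intro exI[of _ "1 / \<phi> x"]) auto
qed

lemma ln_phi_less_iff: "0 < s \<Longrightarrow> 0 < t \<Longrightarrow> ln_phi \<phi> s < ln_phi \<phi> t \<longleftrightarrow> s < t"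
  using ln_phi_strict_mono by (metis less_asym linorder_neqE_linordered_idom order_less_irrefl)

lemma ln_phi_le_iff: "0 < s \<Longrightarrow> 0 < t \<Longrightarrow> ln_phi \<phi> s \<le> ln_phi \<phi> t \<longleftrightarrow> s \<le> t"
  using ln_phi_less_iff by (metis not_le)

lemma continuous_on_ln_phi: "continuous_on {0<..} (ln_phi \<phi>)"
  using ln_phi_deriv by (meson DERIV_isCont continuous_at_imp_continuous_on greaterThan_iff)

lemma inj_on_ln_phi: "inj_on (ln_phi \<phi>) {0<..}"
  by (rule inj_onI) (metis ln_phi_less_iff greaterThan_iff linorder_neqE_linordered_idom order_less_irrefl)

lemma ln_phi_surj:
  assumes "0 < a" "0 < b" "ln_phi \<phi> a \<le> s" "s \<le> ln_phi \<phi> b"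
  shows "\<exists>t>0. ln_phi \<phi> t = s"
proof -
  have "a \<le> b" using assms ln_phi_le_iff by (meson order_trans)
  moreover have "continuous_on {a..b} (ln_phi \<phi>)"
    using assms by (intro continuous_on_subset[OF continuous_on_ln_phi]) auto
  ultimately obtain t where "a \<le> t" "ln_phi \<phi> t = s" using IVT'[of "ln_phi \<phi>" a s b] assms by auto
  then show ?thesis using assms by (intro exI[of _ t]) auto
qed

text \<open>The Galois connection between \<open>ln\<^sub>\<phi>\<close> and \<open>exp\<^sub>\<phi>\<close>; it also holds where \<open>exp\<^sub>\<phi>\<close> takes the values \<open>0\<close> and
  \<open>\<infinity>\<close>.\<close>
lemma less_exp_phi_iff:
  assumes t: "0 < t"
  shows "ennreal t < exp_phi \<phi> s \<longleftrightarrow> ln_phi \<phi> t < s"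
proof -
  have lt: "l_phi \<phi> \<le> ereal (ln_phi \<phi> t)" "ereal (ln_phi \<phi> t) \<le> L_phi \<phi>"
    unfolding l_phi_def L_phi_def using t by (auto intro: INF_lower SUP_upper)
  consider "ereal s \<le> l_phi \<phi>" | "l_phi \<phi> < ereal s" "ereal s < L_phi \<phi>" | "l_phi \<phi> < ereal s" "L_phi \<phi> \<le> ereal s"
    by fastforce
  then show ?thesis
  proof cases
    case 1
    then have "\<not> ln_phi \<phi> t < s" using lt by (metis ereal_less_eq(3) not_le order_trans)
    then show ?thesis using 1 by (simp add: exp_phi_def)
  next
    case 2
    obtain a where a: "0 < a" "ln_phi \<phi> a < s" using 2 by (auto simp: l_phi_def INF_less_iff)
    obtain b where b: "0 < b" "s < ln_phi \<phi> b" using 2 by (auto simp: L_phi_def less_SUP_iff)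
    obtain u where u: "0 < u" "ln_phi \<phi> u = s" using ln_phi_surj[of a b s] a b by auto
    then have "the_inv_into {0<..} (ln_phi \<phi>) s = u" using the_inv_into_f_f[OF inj_on_ln_phi, of u] by auto
    then have "exp_phi \<phi> s = ennreal u" using 2 by (simp add: exp_phi_def not_le)
    then show ?thesis using t u ln_phi_less_iff by (auto simp: ennreal_less_iff)
  next
    case 3
    have "ln_phi \<phi> t < ln_phi \<phi> (t + 1)" using t by (intro ln_phi_strict_mono) auto
    moreover have "ereal (ln_phi \<phi> (t + 1)) \<le> L_phi \<phi>" unfolding L_phi_def using t by (auto intro: SUP_upper)
    ultimately have "ln_phi \<phi> t < s" using 3 by (metis ereal_less(2) ereal_less_eq(3) less_le_trans order_trans)
    then show ?thesis using 3 by (simp add: exp_phi_def leD)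
  qed
qed

lemma exp_phi_measurable [measurable]: "exp_phi \<phi> \<in> borel_measurable borel"
proof (rule borel_measurableI_greater)
  fix y :: ennreal
  show "{x \<in> space borel. y < exp_phi \<phi> x} \<in> sets borel"
  proof (cases "y = 0")
    case True
    have "0 < exp_phi \<phi> s \<longleftrightarrow> (\<exists>n. ln_phi \<phi> (1 / real (Suc n)) < s)" for s
    proof
      assume "0 < exp_phi \<phi> s"
      then obtain e where e: "0 < e" "ennreal e < exp_phi \<phi> s"
        by (metis dense ennreal_cases ennreal_less_zero_iff infinity_ennreal_def less_irrefl not_less_iff_gr_or_eq top.not_eq_extremum top_greatest not_le ennreal_0 less_le)
      then obtain n where "1 / real (Suc n) < e" using nat_approx_posE by blast
      then have "ennreal (1 / real (Suc n)) < exp_phi \<phi> s" using e(2) by (meson ennreal_leI less_imp_le order_le_less_trans)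
      then show "\<exists>n. ln_phi \<phi> (1 / real (Suc n)) < s" by (subst (asm) less_exp_phi_iff) auto
    next
      assume "\<exists>n. ln_phi \<phi> (1 / real (Suc n)) < s"
      then obtain n where "ennreal (1 / real (Suc n)) < exp_phi \<phi> s" using less_exp_phi_iff[of "1 / real (Suc _)"] by auto
      then show "0 < exp_phi \<phi> s" by (metis not_gr_zero not_less_zero)
    qed
    then have "{x \<in> space borel. y < exp_phi \<phi> x} = (\<Union>n. {ln_phi \<phi> (1 / real (Suc n)) <..})" using True by auto
    then show ?thesis by simp
  next
    case False
    show ?thesis
    proof (cases y)
      case (real t)
      then have "0 < t" using False by (cases "t = 0") auto
      then have "{x \<in> space borel. y < exp_phi \<phi> x} = {ln_phi \<phi> t <..}"
        unfolding real(2) using less_exp_phi_iff by auto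
      then show ?thesis by simp
    qed simp
  qed
qed

text \<open>For \<open>\<lambda> = ln\<^sub>\<phi> h\<close> the superlevel set \<open>{r \<ge> 0. exp\<^sub>\<phi> (\<lambda> - r) > t}\<close> is the interval \<open>[0, excess h t)\<close>. Since
  \<open>ln\<^sub>\<phi>\<close> is increasing, the values \<open>\<lambda> \<in> (l\<^sub>\<phi>, L\<^sub>\<phi>)\<close> are parametrized by \<open>h \<in> (0, \<infinity>)\<close>.\<close>
definition excess :: "real \<Rightarrow> real \<Rightarrow> real" where
  "excess h t = (if 0 < t \<and> t < h then ln_phi \<phi> h - ln_phi \<phi> t else 0)"

lemma excess_nonneg: "0 \<le> excess h t"
  unfolding excess_def using ln_phi_strict_mono[of t h] by auto

lemma ln_phi_measurable_pos: "(\<lambda>t. if 0 < t then ln_phi \<phi> t else 0) \<in> borel_measurable borel"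
proof -
  have "(\<lambda>t. indicator {0<..} t *\<^sub>R ln_phi \<phi> t) \<in> borel_measurable borel"
    by (rule borel_measurable_continuous_on_indicator[OF _ continuous_on_ln_phi]) simp
  moreover have "(\<lambda>t. indicator {0<..} t *\<^sub>R ln_phi \<phi> t) = (\<lambda>t. if 0 < t then ln_phi \<phi> t else 0)"
    by (auto simp: fun_eq_iff)
  ultimately show ?thesis by simp
qed

lemma excess_measurable [measurable]: "excess h \<in> borel_measurable borel"
proof -
  have "excess h = (\<lambda>t. if 0 < t \<and> t < h then ln_phi \<phi> h - (if 0 < t then ln_phi \<phi> t else 0) else 0)"
    by (auto simp: excess_def fun_eq_iff)
  then show ?thesis using ln_phi_measurable_pos by simp
qed

text \<open>The layer cake formula: integrate \<open>r\<^sup>b\<^sup>-\<^sup>1\<close> over the superlevel sets of the profile.\<close>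
lemma radial_moment_exp_phi:
  assumes h: "0 < h" and b: "0 < b"
  shows "radial_moment (\<lambda>r. exp_phi \<phi> (ln_phi \<phi> h - r)) b = ennreal (1 / b) * (\<integral>\<^sup>+ t. ennreal (excess h t powr b) \<partial>lborel)"
proof -
  define g where "g t = (if 0 < t then ln_phi \<phi> t else 0)" for t
  have [measurable]: "g \<in> borel_measurable borel" unfolding g_def by (rule ln_phi_measurable_pos)
  define S where "S = {z. 0 < snd z \<and> g (snd z) < ln_phi \<phi> h - fst z}"
  have "S = {z \<in> space (borel \<Otimes>\<^sub>M borel). 0 < snd z \<and> g (snd z) < ln_phi \<phi> h - fst z}"
    by (simp add: S_def space_pair_measure)
  also have "\<dots> \<in> sets (borel \<Otimes>\<^sub>M borel)" by measurable
  finally have [measurable]: "S \<in> sets (borel \<Otimes>\<^sub>M borel)" .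
  have exp_eq: "exp_phi \<phi> (ln_phi \<phi> h - r) = (\<integral>\<^sup>+ t. indicator S (r, t) \<partial>lborel)" for r
  proof -
    define y where "y = exp_phi \<phi> (ln_phi \<phi> h - r)"
    have S: "(r, t) \<in> S \<longleftrightarrow> 0 < t \<and> ennreal t < y" for t
      unfolding S_def y_def using less_exp_phi_iff[of t] by (auto simp: g_def)
    have "(\<integral>\<^sup>+ t. indicator S (r, t) \<partial>lborel) = (\<integral>\<^sup>+ t. indicator {t. 0 < t \<and> ennreal t < y} t \<partial>lborel)"
      by (intro nn_integral_cong) (auto simp: indicator_def S)
    also have "\<dots> = emeasure lborel {t. 0 < t \<and> ennreal t < y}"
      by (rule nn_integral_indicator) measurable
    also have "\<dots> = y"
    proof (cases y)
      case (real u)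
      then have "{t. 0 < t \<and> ennreal t < y} = {0<..<u}" by (auto simp: ennreal_less_iff)
      then show ?thesis using real by simp
    next
      case top
      then have "{t. 0 < t \<and> ennreal t < y} = {0::real<..}" by auto
      moreover have "of_nat n \<le> emeasure lborel {0::real<..}" for n
      proof -
        have "emeasure lborel {0<..<real n} \<le> emeasure lborel {0::real<..}" by (intro emeasure_mono) auto
        then show ?thesis by (simp add: ennreal_of_nat_eq_real_of_nat)
      qed
      then have "emeasure lborel {0::real<..} = top"
        by (metis ennreal_Ex_less_of_nat infinity_ennreal_def less_top not_le)
      ultimately show ?thesis using top by simp
    qed
    finally show ?thesis by (simp add: y_def)
  qed
  define W where "W r t = ennreal (indicator {0..} r * r powr (b - 1)) * indicator S (r, t)" for r t :: real
  have [measurable]: "case_prod W \<in> borel_measurable (borel \<Otimes>\<^sub>M borel)" unfolding W_def by measurable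
  have "radial_moment (\<lambda>r. exp_phi \<phi> (ln_phi \<phi> h - r)) b = (\<integral>\<^sup>+ r. (\<integral>\<^sup>+ t. W r t \<partial>lborel) \<partial>lborel)"
    unfolding radial_moment_def exp_eq W_def by (intro nn_integral_cong nn_integral_cmult[symmetric]) measurable
  also have "\<dots> = (\<integral>\<^sup>+ t. (\<integral>\<^sup>+ r. W r t \<partial>lborel) \<partial>lborel)"
    by (rule lborel_pair.Fubini'[symmetric]) measurable
  also have "\<dots> = (\<integral>\<^sup>+ t. ennreal (1 / b) * ennreal (excess h t powr b) \<partial>lborel)"
  proof (rule nn_integral_cong)
    fix t
    define a where "a = excess h t"
    have a: "0 \<le> a" using excess_nonneg by (simp add: a_def)
    have "((\<lambda>r. r powr (b - 1)) has_integral (a powr (b - 1 + 1) / (b - 1 + 1))) {0..a}"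
      using a b by (intro has_integral_powr_from_0) auto
    then have "((\<lambda>r. if r \<in> {0..a} then r powr (b - 1) else 0) has_integral (a powr b / b)) UNIV"
      by (subst has_integral_restrict_UNIV) simp
    then have I: "(\<integral>\<^sup>+ r. ennreal (if r \<in> {0..a} then r powr (b - 1) else 0) \<partial>lborel) = ennreal (a powr b / b)"
      by (intro nn_integral_has_integral_lborel) auto
    have "AE r in lborel. W r t = ennreal (if r \<in> {0..a} then r powr (b - 1) else 0)"
      using AE_lborel_singleton[of a]
    proof eventually_elim
      fix r assume r: "r \<noteq> a"
      have "0 \<le> r \<Longrightarrow> (r, t) \<in> S \<longleftrightarrow> r \<le> a"
      proof -
        assume r0: "0 \<le> r"
        show "(r, t) \<in> S \<longleftrightarrow> r \<le> a"
        proof (cases "0 < t \<and> t < h")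
          case True
          then show ?thesis using r by (auto simp: S_def g_def a_def excess_def)
        next
          case False
          then have "a = 0" unfolding a_def excess_def by (rule if_not_P)
          moreover have "\<not> (0 < t \<and> ln_phi \<phi> t < ln_phi \<phi> h - r)"
          proof
            assume *: "0 < t \<and> ln_phi \<phi> t < ln_phi \<phi> h - r"
            then have "t < h" using ln_phi_less_iff[of t h] h r0 by auto
            then show False using * False by simp
          qed
          ultimately show ?thesis using r r0 by (auto simp: S_def g_def)
        qed
      qed
      then show "W r t = ennreal (if r \<in> {0..a} then r powr (b - 1) else 0)"
        by (auto simp: W_def indicator_def)
    qed
    then have "(\<integral>\<^sup>+ r. W r t \<partial>lborel) = (\<integral>\<^sup>+ r. ennreal (if r \<in> {0..a} then r powr (b - 1) else 0) \<partial>lborel)"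
      by (rule nn_integral_cong_AE)
    then show "(\<integral>\<^sup>+ r. W r t \<partial>lborel) = ennreal (1 / b) * ennreal (excess h t powr b)"
      unfolding I using b by (simp add: a_def ennreal_mult[symmetric])
  qed
  also have "\<dots> = ennreal (1 / b) * (\<integral>\<^sup>+ t. ennreal (excess h t powr b) \<partial>lborel)"
    by (rule nn_integral_cmult) measurable
  finally show ?thesis .
qed

end

section \<open>Normalizing the phi-exponential\<close>

lemma powr_add_le: "0 \<le> (a::real) \<Longrightarrow> 0 \<le> b \<Longrightarrow> 0 < p \<Longrightarrow> (a + b) powr p \<le> 2 powr p * (a powr p + b powr p)"
proof -
  assume *: "0 \<le> a" "0 \<le> b" "0 < p"
  have "(a + b) powr p \<le> (2 * max a b) powr p" using * by (intro powr_mono2) auto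
  also have "\<dots> = 2 powr p * (max a b) powr p" using * by (simp add: powr_mult)
  also have "\<dots> \<le> 2 powr p * (a powr p + b powr p)" by (intro mult_left_mono) (auto simp: max_def)
  finally show ?thesis .
qed

text \<open>Here \<open>k\<close> is half the dimension, so that \<open>\<delta> (k + 1) < 1\<close> is the condition \<open>\<delta> < 2 / (d + 2)\<close>. The growth
  conditions are those of \<open>O_class\<close> for one exponent that works at both ends.\<close>
locale admissible_deformation = deformation +
  fixes k \<delta> C s\<^sub>0 :: real
  assumes k: "0 < k" and \<delta>: "0 < \<delta>" "\<delta> * (k + 1) < 1"
    and growth_at_0: "0 < s\<^sub>0" "\<And>s. 0 < s \<Longrightarrow> s < s\<^sub>0 \<Longrightarrow> s powr (1 + \<delta>) \<le> C * \<phi> s"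
    and growth_at_top: "\<forall>\<^sub>F s in at_top. \<phi> s \<le> s powr (1 + \<delta>)"
begin

lemma phi_lower_bound: "\<exists>K>0. \<forall>s. 0 < s \<and> s \<le> 1 \<longrightarrow> 1 / \<phi> s \<le> K * s powr (- \<delta> - 1)"
proof -
  define u where "u = min s\<^sub>0 1 / 2"
  have u: "0 < u" "u < s\<^sub>0" "u \<le> 1" using growth_at_0(1) by (auto simp: u_def)
  define K where "K = \<bar>C\<bar> + 1 / \<phi> u"
  have K: "0 < K" using pos[OF u(1)] by (simp add: K_def add_nonneg_pos)
  have "1 / \<phi> s \<le> K * s powr (- \<delta> - 1)" if s: "0 < s" "s \<le> 1" for s
  proof (cases "s < u")
    case True
    have "s powr (1 + \<delta>) \<le> C * \<phi> s" using True s u by (intro growth_at_0) auto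
    also have "\<dots> \<le> K * \<phi> s"
    proof (rule mult_right_mono)
      show "C \<le> K" unfolding K_def using abs_ge_self[of C] divide_pos_pos[OF zero_less_one pos[OF u(1)]] by linarith
    qed (use pos[OF s(1)] in simp)
    finally have "s powr (1 + \<delta>) * s powr (- \<delta> - 1) \<le> K * \<phi> s * s powr (- \<delta> - 1)"
      by (intro mult_right_mono) auto
    moreover have "s powr (1 + \<delta>) * s powr (- \<delta> - 1) = 1" using s by (simp add: powr_add[symmetric])
    ultimately show ?thesis using pos[OF s(1)] by (simp add: field_simps)
  next
    case False
    then have "\<phi> u \<le> \<phi> s" using mono u s by (intro mono_onD[OF mono]) auto
    then have "1 / \<phi> s \<le> 1 / \<phi> u" using pos[OF u(1)] by (intro divide_left_mono) auto
    also have "\<dots> \<le> K * 1" by (simp add: K_def)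
    also have "\<dots> \<le> K * s powr (- \<delta> - 1)"
    proof (intro mult_left_mono)
      have "1 powr (- \<delta> - 1) \<le> s powr (- \<delta> - 1)" using s \<delta> by (intro powr_mono2') auto
      then show "1 \<le> s powr (- \<delta> - 1)" by simp
    qed (use K in auto)
    finally show ?thesis .
  qed
  then show ?thesis using K by blast
qed

lemma ln_phi_lower_bound: "\<exists>K>0. \<forall>t. 0 < t \<and> t \<le> 1 \<longrightarrow> - ln_phi \<phi> t \<le> K * t powr (- \<delta>)"
proof -
  obtain K where K: "0 < K" and bd: "\<And>s. 0 < s \<Longrightarrow> s \<le> 1 \<Longrightarrow> 1 / \<phi> s \<le> K * s powr (- \<delta> - 1)"
    using phi_lower_bound by blast
  have "- ln_phi \<phi> t \<le> K / \<delta> * t powr (- \<delta>)" if t: "0 < t" "t \<le> 1" for t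
  proof -
    let ?f = "\<lambda>s. ln_phi \<phi> s + K / \<delta> * s powr (- \<delta>)"
    have "?f 1 \<le> ?f t"
    proof (rule DERIV_nonpos_imp_nonincreasing[OF t(2)])
      fix x assume x: "t \<le> x" "x \<le> 1"
      then have x0: "0 < x" using t by simp
      have "(?f has_real_derivative 1 / \<phi> x + K / \<delta> * (- \<delta> * x powr (- \<delta> - 1))) (at x)"
        by (intro DERIV_add ln_phi_deriv x0 DERIV_cmult has_real_derivative_powr)
      moreover have "1 / \<phi> x + K / \<delta> * (- \<delta> * x powr (- \<delta> - 1)) \<le> 0"
        using bd[OF x0 x(2)] \<delta> by simp
      ultimately show "\<exists>y. (?f has_real_derivative y) (at x) \<and> y \<le> 0" by blast
    qed
    then show ?thesis using K \<delta> by (simp add: ln_phi_1) (smt (verit) divide_pos_pos)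
  qed
  then show ?thesis using K \<delta> by (intro exI[of _ "K / \<delta>"]) auto
qed

definition excess_moment :: "real \<Rightarrow> real \<Rightarrow> real" where
  "excess_moment b h = (\<integral>t. excess h t powr b \<partial>lborel)"

text \<open>Near \<open>0\<close> the excess is at most a multiple of \<open>t\<^sup>-\<^sup>\<delta>\<close>, whose power with exponent \<open>b \<le> k + 1\<close> is integrable
  since \<open>\<delta> b < 1\<close>.\<close>
lemma integrable_excess:
  assumes h: "0 < h" and b: "0 < b" "b \<le> k + 1"
  shows "integrable lborel (\<lambda>t. excess h t powr b)"
proof -
  obtain K where K: "0 < K" and bd: "\<And>t. 0 < t \<Longrightarrow> t \<le> 1 \<Longrightarrow> - ln_phi \<phi> t \<le> K * t powr (- \<delta>)"
    using ln_phi_lower_bound by blast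
  define M where "M = \<bar>ln_phi \<phi> h\<bar> * (1 + h powr \<delta>) + K"
  have M: "0 < M" using K by (simp add: M_def add_nonneg_pos)
  have le: "excess h t \<le> M * t powr (- \<delta>)" if t: "0 < t" "t < h" for t
  proof (cases "t \<le> 1")
    case True
    have "1 powr (- \<delta>) \<le> t powr (- \<delta>)" using t True \<delta> by (intro powr_mono2') auto
    then have "\<bar>ln_phi \<phi> h\<bar> * 1 \<le> \<bar>ln_phi \<phi> h\<bar> * t powr (- \<delta>)" by (intro mult_left_mono) auto
    moreover have "0 \<le> \<bar>ln_phi \<phi> h\<bar> * h powr \<delta> * t powr (- \<delta>)" by simp
    moreover have "M * t powr (- \<delta>) = \<bar>ln_phi \<phi> h\<bar> * t powr (- \<delta>) + \<bar>ln_phi \<phi> h\<bar> * h powr \<delta> * t powr (- \<delta>) + K * t powr (- \<delta>)"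
      by (simp add: M_def distrib_left distrib_right)
    moreover have "excess h t = ln_phi \<phi> h - ln_phi \<phi> t" using t by (simp add: excess_def)
    ultimately show ?thesis
      using bd[OF t(1) True] abs_ge_self[of "ln_phi \<phi> h"] by linarith
  next
    case False
    have "ln_phi \<phi> 1 < ln_phi \<phi> t" using False by (intro ln_phi_strict_mono) auto
    then have "excess h t \<le> \<bar>ln_phi \<phi> h\<bar> * 1" using t by (simp add: excess_def ln_phi_1)
    also have "\<dots> \<le> \<bar>ln_phi \<phi> h\<bar> * (h powr \<delta> * t powr (- \<delta>))"
    proof (intro mult_left_mono)
      have "1 = t powr \<delta> * t powr (- \<delta>)" using t by (simp add: powr_add[symmetric])
      also have "\<dots> \<le> h powr \<delta> * t powr (- \<delta>)" using t \<delta> by (intro mult_right_mono powr_mono2) auto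
      finally show "1 \<le> h powr \<delta> * t powr (- \<delta>)" .
    qed simp
    also have "\<dots> \<le> M * t powr (- \<delta>)"
      unfolding M_def mult.assoc[symmetric] using K by (intro mult_right_mono) (auto simp: distrib_left)
    finally show ?thesis .
  qed
  have db: "- (\<delta> * b) > -1"
  proof -
    have "\<delta> * b \<le> \<delta> * (k + 1)" using b \<delta> by (intro mult_left_mono) auto
    then show ?thesis using \<delta> by linarith
  qed
  have "((\<lambda>t. t powr (- (\<delta> * b))) has_integral (h powr (- (\<delta> * b) + 1) / (- (\<delta> * b) + 1))) {0..h}"
    using h db by (intro has_integral_powr_from_0) auto
  then have "(\<lambda>t. t powr (- (\<delta> * b))) integrable_on {0..h}" by blast
  then have "(\<lambda>t. t powr (- (\<delta> * b))) absolutely_integrable_on {0..h}"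
    by (rule nonnegative_absolutely_integrable_1) auto
  then have "integrable lborel (\<lambda>t. indicator {0..h} t *\<^sub>R (t powr (- (\<delta> * b))))"
    unfolding set_integrable_def by (subst (asm) integrable_completion) auto
  then have "integrable lborel (\<lambda>t. M powr b * (indicator {0..h} t *\<^sub>R (t powr (- (\<delta> * b)))))"
    by (rule integrable_mult_right)
  then show ?thesis
  proof (rule Bochner_Integration.integrable_bound)
    have "excess h t powr b \<le> M powr b * (indicator {0..h} t * t powr (- (\<delta> * b)))" for t
    proof (cases "0 < t \<and> t < h")
      case True
      then have "excess h t powr b \<le> (M * t powr (- \<delta>)) powr b"
        using le[of t] b excess_nonneg by (intro powr_mono2) auto
      then show ?thesis using True M by (simp add: powr_mult powr_powr)
    next
      case False
      then have "excess h t = 0" unfolding excess_def by (rule if_not_P)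
      then show ?thesis using b by simp
    qed
    then show "AE t in lborel. norm (excess h t powr b) \<le> norm (M powr b * (indicator {0..h} t *\<^sub>R (t powr (- (\<delta> * b)))))"
      by (auto intro!: AE_I2 order_trans[OF _ abs_ge_self])
  qed measurable
qed

lemma nn_integral_excess:
  assumes h: "0 < h" and b: "0 < b" "b \<le> k + 1"
  shows "(\<integral>\<^sup>+ t. ennreal (excess h t powr b) \<partial>lborel) = ennreal (excess_moment b h)"
  unfolding excess_moment_def using integrable_excess[OF assms] by (intro nn_integral_eq_integral) auto

lemma excess_ge: "0 < t \<Longrightarrow> t < u \<Longrightarrow> u < h \<Longrightarrow> ln_phi \<phi> h - ln_phi \<phi> u \<le> excess h t"
  using ln_phi_strict_mono[of t u] by (simp add: excess_def)

lemma excess_moment_ge: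
  assumes u: "0 < u" "u < h" and b: "0 < b" "b \<le> k + 1"
  shows "u * (ln_phi \<phi> h - ln_phi \<phi> u) powr b \<le> excess_moment b h"
proof -
  let ?c = "(ln_phi \<phi> h - ln_phi \<phi> u) powr b"
  have c: "0 \<le> ln_phi \<phi> h - ln_phi \<phi> u" using ln_phi_strict_mono[OF u] by simp
  have i: "integrable lborel (\<lambda>t. indicator {0<..<u} t *\<^sub>R ?c)"
    by (intro integrable_real_indicator integrable_scaleR_left) (use u in auto)
  have "u * ?c = (\<integral>t. indicator {0<..<u} t *\<^sub>R ?c \<partial>lborel)"
    using u by simp
  also have "\<dots> \<le> excess_moment b h"
    unfolding excess_moment_def
  proof (rule integral_mono[OF i])
    show "integrable lborel (\<lambda>t. excess h t powr b)" using u b by (intro integrable_excess) auto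
    fix t show "indicator {0<..<u} t *\<^sub>R ?c \<le> excess h t powr b"
      using excess_ge[of t u h] u b c by (cases "t \<in> {0<..<u}") (auto intro: powr_mono2)
  qed
  finally show ?thesis .
qed

lemma excess_moment_pos: "0 < h \<Longrightarrow> 0 < b \<Longrightarrow> b \<le> k + 1 \<Longrightarrow> 0 < excess_moment b h"
proof -
  assume *: "0 < h" "0 < b" "b \<le> k + 1"
  have "0 < h / 2 * (ln_phi \<phi> h - ln_phi \<phi> (h / 2)) powr b"
    using ln_phi_strict_mono[of "h / 2" h] * by simp
  also have "\<dots> \<le> excess_moment b h" using * by (intro excess_moment_ge) auto
  finally show ?thesis .
qed

lemma excess_mono: "0 < h \<Longrightarrow> h \<le> h' \<Longrightarrow> excess h t \<le> excess h' t"
  using ln_phi_le_iff[of h h'] ln_phi_strict_mono[of t h'] by (auto simp: excess_def)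

lemma continuous_on_excess_moment:
  assumes b: "0 < b" "b \<le> k + 1"
  shows "continuous_on {0<..} (excess_moment b)"
proof (rule continuous_on_sequentiallyI)
  fix x :: "nat \<Rightarrow> real" and h :: real
  assume x: "\<forall>n. x n \<in> {0<..}" and h: "h \<in> {0<..}" and lim: "x \<longlonglongrightarrow> h"
  obtain H where H: "\<And>n. \<bar>x n\<bar> \<le> H" "0 < H"
    using convergent_imp_Bseq[OF convergentI[OF lim]] by (auto simp: Bseq_def)
  have xH: "0 < x n" "x n \<le> H" for n using x H(1)[of n] by auto
  show "(\<lambda>n. excess_moment b (x n)) \<longlonglongrightarrow> excess_moment b h"
    unfolding excess_moment_def
  proof (rule integral_dominated_convergence)
    show "integrable lborel (\<lambda>t. excess H t powr b)" using H b by (intro integrable_excess) auto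
    show "AE t in lborel. norm (excess (x n) t powr b) \<le> excess H t powr b" for n
      using excess_mono[OF xH] b excess_nonneg by (auto intro!: AE_I2 powr_mono2)
    have lnlim: "(\<lambda>n. ln_phi \<phi> (x n)) \<longlonglongrightarrow> ln_phi \<phi> h"
      using continuous_on_ln_phi x h lim by (auto simp: continuous_on_sequentially o_def)
    have "AE t in lborel. t \<noteq> h" by (rule AE_lborel_singleton)
    then show "AE t in lborel. (\<lambda>n. excess (x n) t powr b) \<longlonglongrightarrow> excess h t powr b"
    proof eventually_elim
      fix t assume t: "t \<noteq> h"
      have "(\<lambda>n. excess (x n) t) \<longlonglongrightarrow> excess h t"
      proof (cases "0 < t \<and> t < h")
        case True
        have "\<forall>\<^sub>F n in sequentially. t < x n" using lim True by (auto intro: order_tendstoD)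
        then have "\<forall>\<^sub>F n in sequentially. ln_phi \<phi> (x n) - ln_phi \<phi> t = excess (x n) t"
          by eventually_elim (use True in \<open>simp add: excess_def\<close>)
        moreover have "(\<lambda>n. ln_phi \<phi> (x n) - ln_phi \<phi> t) \<longlonglongrightarrow> excess h t"
          using True by (auto simp: excess_def intro!: tendsto_intros lnlim)
        ultimately show ?thesis by (rule Lim_transform_eventually[rotated])
      next
        case False
        then have "\<forall>\<^sub>F n in sequentially. t \<le> 0 \<or> x n < t"
          using t lim by (cases "t \<le> 0") (auto intro: order_tendstoD)
        then have ev: "\<forall>\<^sub>F n in sequentially. 0 = excess (x n) t"
          by eventually_elim (auto simp: excess_def)
        have "excess h t = 0" unfolding excess_def using False by (rule if_not_P)
        then show ?thesis using Lim_transform_eventually[OF tendsto_const ev] by simp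
      qed
      then show "(\<lambda>n. excess (x n) t powr b) \<longlonglongrightarrow> excess h t powr b"
        using b excess_nonneg by (intro tendsto_powr2 tendsto_const) auto
    qed
  qed measurable
qed

text \<open>Where the excess is at most \<open>a\<close>, its \<open>k\<close>-th power is at most \<open>a\<^sup>k\<close>; elsewhere, it is at most the
  \<open>(k + 1)\<close>-st power divided by \<open>a\<close>.\<close>
lemma excess_moment_interpolate:
  assumes h: "0 < h" and a: "0 < a"
  shows "excess_moment k h \<le> h * a powr k + excess_moment (k + 1) h / a"
proof -
  have i: "integrable lborel (\<lambda>t. indicator {0<..<h} t *\<^sub>R (a powr k))"
    by (intro integrable_scaleR_left integrable_real_indicator) (use h in auto)
  have i2: "integrable lborel (\<lambda>t. excess h t powr (k + 1) / a)"
    using integrable_excess[OF h, of "k + 1"] k by (intro integrable_divide) auto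
  have "excess_moment k h \<le> (\<integral>t. indicator {0<..<h} t *\<^sub>R (a powr k) + excess h t powr (k + 1) / a \<partial>lborel)"
    unfolding excess_moment_def
  proof (rule integral_mono)
    show "integrable lborel (\<lambda>t. excess h t powr k)" using k by (intro integrable_excess h) auto
    show "integrable lborel (\<lambda>t. indicator {0<..<h} t *\<^sub>R (a powr k) + excess h t powr (k + 1) / a)"
      by (intro Bochner_Integration.integrable_add i i2)
    fix t
    have e0: "0 \<le> excess h t" by (rule excess_nonneg)
    show "excess h t powr k \<le> indicator {0<..<h} t *\<^sub>R (a powr k) + excess h t powr (k + 1) / a"
    proof (cases "t \<in> {0<..<h}")
      case True
      show ?thesis
      proof (cases "excess h t \<le> a")
        case le: True
        then have "excess h t powr k \<le> a powr k" using k e0 by (intro powr_mono2) auto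
        moreover have "0 \<le> excess h t powr (k + 1) / a" using a by simp
        ultimately show ?thesis using True by simp
      next
        case False
        have "excess h t powr k * a \<le> excess h t powr k * excess h t"
          using False by (intro mult_left_mono) auto
        also have "\<dots> = excess h t powr (k + 1)" using False a by (simp add: powr_add)
        finally have "excess h t powr k \<le> excess h t powr (k + 1) / a" using a by (simp add: pos_le_divide_eq)
        moreover have "0 \<le> a powr k" by simp
        ultimately show ?thesis using True by (simp add: add_increasing)
      qed
    next
      case False
      then have "excess h t = 0" by (auto simp: excess_def)
      then show ?thesis using False k by simp
    qed
  qed
  also have "\<dots> = h * a powr k + excess_moment (k + 1) h / a"
    using h by (subst Bochner_Integration.integral_add[OF i i2]) (simp add: excess_moment_def)
  finally show ?thesis .
qed

text \<open>For small \<open>h\<close>: the choice of \<open>a\<close> that makes the first term of the interpolation inequality half of the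
  left-hand side gives the ratio at least \<open>(2 h)\<^sup>-\<^sup>1\<^sup>/\<^sup>k / 2\<close>.\<close>
lemma excess_ratio_large:
  assumes M: "0 < M"
  shows "\<exists>h>0. M * excess_moment k h powr ((k + 1) / k) \<le> excess_moment (k + 1) h"
proof -
  define h where "h = (2 * M) powr (- k) / 2"
  have h: "0 < h" using M by (simp add: h_def)
  define J where "J = excess_moment k h"
  have J: "0 < J" using excess_moment_pos[OF h k] by (simp add: J_def)
  define a where "a = (J / (2 * h)) powr (1 / k)"
  have a: "0 < a" using J h by (simp add: a_def)
  have "a powr k = J / (2 * h)" using k J h by (simp add: a_def powr_powr)
  then have "J \<le> J / 2 + excess_moment (k + 1) h / a"
    using excess_moment_interpolate[OF h a] h by (simp add: J_def[symmetric])
  then have "J / 2 * a \<le> excess_moment (k + 1) h" using a by (simp add: field_simps)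
  moreover have "J / 2 * a = M * J powr ((k + 1) / k)"
  proof -
    have "2 * h = (2 * M) powr (- k)" by (simp add: h_def)
    then have "(2 * h) powr (1 / k) = ((2 * M) powr (- k)) powr (1 / k)" by simp
    also have "\<dots> = (2 * M) powr (- 1)" using k by (subst powr_powr) simp
    also have "\<dots> = 1 / (2 * M)" using M by (simp add: powr_minus field_simps)
    finally have "(2 * h) powr (1 / k) = 1 / (2 * M)" .
    then have "a = J powr (1 / k) * (2 * M)" using J h M by (simp add: a_def powr_divide)
    moreover have "J powr ((k + 1) / k) = J * J powr (1 / k)"
    proof -
      have "(k + 1) / k = 1 + 1 / k" using k by (simp add: field_simps)
      then show ?thesis using J by (simp only: powr_add) simp
    qed
    ultimately show ?thesis by simp
  qed
  ultimately show ?thesis using h by (auto simp: J_def)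
qed

text \<open>If \<open>ln\<^sub>\<phi>\<close> is unbounded, take \<open>u\<close> large and \<open>h\<close> with \<open>ln\<^sub>\<phi> h = 2 ln\<^sub>\<phi> u\<close>: the excess is at least \<open>ln\<^sub>\<phi> u\<close> on
  \<open>(0, u)\<close>, so the right-hand sides contain the factor \<open>u\<^sup>1\<^sup>/\<^sup>k\<close>. If it is bounded, it suffices that the
  moment is unbounded: on \<open>(0, h / 2)\<close> the excess is at least \<open>h / (2 \<phi>(h)) \<ge> h\<^sup>-\<^sup>\<delta> / 2\<close>, and
  \<open>\<delta> < 1 / k\<close>.\<close>
lemma excess_moment_large:
  assumes \<eta>: "0 < \<eta>"
  shows "\<exists>h\<ge>1. ln_phi \<phi> h \<le> \<eta> * excess_moment k h powr (1 / k) \<and> 1 \<le> \<eta> * excess_moment k h powr (1 / k)"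
proof -
  have lower: "u powr (1 / k) * (ln_phi \<phi> h - ln_phi \<phi> u) \<le> excess_moment k h powr (1 / k)"
    if u: "0 < u" "u < h" for u h
  proof -
    have "(u * (ln_phi \<phi> h - ln_phi \<phi> u) powr k) powr (1 / k) \<le> excess_moment k h powr (1 / k)"
      using u k excess_moment_ge[OF u, of k] by (intro powr_mono2) auto
    moreover have "(u * (ln_phi \<phi> h - ln_phi \<phi> u) powr k) powr (1 / k) = u powr (1 / k) * (ln_phi \<phi> h - ln_phi \<phi> u)"
      using u k ln_phi_strict_mono[OF u] by (simp add: powr_mult powr_powr)
    ultimately show ?thesis by simp
  qed
  show ?thesis
  proof (cases "\<forall>s. \<exists>t>0. s < ln_phi \<phi> t")
    case True
    have g2: "0 < ln_phi \<phi> 2" using ln_phi_strict_mono[of 1 2] by (simp add: ln_phi_1)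
    define z where "z = max (2 / \<eta>) (1 / (\<eta> * ln_phi \<phi> 2))"
    define u where "u = max 2 (z powr k)"
    have z: "0 < z" "2 \<le> \<eta> * z" "1 \<le> \<eta> * z * ln_phi \<phi> 2"
      using \<eta> g2 by (auto simp: z_def max_def field_simps)
    have "z = (z powr k) powr (1 / k)" using z k by (simp add: powr_powr)
    also have "\<dots> \<le> u powr (1 / k)" using k by (intro powr_mono2) (auto simp: u_def)
    finally have zu: "z \<le> u powr (1 / k)" .
    have u2: "2 \<le> u" by (simp add: u_def)
    have gu: "ln_phi \<phi> 2 \<le> ln_phi \<phi> u" using u2 ln_phi_le_iff[of 2 u] by simp
    obtain t where t: "0 < t" "2 * ln_phi \<phi> u < ln_phi \<phi> t" using True by blast
    obtain h where h: "0 < h" "ln_phi \<phi> h = 2 * ln_phi \<phi> u"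
      using ln_phi_surj[of u t "2 * ln_phi \<phi> u"] t u2 gu g2 by auto
    have uh: "u < h" using h gu g2 u2 ln_phi_less_iff[of u h] by auto
    have "z * ln_phi \<phi> u \<le> u powr (1 / k) * ln_phi \<phi> u" using zu gu g2 by (intro mult_right_mono) auto
    also have "\<dots> \<le> excess_moment k h powr (1 / k)" using lower[OF _ uh] u2 h by simp
    finally have *: "\<eta> * (z * ln_phi \<phi> u) \<le> \<eta> * excess_moment k h powr (1 / k)" using \<eta> by simp
    have "2 * ln_phi \<phi> u \<le> \<eta> * z * ln_phi \<phi> u" using z gu g2 by (intro mult_right_mono) auto
    moreover have "\<eta> * z * ln_phi \<phi> 2 \<le> \<eta> * z * ln_phi \<phi> u" using z gu by (intro mult_left_mono) auto
    ultimately show ?thesis using * z h uh u2 by (intro exI[of _ h]) (auto simp: mult.assoc)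
  next
    case False
    then obtain L where "\<not> (\<exists>t>0. L < ln_phi \<phi> t)" by blast
    then have L: "\<And>t. 0 < t \<Longrightarrow> ln_phi \<phi> t \<le> L" by (meson not_le)
    define L' where "L' = max L 1"
    have exponent: "0 < 1 / k - \<delta>"
    proof -
      have "\<delta> * k < 1" using \<delta> by (simp add: distrib_left)
      then show ?thesis using k by (simp add: pos_less_divide_eq)
    qed
    define e where "e = 1 / k - \<delta>"
    define c where "c = (1/2) powr (1 / k) / 2"
    have c: "0 < c" by (simp add: c_def)
    have "\<forall>\<^sub>F h in at_top. L' / (\<eta> * c) \<le> h powr e"
    proof -
      have e0: "0 < e" using exponent by (simp add: e_def)
      have z0: "0 \<le> L' / (\<eta> * c)" using \<eta> c by (simp add: L'_def)
      have "\<forall>\<^sub>F h in at_top. (L' / (\<eta> * c)) powr (1 / e) \<le> h" by (rule eventually_ge_at_top)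
      then show ?thesis
      proof eventually_elim
        fix h assume "(L' / (\<eta> * c)) powr (1 / e) \<le> h"
        then have "((L' / (\<eta> * c)) powr (1 / e)) powr e \<le> h powr e" using e0 by (intro powr_mono2) auto
        moreover have "((L' / (\<eta> * c)) powr (1 / e)) powr e = L' / (\<eta> * c)"
          unfolding powr_powr using e0 z0 by (simp del: abs_divide)
        ultimately show "L' / (\<eta> * c) \<le> h powr e" by simp
      qed
    qed
    moreover note growth_at_top
    moreover have "\<forall>\<^sub>F h in at_top. (1::real) \<le> h" by (rule eventually_ge_at_top)
    ultimately have "\<forall>\<^sub>F h in at_top. L' / (\<eta> * c) \<le> h powr e \<and> \<phi> h \<le> h powr (1 + \<delta>) \<and> 1 \<le> h"
      by eventually_elim auto
    from eventually_happens'[OF trivial_limit_at_top_linorder this]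
    obtain h where h: "L' / (\<eta> * c) \<le> h powr e" "\<phi> h \<le> h powr (1 + \<delta>)" "1 \<le> h"
      by blast
    have "h / 2 * (1 / \<phi> h) \<le> ln_phi \<phi> h - ln_phi \<phi> (h / 2)"
    proof -
      let ?f = "\<lambda>s. ln_phi \<phi> s - s * (1 / \<phi> h)"
      have "?f (h / 2) \<le> ?f h"
      proof (rule DERIV_nonneg_imp_nondecreasing[where f = ?f])
        fix x assume x: "h / 2 \<le> x" "x \<le> h"
        then have x0: "0 < x" using h by simp
        have "\<phi> x \<le> \<phi> h" using x x0 by (intro mono_onD[OF mono]) auto
        then have "1 / \<phi> h \<le> 1 / \<phi> x" using pos[OF x0] by (intro divide_left_mono) auto
        moreover have "(?f has_real_derivative 1 / \<phi> x - 1 * (1 / \<phi> h)) (at x)"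
          by (intro DERIV_diff ln_phi_deriv x0 DERIV_cmult_right DERIV_ident)
        ultimately show "\<exists>y. (?f has_real_derivative y) (at x) \<and> 0 \<le> y" by (intro exI[of _ "1 / \<phi> x - 1 * (1 / \<phi> h)"]) auto
      qed (use h in auto)
      moreover have "h * (1 / \<phi> h) = h / 2 * (1 / \<phi> h) + h / 2 * (1 / \<phi> h)" by simp
      ultimately show ?thesis by linarith
    qed
    moreover have "h powr (- \<delta>) / 2 \<le> h / 2 * (1 / \<phi> h)"
    proof -
      have "h powr (1 + \<delta>) = h * h powr \<delta>" using h by (simp add: powr_add)
      then have "h powr (- \<delta>) = h * (1 / h powr (1 + \<delta>))" using h by (simp add: powr_minus divide_inverse)
      also have "\<dots> \<le> h * (1 / \<phi> h)" using h pos[of h] by (intro mult_left_mono divide_left_mono) auto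
      finally show ?thesis by simp
    qed
    ultimately have "h powr (- \<delta>) / 2 \<le> ln_phi \<phi> h - ln_phi \<phi> (h / 2)" by linarith
    then have "(h / 2) powr (1 / k) * (h powr (- \<delta>) / 2) \<le> (h / 2) powr (1 / k) * (ln_phi \<phi> h - ln_phi \<phi> (h / 2))"
      by (intro mult_left_mono) auto
    also have "\<dots> \<le> excess_moment k h powr (1 / k)" using h by (intro lower) auto
    also have "(h / 2) powr (1 / k) * (h powr (- \<delta>) / 2) = c * h powr e"
    proof -
      have "(h / 2) powr (1 / k) = h powr (1 / k) * (1 / 2) powr (1 / k)"
        using h powr_mult[of h "1 / 2" "1 / k"] by simp
      moreover have "h powr (1 / k) * h powr (- \<delta>) = h powr e"
        by (simp add: e_def powr_add[symmetric])
      ultimately show ?thesis by (simp add: c_def mult_ac)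
    qed
    finally have "\<eta> * (c * h powr e) \<le> \<eta> * excess_moment k h powr (1 / k)" using \<eta> by simp
    moreover have "L' \<le> \<eta> * (c * h powr e)" using h(1) \<eta> c by (simp add: pos_divide_le_eq mult_ac)
    ultimately have "L' \<le> \<eta> * excess_moment k h powr (1 / k)" by linarith
    moreover have "ln_phi \<phi> h \<le> L'" "1 \<le> L'" using L[of h] h by (auto simp: L'_def)
    ultimately show ?thesis using h by (intro exI[of _ h]) auto
  qed
qed

text \<open>On \<open>[1, h)\<close> the excess is at most \<open>ln\<^sub>\<phi> h\<close>; on \<open>(0, 1)\<close> it is \<open>ln\<^sub>\<phi> h + excess 1 t\<close>.\<close>
lemma excess_moment_upper:
  assumes h: "1 \<le> h"
  shows "excess_moment (k + 1) h \<le> ln_phi \<phi> h * excess_moment k h +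
     2 powr (k + 1) * (ln_phi \<phi> h powr (k + 1) + excess_moment (k + 1) 1)"
proof -
  let ?\<Lambda> = "ln_phi \<phi> h"
  have \<Lambda>: "0 \<le> ?\<Lambda>" using h ln_phi_le_iff[of 1 h] by (simp add: ln_phi_1)
  have i1: "integrable lborel (\<lambda>t. ?\<Lambda> * excess h t powr k)"
    using h k by (intro integrable_mult_right integrable_excess) auto
  have i2: "integrable lborel (\<lambda>t. indicator {0<..<1::real} t *\<^sub>R (?\<Lambda> powr (k + 1)) + excess 1 t powr (k + 1))"
    using k by (intro Bochner_Integration.integrable_add integrable_scaleR_left integrable_real_indicator integrable_excess) auto
  then have i3: "integrable lborel (\<lambda>t. 2 powr (k + 1) * (indicator {0<..<1::real} t *\<^sub>R (?\<Lambda> powr (k + 1)) + excess 1 t powr (k + 1)))"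
    by (rule integrable_mult_right)
  have "excess_moment (k + 1) h \<le> (\<integral>t. ?\<Lambda> * excess h t powr k +
      2 powr (k + 1) * (indicator {0<..<1::real} t *\<^sub>R (?\<Lambda> powr (k + 1)) + excess 1 t powr (k + 1)) \<partial>lborel)"
    unfolding excess_moment_def
  proof (rule integral_mono)
    show "integrable lborel (\<lambda>t. excess h t powr (k + 1))" using h k by (intro integrable_excess) auto
    show "integrable lborel (\<lambda>t. ?\<Lambda> * excess h t powr k +
      2 powr (k + 1) * (indicator {0<..<1::real} t *\<^sub>R (?\<Lambda> powr (k + 1)) + excess 1 t powr (k + 1)))"
      by (intro Bochner_Integration.integrable_add i1 i3)
    fix t
    have e0: "0 \<le> excess h t" "0 \<le> excess 1 t" by (rule excess_nonneg)+
    have z: "0 \<le> ?\<Lambda> * excess h t powr k" using \<Lambda> by simp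
    show "excess h t powr (k + 1) \<le> ?\<Lambda> * excess h t powr k +
      2 powr (k + 1) * (indicator {0<..<1::real} t *\<^sub>R (?\<Lambda> powr (k + 1)) + excess 1 t powr (k + 1))"
    proof (cases "0 < t \<and> t < 1")
      case True
      then have "excess h t = ?\<Lambda> + excess 1 t" using h by (simp add: excess_def ln_phi_1)
      then have "excess h t powr (k + 1) \<le> 2 powr (k + 1) * (?\<Lambda> powr (k + 1) + excess 1 t powr (k + 1))"
        using powr_add_le[of ?\<Lambda> "excess 1 t" "k + 1"] \<Lambda> e0 k by simp
      then show ?thesis using True z by simp
    next
      case False
      have "excess h t \<le> ?\<Lambda>"
        using False \<Lambda> ln_phi_le_iff[of 1 t] by (auto simp: excess_def ln_phi_1)
      moreover have "excess h t powr (k + 1) = excess h t powr k * excess h t"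
        using e0 by (cases "excess h t = 0") (auto simp: powr_add)
      ultimately have "excess h t powr (k + 1) \<le> ?\<Lambda> * excess h t powr k"
        using mult_right_mono[of "excess h t" ?\<Lambda> "excess h t powr k"] by (simp add: mult.commute)
      moreover have "0 \<le> 2 powr (k + 1) * (indicator {0<..<1::real} t *\<^sub>R (?\<Lambda> powr (k + 1)) + excess 1 t powr (k + 1))"
        by (intro mult_nonneg_nonneg add_nonneg_nonneg) auto
      ultimately show ?thesis by linarith
    qed
  qed
  also have "\<dots> = ?\<Lambda> * excess_moment k h + 2 powr (k + 1) * (?\<Lambda> powr (k + 1) + excess_moment (k + 1) 1)"
  proof -
    have "(\<integral>t. indicator {0<..<1::real} t *\<^sub>R (?\<Lambda> powr (k + 1)) + excess 1 t powr (k + 1) \<partial>lborel) =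
        ?\<Lambda> powr (k + 1) + excess_moment (k + 1) 1"
      using k by (subst Bochner_Integration.integral_add)
        (auto simp: excess_moment_def intro!: integrable_scaleR_left integrable_real_indicator integrable_excess)
    then show ?thesis
      by (subst Bochner_Integration.integral_add[OF i1 i3]) (simp add: excess_moment_def)
  qed
  finally show ?thesis .
qed

text \<open>Insert the \<open>h\<close> of \<open>excess_moment_large\<close> into the upper bound of the \<open>(k + 1)\<close>-st moment: each of the three
  terms is at most a multiple of \<open>\<eta>\<close> times the required power of the \<open>k\<close>-th moment.\<close>
lemma excess_ratio_small:
  assumes \<epsilon>: "0 < \<epsilon>"
  shows "\<exists>h>0. excess_moment (k + 1) h \<le> \<epsilon> * excess_moment k h powr ((k + 1) / k)"
proof -
  define c where "c = excess_moment (k + 1) 1"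
  have c: "0 < c" using excess_moment_pos[of 1 "k + 1"] k by (simp add: c_def)
  define B where "B = 1 + 2 powr (k + 1) * (1 + c)"
  have B: "0 < B" using c by (simp add: B_def add_pos_nonneg)
  define \<eta> where "\<eta> = min 1 (\<epsilon> / B)"
  have \<eta>: "0 < \<eta>" "\<eta> \<le> 1" "\<eta> * B \<le> \<epsilon>" using \<epsilon> B by (auto simp: \<eta>_def min_def field_simps)
  obtain h where h: "1 \<le> h" and h1: "ln_phi \<phi> h \<le> \<eta> * excess_moment k h powr (1 / k)"
    and h2: "1 \<le> \<eta> * excess_moment k h powr (1 / k)"
    using excess_moment_large[OF \<eta>(1)] by blast
  define J where "J = excess_moment k h"
  have J: "0 < J" using excess_moment_pos[of h k] h k by (simp add: J_def)
  define Z where "Z = J powr ((k + 1) / k)"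
  have Z: "Z = J powr (1 / k) * J"
  proof -
    have "(k + 1) / k = 1 / k + 1" using k by (simp add: field_simps)
    then show ?thesis using J unfolding Z_def by (simp only: powr_add) simp
  qed
  have Z': "Z = (J powr (1 / k)) powr (k + 1)" by (simp add: Z_def powr_powr)
  have Z0: "0 < Z" using J by (simp add: Z_def)
  have \<Lambda>: "0 \<le> ln_phi \<phi> h" using h ln_phi_le_iff[of 1 h] by (simp add: ln_phi_1)
  have \<eta>k: "\<eta> powr (k + 1) \<le> \<eta>"
    using powr_mono'[of 1 "k + 1" \<eta>] \<eta> k by simp
  have t1: "ln_phi \<phi> h * J \<le> \<eta> * Z"
    unfolding Z using mult_right_mono[OF h1[folded J_def], of J] J by (simp add: mult.assoc)
  have up: "(\<eta> * J powr (1 / k)) powr (k + 1) \<le> \<eta> * Z"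
  proof -
    have "(\<eta> * J powr (1 / k)) powr (k + 1) = \<eta> powr (k + 1) * Z"
      unfolding Z' using \<eta> by (simp add: powr_mult)
    then show ?thesis using \<eta>k Z0 by (simp add: mult_right_mono)
  qed
  have t2: "ln_phi \<phi> h powr (k + 1) \<le> \<eta> * Z"
    using powr_mono2[of "k + 1" "ln_phi \<phi> h" "\<eta> * J powr (1 / k)"] \<Lambda> h1 k up by (simp add: J_def[symmetric])
  have t3: "1 \<le> \<eta> * Z"
    using powr_mono2[of "k + 1" 1 "\<eta> * J powr (1 / k)"] h2 k up by (simp add: J_def[symmetric])
  have "excess_moment (k + 1) h \<le> ln_phi \<phi> h * J + 2 powr (k + 1) * (ln_phi \<phi> h powr (k + 1) + c)"
    using excess_moment_upper[OF h] by (simp add: J_def c_def)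
  also have "\<dots> \<le> \<eta> * Z + 2 powr (k + 1) * (\<eta> * Z + c * (\<eta> * Z))"
  proof (intro add_mono mult_left_mono t1 t2)
    show "c \<le> c * (\<eta> * Z)" using mult_left_mono[OF t3, of c] c by simp
  qed auto
  also have "\<dots> = \<eta> * B * Z" by (simp add: B_def algebra_simps)
  also have "\<dots> \<le> \<epsilon> * Z" using \<eta> Z0 by (intro mult_right_mono) auto
  finally show ?thesis using h by (auto simp: Z_def J_def intro!: exI[of _ h])
qed

theorem excess_ratio_attained:
  assumes r: "0 < r"
  shows "\<exists>h>0. excess_moment (k + 1) h = r * excess_moment k h powr ((k + 1) / k)"
proof -
  define f where "f h = excess_moment (k + 1) h - r * excess_moment k h powr ((k + 1) / k)" for h
  obtain a where a: "0 < a" "0 \<le> f a" using excess_ratio_large[OF r] by (auto simp: f_def)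
  obtain b where b: "0 < b" "f b \<le> 0" using excess_ratio_small[OF r] by (auto simp: f_def)
  have "continuous_on {0<..} f"
    unfolding f_def using k excess_moment_pos[of _ k] 
    by (intro continuous_intros continuous_on_excess_moment) (auto simp: less_imp_neq[symmetric])
  then have "connected (f ` {0<..})" by (rule connected_continuous_image) simp
  then have "0 \<in> f ` {0<..}"
    using connectedD_interval[of "f ` {0<..}" "f b" "f a" 0] a b by auto
  then show ?thesis by (auto simp: f_def)
qed

end

lemma O_class_admissible:
  assumes \<phi>: "\<phi> \<in> O_class (2 / (real d + 2))" and d: "0 < d"
  shows "\<exists>\<delta> C s\<^sub>0. admissible_deformation \<phi> (real d / 2) \<delta> C s\<^sub>0"
proof -
  define a where "a = 2 / (real d + 2)"
  have a: "0 < a" by (simp add: a_def)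
  have mono: "mono_on {0<..} \<phi>" and pos: "\<And>s. 0 < s \<Longrightarrow> 0 < \<phi> s" and cont: "continuous_on {0<..} \<phi>"
    and "delta_lower \<phi> < ereal a" "delta_upper \<phi> < ereal a"
    using \<phi> by (auto simp: O_class_def a_def)
  then obtain \<delta>\<^sub>1 \<delta>\<^sub>2 L where d1: "\<delta>\<^sub>1 < a" "((\<lambda>s. s powr (1 + \<delta>\<^sub>1) / \<phi> s) \<longlongrightarrow> L) (at_right 0)"
    and d2: "\<delta>\<^sub>2 < a" "filterlim (\<lambda>s. s powr (1 + \<delta>\<^sub>2) / \<phi> s) at_top at_top"
    unfolding delta_lower_def delta_upper_def INF_less_iff by auto
  define \<delta> where "\<delta> = max (max \<delta>\<^sub>1 \<delta>\<^sub>2) (a / 2)"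
  have \<delta>: "0 < \<delta>" "\<delta> < a" "\<delta>\<^sub>1 \<le> \<delta>" "\<delta>\<^sub>2 \<le> \<delta>" using a d1 d2 by (auto simp: \<delta>_def)
  have "\<forall>\<^sub>F s in at_right 0. s powr (1 + \<delta>\<^sub>1) / \<phi> s < L + 1"
    using d1(2) by (rule order_tendstoD) simp
  then obtain u where u: "0 < u" "\<And>s. 0 < s \<Longrightarrow> s < u \<Longrightarrow> s powr (1 + \<delta>\<^sub>1) / \<phi> s < L + 1"
    unfolding eventually_at_right_field by auto
  have "admissible_deformation \<phi> (real d / 2) \<delta> (L + 1) (min u 1)"
  proof
    show "mono_on {0<..} \<phi>" "continuous_on {0<..} \<phi>" by fact+
    show "0 < \<phi> s" if "0 < s" for s using pos that .
    show "0 < real d / 2" using d by simp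
    show "0 < \<delta>" by fact
    have "\<delta> * (real d / 2 + 1) < a * (real d / 2 + 1)" using \<delta> by (intro mult_strict_right_mono) auto
    also have "\<dots> = 1" by (simp add: a_def field_simps)
    finally show "\<delta> * (real d / 2 + 1) < 1" .
    show "0 < min u 1" using u by simp
    show "s powr (1 + \<delta>) \<le> (L + 1) * \<phi> s" if s: "0 < s" "s < min u 1" for s
    proof -
      have "s powr (1 + \<delta>) \<le> s powr (1 + \<delta>\<^sub>1)" using s \<delta> by (intro powr_mono') auto
      moreover have "s powr (1 + \<delta>\<^sub>1) < (L + 1) * \<phi> s" using u(2)[of s] s pos[of s] by (simp add: pos_divide_less_eq)
      ultimately show ?thesis by simp
    qed
    have "\<forall>\<^sub>F s in at_top. 1 \<le> s powr (1 + \<delta>\<^sub>2) / \<phi> s" using d2(2) by (simp add: filterlim_at_top)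
    moreover have "\<forall>\<^sub>F s in at_top. (1::real) \<le> s" by (rule eventually_ge_at_top)
    ultimately show "\<forall>\<^sub>F s in at_top. \<phi> s \<le> s powr (1 + \<delta>)"
    proof eventually_elim
      fix s :: real assume s: "1 \<le> s powr (1 + \<delta>\<^sub>2) / \<phi> s" "1 \<le> s"
      then have "\<phi> s \<le> s powr (1 + \<delta>\<^sub>2)" using pos[of s] by (simp add: pos_le_divide_eq)
      also have "\<dots> \<le> s powr (1 + \<delta>)" using s \<delta> by (intro powr_mono) auto
      finally show "\<phi> s \<le> s powr (1 + \<delta>)" .
    qed
  qed
  then show ?thesis by blast
qed

text \<open>Scaling the argument by \<open>c\<close> multiplies the two radial moments by \<open>c\<^sup>-\<^sup>k\<close> and \<open>c\<^sup>-\<^sup>k\<^sup>-\<^sup>1\<close>. The mass fixes \<open>c\<close>; the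
  second moment is then right if the scale invariant ratio of the moments has the value \<open>r\<close>.\<close>
lemma (in admissible_deformation) exp_phi_profile_exists:
  assumes \<kappa>: "0 < \<kappa>"
  shows "\<exists>l c. 0 < c \<and> ennreal \<kappa> * radial_moment (\<lambda>r. exp_phi \<phi> (l - c * r)) k = 1 \<and>
     ennreal \<kappa> * radial_moment (\<lambda>r. exp_phi \<phi> (l - c * r)) (k + 1) = ennreal (2 * k)"
proof -
  define r where "r = 2 * k * (k + 1) / \<kappa> * (\<kappa> / k) powr ((k + 1) / k)"
  have "0 < r" using k \<kappa> by (simp add: r_def)
  then obtain h where h: "0 < h" and eq: "excess_moment (k + 1) h = r * excess_moment k h powr ((k + 1) / k)"
    using excess_ratio_attained by blast
  define J where "J = excess_moment k h"
  have J: "0 < J" using excess_moment_pos[OF h k] by (simp add: J_def)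
  define c where "c = (\<kappa> * J / k) powr (1 / k)"
  have c: "0 < c" using J k \<kappa> by (simp add: c_def)
  have ck: "c powr k = \<kappa> * J / k" using J k \<kappa> by (simp add: c_def powr_powr)
  have ck1: "c powr (k + 1) = (\<kappa> / k) powr ((k + 1) / k) * J powr ((k + 1) / k)"
    using J k \<kappa> by (simp add: c_def powr_powr powr_mult[symmetric])
  let ?l = "ln_phi \<phi> h"
  have rm: "radial_moment (\<lambda>r. exp_phi \<phi> (?l - c * r)) b = ennreal (c powr (- b) * (1 / b * excess_moment b h))"
    if b: "0 < b" "b \<le> k + 1" for b
    using radial_moment_scale[of "\<lambda>r. exp_phi \<phi> (?l - r)" c b] c radial_moment_exp_phi[OF h b(1)]
      nn_integral_excess[OF h b] excess_moment_pos[OF h b] b(1)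
    by (simp add: ennreal_mult[symmetric])
  have "\<kappa> * (c powr (- k) * (1 / k * J)) = 1"
    using J k \<kappa> by (simp add: powr_minus ck field_simps)
  then have m0: "ennreal \<kappa> * radial_moment (\<lambda>r. exp_phi \<phi> (?l - c * r)) k = 1"
    using rm[of k] k \<kappa> J by (simp add: J_def[symmetric] ennreal_mult[symmetric])
  have "\<kappa> * (c powr (- (k + 1)) * (1 / (k + 1) * excess_moment (k + 1) h)) = 2 * k"
  proof -
    have "\<kappa> * (1 / (k + 1) * excess_moment (k + 1) h) = 2 * k * c powr (k + 1)"
    proof -
      have alg: "\<kappa> * (1 / m * (2 * k * m / \<kappa> * P * Q)) = 2 * k * (P * Q)" if "m \<noteq> 0" for m P Q
        using that \<kappa> by (simp add: field_simps)
      show ?thesis unfolding eq ck1 r_def J_def[symmetric] using k by (intro alg) simp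
    qed
    moreover have "c powr (k + 1) * c powr (- (k + 1)) = 1" using c by (simp add: powr_add[symmetric])
    ultimately show ?thesis by (metis (no_types, opaque_lifting) mult.assoc mult.commute mult.right_neutral)
  qed
  then have m1: "ennreal \<kappa> * radial_moment (\<lambda>r. exp_phi \<phi> (?l - c * r)) (k + 1) = ennreal (2 * k)"
    using rm[of "k + 1"] k \<kappa> excess_moment_pos[OF h, of "k + 1"] by (simp add: ennreal_mult[symmetric])
  show ?thesis using c m0 m1 by blast
qed

section \<open>Covariance of elliptic measures\<close>

lemma distr_elliptic_orthogonal:
  fixes R :: "real ^ 'n \<Rightarrow> real ^ 'n"
  assumes f: "f \<in> borel_measurable borel" and R: "orthogonal_transformation R"
  shows "distr (elliptic f (mat 1)) borel R = elliptic f (mat 1)"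
proof -
  have lin: "linear R" and M: "orthogonal_matrix (matrix R)"
    using R orthogonal_transformation_matrix by blast+
  have Rm: "(*v) (matrix R) = R" using lin by (simp add: matrix_vector_mul)
  have "invertible (matrix R)" using M by (auto simp: invertible_def orthogonal_matrix_def)
  from distr_elliptic[OF f spd_mat_1 this] show ?thesis
    using M by (simp add: Rm orthogonal_matrix_def)
qed

text \<open>The normalization of the second moment makes the covariance matrix the identity, so that the
  linear image under \<open>A\<close> has covariance \<open>A A\<^sup>T\<close>.\<close>
locale standard_elliptic =
  fixes f :: "real \<Rightarrow> ennreal" and \<rho> :: "(real ^ 'n) measure"
  assumes \<rho>_def: "\<rho> = elliptic f (mat 1)"
    and f [measurable]: "f \<in> borel_measurable borel"
    and mass: "(\<integral>\<^sup>+ (x :: real ^ 'n). f (x \<bullet> x) \<partial>lborel) = 1"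
    and moment: "(\<integral>\<^sup>+ (x :: real ^ 'n). f (x \<bullet> x) * ennreal (x \<bullet> x) \<partial>lborel) = ennreal (real CARD('n))"
begin

lemma rho_P2: "\<rho> \<in> P2"
  unfolding \<rho>_def by (rule elliptic_P2[OF f spd_mat_1 mass]) (simp add: moment)

sublocale prob_space \<rho> using rho_P2 by (simp add: P2_def)

lemma sets_rho [simp, measurable_cong]: "sets \<rho> = sets borel"
  by (simp add: \<rho>_def)

lemma integrable_components: "integrable \<rho> (\<lambda>x. x $ i * x $ j)"
proof (rule Bochner_Integration.integrable_bound)
  show "integrable \<rho> (\<lambda>x. (norm x)\<^sup>2)" using rho_P2 by (simp add: P2_def)
  have "\<bar>x $ i * x $ j\<bar> \<le> (norm x)\<^sup>2" for x :: "real ^ 'n"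
    using mult_mono[OF component_le_norm_cart[of x i] component_le_norm_cart[of x j]]
    by (simp add: abs_mult power2_eq_square)
  then show "AE x in \<rho>. norm (x $ i * x $ j) \<le> norm ((norm x)\<^sup>2)" by simp
qed measurable

lemma integrable_id: "integrable \<rho> (\<lambda>x. x)"
proof (rule Bochner_Integration.integrable_bound)
  show "integrable \<rho> (\<lambda>x. 1 + (norm x)\<^sup>2)" using rho_P2 by (simp add: P2_def)
  have "norm x \<le> 1 + (norm x)\<^sup>2" for x :: "real ^ 'n"
  proof -
    have "2 * norm x \<le> (norm x)\<^sup>2 + 1"
      using zero_le_power2[of "norm x - 1"] by (simp add: power2_diff)
    then show ?thesis using norm_ge_zero[of x] by linarith
  qed
  then show "AE x in \<rho>. norm x \<le> norm (1 + (norm x)\<^sup>2)" by (simp add: abs_of_nonneg)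
qed measurable

lemma integral_orthogonal:
  fixes g :: "real ^ 'n \<Rightarrow> 'b :: {banach, second_countable_topology}"
  assumes R: "orthogonal_transformation R" and [measurable]: "g \<in> borel_measurable borel"
  shows "(\<integral>x. g (R x) \<partial>\<rho>) = (\<integral>x. g x \<partial>\<rho>)"
proof -
  have "linear R" using R by (simp add: orthogonal_transformation_def)
  then have [measurable]: "R \<in> borel_measurable borel"
    by (intro borel_measurable_continuous_onI linear_continuous_on linear_conv_bounded_linear[THEN iffD1])
  have "(\<integral>x. g x \<partial>\<rho>) = (\<integral>x. g x \<partial>distr \<rho> borel R)"
    unfolding \<rho>_def distr_elliptic_orthogonal[OF f R] ..
  also have "\<dots> = (\<integral>x. g (R x) \<partial>\<rho>)" by (rule integral_distr) measurable
  finally show ?thesis ..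
qed

lemma mean_zero: "(\<integral>x. x \<partial>\<rho>) = 0"
proof -
  have "orthogonal_transformation (\<lambda>x :: real ^ 'n. - x)"
    by (simp add: orthogonal_transformation linear_iff)
  then have "(\<integral>x. - x \<partial>\<rho>) = (\<integral>x. x \<partial>\<rho>)" by (rule integral_orthogonal) simp
  then have "(\<integral>x. x \<partial>\<rho>) = - (\<integral>x. x \<partial>\<rho>)" by simp
  then show ?thesis by (simp add: eq_neg_iff_add_eq_0 flip: scaleR_2)
qed

text \<open>Reflect the \<open>i\<close>-th coordinate.\<close>
lemma uncorrelated:
  assumes "i \<noteq> j"
  shows "(\<integral>x. x $ i * x $ j \<partial>\<rho>) = 0"
proof -
  define R :: "real ^ 'n \<Rightarrow> real ^ 'n" where "R x = (\<chi> a. if a = i then - x $ a else x $ a)" for x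
  have "linear R" by (auto simp: R_def linear_iff vec_eq_iff)
  moreover have "norm (R x) = norm x" for x
    unfolding norm_eq_sqrt_inner inner_vec_def R_def by (intro arg_cong[where f = sqrt] sum.cong) auto
  ultimately have "orthogonal_transformation R" by (simp add: orthogonal_transformation)
  from integral_orthogonal[OF this, of "\<lambda>x. x $ i * x $ j"]
  have "(\<integral>x. R x $ i * R x $ j \<partial>\<rho>) = (\<integral>x. x $ i * x $ j \<partial>\<rho>)" by simp
  moreover have "R x $ i * R x $ j = - (x $ i * x $ j)" for x using assms by (simp add: R_def)
  ultimately show ?thesis by simp
qed

text \<open>Exchange the two coordinates.\<close>
lemma equal_variances: "(\<integral>x. x $ i * x $ i \<partial>\<rho>) = (\<integral>x. x $ j * x $ j \<partial>\<rho>)"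
proof -
  define R :: "real ^ 'n \<Rightarrow> real ^ 'n" where "R x = (\<chi> a. x $ Transposition.transpose i j a)" for x
  have "linear R" by (auto simp: R_def linear_iff vec_eq_iff)
  moreover have "norm (R x) = norm x" for x
  proof -
    have "(\<Sum>a\<in>UNIV. x $ Transposition.transpose i j a * x $ Transposition.transpose i j a) = (\<Sum>a\<in>UNIV. x $ a * x $ a)"
      by (rule sum.reindex_bij_betw[where g = "\<lambda>a. x $ a * x $ a"]) (simp add: bij_swap_iff)
    then show ?thesis by (simp add: norm_eq_sqrt_inner inner_vec_def R_def)
  qed
  ultimately have "orthogonal_transformation R" by (simp add: orthogonal_transformation)
  from integral_orthogonal[OF this, of "\<lambda>x. x $ j * x $ j"]
  show ?thesis by (simp add: R_def)
qed

lemma unit_variance: "(\<integral>x. x $ i * x $ i \<partial>\<rho>) = 1"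
proof -
  have "integrable \<rho> (\<lambda>x. x \<bullet> x)" using integrable_quadratic_form[OF rho_P2, of "mat 1"] by simp
  then have "ennreal (\<integral>x. x \<bullet> x \<partial>\<rho>) = (\<integral>\<^sup>+ x. ennreal (x \<bullet> x) \<partial>\<rho>)"
    by (rule nn_integral_eq_integral[symmetric]) simp
  also have "\<dots> = ennreal (real CARD('n))"
    unfolding \<rho>_def by (simp add: nn_integral_elliptic_mat_1 moment)
  finally have "(\<integral>x. x \<bullet> x \<partial>\<rho>) = real CARD('n)"
    by (subst (asm) ennreal_inj) (auto intro: Bochner_Integration.integral_nonneg)
  moreover have "(\<integral>x. x \<bullet> x \<partial>\<rho>) = (\<Sum>a\<in>UNIV. \<integral>x. x $ a * x $ a \<partial>\<rho>)"
    unfolding inner_vec_def by (simp add: integrable_components)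
  moreover have "\<dots> = (\<Sum>a\<in>(UNIV :: 'n set). \<integral>x. x $ i * x $ i \<partial>\<rho>)"
    by (intro sum.cong refl equal_variances)
  ultimately show ?thesis by simp
qed

lemma has_mean_cov_affine_image:
  fixes S :: "real ^ 'n ^ 'n"
  shows "has_mean_cov (distr \<rho> borel (\<lambda>x. v + S *v x)) v (S ** transpose S)"
  unfolding has_mean_cov_def
proof (intro conjI allI)
  let ?T = "\<lambda>x. v + S *v x"
  have bl: "bounded_linear ((*v) S)" by (rule matrix_vector_mul_bounded_linear)
  have iS: "integrable \<rho> (\<lambda>x. S *v x)" by (rule integrable_bounded_linear[OF bl integrable_id])
  have "(\<integral>x. S *v x \<partial>\<rho>) = S *v (\<integral>x. x \<partial>\<rho>)" by (rule integral_bounded_linear[OF bl integrable_id])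
  then have "(\<integral>x. ?T x \<partial>\<rho>) = v" using iS by (simp add: mean_zero prob_space)
  moreover have "integrable \<rho> ?T" using iS by simp
  ultimately show "has_bochner_integral (distr \<rho> borel ?T) (\<lambda>x. x) v"
    by (simp add: has_bochner_integral_iff integrable_distr_eq integral_distr)
  fix i j
  have e: "(?T x - v) $ i * (?T x - v) $ j = (\<Sum>a\<in>UNIV. \<Sum>b\<in>UNIV. S $ i $ a * S $ j $ b * (x $ a * x $ b))" for x
    by (simp add: matrix_vector_mult_def sum_product mult_ac)
  have I: "(\<integral>x. x $ a * x $ b \<partial>\<rho>) = (if a = b then 1 else 0)" for a b
    using uncorrelated unit_variance by simp
  have "(\<integral>x. (?T x - v) $ i * (?T x - v) $ j \<partial>\<rho>) = (\<Sum>a\<in>UNIV. \<Sum>b\<in>UNIV. S $ i $ a * S $ j $ b * (if a = b then 1 else 0))"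
    unfolding e by (simp add: integrable_components I)
  also have "\<dots> = (S ** transpose S) $ i $ j"
    by (simp add: matrix_matrix_mult_def transpose_def if_distrib cong: if_cong)
  finally have "(\<integral>x. (?T x - v) $ i * (?T x - v) $ j \<partial>\<rho>) = (S ** transpose S) $ i $ j" .
  moreover have "integrable \<rho> (\<lambda>x. (?T x - v) $ i * (?T x - v) $ j)"
    unfolding e by (intro Bochner_Integration.integrable_sum integrable_mult_right integrable_components)
  ultimately show "has_bochner_integral (distr \<rho> borel ?T) (\<lambda>x. (x - v) $ i * (x - v) $ j) ((S ** transpose S) $ i $ j)"
    by (simp add: has_bochner_integral_iff integrable_distr_eq integral_distr)
qed

end

section \<open>Existence of phi-exponential measures\<close>

lemma phi_measure_eq_distr_elliptic:
  fixes V :: "real ^ 'n ^ 'n"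
  assumes [measurable]: "exp_phi \<phi> \<in> borel_measurable borel"
  shows "phi_measure \<phi> l c v V = distr (elliptic (\<lambda>r. exp_phi \<phi> (l - c * r)) V) borel (\<lambda>x. v + x)"
proof -
  define g where "g y = exp_phi \<phi> (l - c * ((y - v) \<bullet> (matrix_inv V *v (y - v)))) * ennreal (det V powr (- 1 / 2))" for y
  have [measurable]: "g \<in> borel_measurable borel" unfolding g_def by measurable
  have "phi_measure \<phi> l c v V = density (distr lborel borel (\<lambda>x. v + x)) g"
    by (simp add: phi_measure_def g_def[abs_def] lborel_distr_translation)
  also have "\<dots> = distr (density lborel (\<lambda>x. g (v + x))) borel (\<lambda>x. v + x)"
    by (rule density_distr) measurable
  also have "density lborel (\<lambda>x. g (v + x)) = elliptic (\<lambda>r. exp_phi \<phi> (l - c * r)) V"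
    by (simp add: elliptic_def g_def)
  finally show ?thesis .
qed

theorem phi_exponential_exists:
  assumes \<phi>: "\<phi> \<in> O_class (2 / (real CARD('n) + 2))"
  shows "\<exists>l c. \<forall>(v :: real ^ 'n) (V :: real ^ 'n ^ 'n). V \<in> spd \<longrightarrow>
     prob_space (phi_measure \<phi> l c v V) \<and> has_mean_cov (phi_measure \<phi> l c v V) v V"
proof -
  obtain \<delta> C s\<^sub>0 where "admissible_deformation \<phi> (real CARD('n) / 2) \<delta> C s\<^sub>0"
    using O_class_admissible[OF \<phi>] by auto
  then interpret admissible_deformation \<phi> "real CARD('n) / 2" \<delta> C s\<^sub>0 .
  define \<kappa> where "\<kappa> = pi powr (real CARD('n) / 2) / Gamma (real CARD('n) / 2)"
  have "0 < \<kappa>" by (simp add: \<kappa>_def Gamma_real_pos)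
  then obtain l c where lc: "ennreal \<kappa> * radial_moment (\<lambda>r. exp_phi \<phi> (l - c * r)) (real CARD('n) / 2) = 1"
     "ennreal \<kappa> * radial_moment (\<lambda>r. exp_phi \<phi> (l - c * r)) (real CARD('n) / 2 + 1) = ennreal (real CARD('n))"
    using exp_phi_profile_exists[of \<kappa>] by auto
  define f where "f r = exp_phi \<phi> (l - c * r)" for r
  have [measurable]: "f \<in> borel_measurable borel" unfolding f_def by measurable
  interpret standard_elliptic f "elliptic f (mat 1) :: (real ^ 'n) measure"
  proof
    show "(\<integral>\<^sup>+ (x :: real ^ 'n). f (x \<bullet> x) \<partial>lborel) = 1"
      using lc(1) by (subst nn_integral_radial_mass) (simp_all add: \<kappa>_def f_def[abs_def])
    show "(\<integral>\<^sup>+ (x :: real ^ 'n). f (x \<bullet> x) * ennreal (x \<bullet> x) \<partial>lborel) = ennreal (real CARD('n))"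
      using lc(2) by (subst nn_integral_radial_square) (simp_all add: \<kappa>_def f_def[abs_def])
  qed simp_all
  have "prob_space (phi_measure \<phi> l c v V) \<and> has_mean_cov (phi_measure \<phi> l c v V) v V"
    if V: "V \<in> spd" for v and V :: "real ^ 'n ^ 'n"
  proof -
    define S where "S = spd_sqrt V"
    have S: "S ** transpose S = V" using spd_sqrt[OF V] by (simp add: S_def spd_def)
    have "phi_measure \<phi> l c v V = distr (elliptic f V) borel (\<lambda>x. v + x)"
      by (simp add: phi_measure_eq_distr_elliptic f_def[abs_def])
    also have "elliptic f V = distr (elliptic f (mat 1)) borel ((*v) S)"
      unfolding S_def by (rule elliptic_eq_distr_mat_1[OF _ V]) measurable
    also have "distr (distr (elliptic f (mat 1)) borel ((*v) S)) borel (\<lambda>x. v + x) =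
        distr (elliptic f (mat 1)) borel (\<lambda>x. v + S *v x)"
      by (subst distr_distr) (auto simp: o_def)
    finally have eq: "phi_measure \<phi> l c v V = distr (elliptic f (mat 1)) borel (\<lambda>x. v + S *v x)" .
    show ?thesis
      unfolding eq using has_mean_cov_affine_image[of v S] prob_space_distr[of "\<lambda>x. v + S *v x" borel]
      by (simp add: S)
  qed
  then show ?thesis by blast
qed

lemma has_mean_cov_P2:
  fixes \<mu> :: "(real ^ 'n) measure"
  assumes "prob_space \<mu>" "sets \<mu> = sets borel" "has_mean_cov \<mu> 0 V"
  shows "\<mu> \<in> P2"
proof -
  have "integrable \<mu> (\<lambda>x. x $ i * x $ i)" for i
    using assms(3) by (auto simp: has_mean_cov_def has_bochner_integral_iff)
  then have "integrable \<mu> (\<lambda>x. \<Sum>i\<in>UNIV. x $ i * x $ i)" by (intro Bochner_Integration.integrable_sum)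
  then have "integrable \<mu> (\<lambda>x. (norm x)\<^sup>2)" by (simp add: power2_norm_eq_inner inner_vec_def)
  then show ?thesis using assms by (simp add: P2_def)
qed

text \<open>The chosen pair has the defining property because some pair has it; this property already implies
  that the measures are elliptic probability measures with finite second moment.\<close>
lemma phi_exponential_elliptic:
  assumes \<phi>: "\<phi> \<in> O_class (2 / (real CARD('n) + 2))"
  obtains f where "f \<in> borel_measurable borel"
    "\<And>V :: real ^ 'n ^ 'n. phi_exponential \<phi> 0 V = elliptic f V"
    "\<And>V :: real ^ 'n ^ 'n. V \<in> spd \<Longrightarrow> phi_exponential \<phi> 0 V \<in> P2"
proof -
  obtain \<delta> C s\<^sub>0 where "admissible_deformation \<phi> (real CARD('n) / 2) \<delta> C s\<^sub>0"
    using O_class_admissible[OF \<phi>] by auto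
  then interpret admissible_deformation \<phi> "real CARD('n) / 2" \<delta> C s\<^sub>0 .
  define l where "l = fst (phi_consts TYPE('n) \<phi>)"
  define c where "c = snd (phi_consts TYPE('n) \<phi>)"
  have "\<exists>p. case p of (l, c) \<Rightarrow> \<forall>(v :: real ^ 'n) (V :: real ^ 'n ^ 'n). V \<in> spd \<longrightarrow>
     prob_space (phi_measure \<phi> l c v V) \<and> has_mean_cov (phi_measure \<phi> l c v V) v V"
    using phi_exponential_exists[OF \<phi>] by auto
  from someI_ex[OF this] have "case phi_consts TYPE('n) \<phi> of (l, c) \<Rightarrow> \<forall>(v :: real ^ 'n) (V :: real ^ 'n ^ 'n). V \<in> spd \<longrightarrow>
     prob_space (phi_measure \<phi> l c v V) \<and> has_mean_cov (phi_measure \<phi> l c v V) v V"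
    unfolding phi_consts_def .
  then have lc: "\<forall>(v :: real ^ 'n) (V :: real ^ 'n ^ 'n). V \<in> spd \<longrightarrow>
     prob_space (phi_measure \<phi> l c v V) \<and> has_mean_cov (phi_measure \<phi> l c v V) v V"
    unfolding l_def c_def by (simp add: case_prod_beta)
  have eq: "phi_exponential \<phi> 0 V = phi_measure \<phi> l c 0 V" for V :: "real ^ 'n ^ 'n"
    by (simp add: phi_exponential_def l_def c_def)
  show ?thesis
  proof (rule that[of "\<lambda>r. exp_phi \<phi> (l - c * r)"])
    show "(\<lambda>r. exp_phi \<phi> (l - c * r)) \<in> borel_measurable borel" by measurable
    show "phi_exponential \<phi> 0 V = elliptic (\<lambda>r. exp_phi \<phi> (l - c * r)) V" for V :: "real ^ 'n ^ 'n"
      by (simp add: eq phi_measure_def elliptic_def)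
    show "phi_exponential \<phi> 0 V \<in> P2" if "V \<in> spd" for V :: "real ^ 'n ^ 'n"
    proof -
      have "sets (phi_measure \<phi> l c 0 V) = sets borel" by (simp add: phi_measure_def)
      then show ?thesis using lc that unfolding eq by (intro has_mean_cov_P2[of _ V]) auto
    qed
  qed
qed

section \<open>Minimizers of the barycenter problems\<close>

lemma m_const_nonneg:
  assumes "0 < q" "q < (real d + 4) / (real d + 2)"
  shows "0 \<le> m_const q d"
  using q_range[OF assms] C0_pos[OF assms] by (auto simp: m_const_def algebra_simps intro!: divide_nonneg_pos mult_nonneg_nonneg)

theorem theorem1p1:
  fixes n :: nat and w :: "nat \<Rightarrow> real" and A :: "nat \<Rightarrow> real ^ 'n ^ 'n"
  assumes "n \<ge> 1"
    and "\<And>i. i \<in> {1..n} \<Longrightarrow> w i \<ge> 0"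
    and "(\<Sum>i = 1..n. w i) = 1"
    and "\<And>i. i \<in> {1..n} \<Longrightarrow> A i \<in> spd"
  shows
    "(\<forall>(q::real) (\<gamma>::real) (\<mu>s :: nat \<Rightarrow> (real ^ 'n) measure).
        0 < q \<and> q < (real CARD('n) + 4) / (real CARD('n) + 2) \<and> \<gamma> \<ge> 0 \<and>
        (\<forall>i\<in>{1..n}. \<mu>s i = q_gaussian q 0 (A i)) \<longrightarrow>
        (\<exists>!\<mu>. is_arg_min (regularized_cost n w \<mu>s q \<gamma>) (\<lambda>\<nu>. \<nu> \<in> P2) \<mu>) \<and>
        (\<exists>X\<in>spd.
           is_arg_min (regularized_cost n w \<mu>s q \<gamma>) (\<lambda>\<nu>. \<nu> \<in> P2) (q_gaussian q 0 X) \<and>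
           X - (\<gamma> * m_const q CARD('n) * det X powr ((q - 1) / 2)) *\<^sub>R mat 1
             = (\<Sum>i = 1..n. w i *\<^sub>R spd_sqrt (spd_sqrt X ** A i ** spd_sqrt X))))
     \<and>
     (\<forall>(\<phi> :: real \<Rightarrow> real) (\<mu>s :: nat \<Rightarrow> (real ^ 'n) measure).
        \<phi> \<in> O_class (2 / (real CARD('n) + 2)) \<and>
        (\<forall>i\<in>{1..n}. \<mu>s i = phi_exponential \<phi> 0 (A i)) \<longrightarrow>
        (\<exists>!\<mu>. is_arg_min (barycenter_cost n w \<mu>s) (\<lambda>\<nu>. \<nu> \<in> P2) \<mu>) \<and>
        (\<exists>X\<in>spd.
           is_arg_min (barycenter_cost n w \<mu>s) (\<lambda>\<nu>. \<nu> \<in> P2) (phi_exponential \<phi> 0 X) \<and>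
           X = (\<Sum>i = 1..n. w i *\<^sub>R spd_sqrt (spd_sqrt X ** A i ** spd_sqrt X))))"
proof (intro conjI allI impI; elim conjE)
  fix q \<gamma> :: real and \<mu>s :: "nat \<Rightarrow> (real ^ 'n) measure"
  assume q: "0 < q" "q < (real CARD('n) + 4) / (real CARD('n) + 2)" and \<gamma>: "0 \<le> \<gamma>"
    and \<mu>s: "\<forall>i\<in>{1..n}. \<mu>s i = q_gaussian q 0 (A i)"
  define p where "p = (q - 1) / 2"
  have "p * real CARD('n) < 1"
  proof (cases "q \<le> 1")
    case True
    then have "p * real CARD('n) \<le> 0" by (intro mult_nonpos_nonneg) (auto simp: p_def)
    then show ?thesis by simp
  next
    case False
    then show ?thesis using q_range(1)[OF q] by (simp add: p_def distrib_left)
  qed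
  moreover have "0 \<le> \<gamma> * m_const q CARD('n)" using \<gamma> m_const_nonneg[OF q] by simp
  ultimately obtain X where X: "X \<in> spd"
    and "X = (\<Sum>i = 1..n. w i *\<^sub>R spd_sqrt (spd_sqrt X ** A i ** spd_sqrt X))
      + (\<gamma> * m_const q CARD('n) * det X powr p) *\<^sub>R mat 1"
    using spd_fixed_point[of "{1..n}" w A "\<gamma> * m_const q CARD('n)" p] assms by auto
  then have eq: "X - (\<gamma> * m_const q CARD('n) * det X powr p) *\<^sub>R mat 1 =
      (\<Sum>i = 1..n. w i *\<^sub>R spd_sqrt (spd_sqrt X ** A i ** spd_sqrt X))"
    by (simp only: diff_eq_eq)
  let ?K = "(m_const q CARD('n) * det X powr p) *\<^sub>R matrix_inv X"
  let ?\<mu> = "q_gaussian q 0 X"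
  obtain T where maps: "\<forall>i\<in>{1..n}. T i \<in> spd \<and> T i ** X ** T i = A i"
    and sumT: "(\<Sum>i = 1..n. w i *\<^sub>R T i) = mat 1 - (\<gamma> * m_const q CARD('n) * det X powr p) *\<^sub>R matrix_inv X"
    using spd_transport_maps[OF X assms(4) eq] by blast
  have T: "T i \<in> spd" "T i ** X ** T i = A i" if "i \<in> {1..n}" for i using maps that by auto
  have sumT': "(\<Sum>i = 1..n. w i *\<^sub>R T i) = mat 1 - \<gamma> *\<^sub>R ?K"
    using sumT by (simp only: scaleR_scaleR mult.assoc)
  have image: "\<mu>s i = distr ?\<mu> borel ((*v) (T i))" if "i \<in> {1..n}" for i
    using \<mu>s that distr_q_gaussian[OF q X T(1)[OF that]] T(2)[OF that] by simp
  obtain e where e: "tsallis_entropy q ?\<mu> = ereal e"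
    and ge: "\<And>\<nu>. \<nu> \<in> P2 \<Longrightarrow> ereal (e + (\<integral>x. x \<bullet> (?K *v x) \<partial>?\<mu>) / 2 - (\<integral>x. x \<bullet> (?K *v x) \<partial>\<nu>) / 2) \<le> tsallis_entropy q \<nu>"
    using q_gaussian_entropy[OF q X] unfolding p_def by blast
  have \<gamma>K: "x \<bullet> ((\<gamma> *\<^sub>R ?K) *v x) = \<gamma> * (x \<bullet> (?K *v x))" for x
    by (simp add: scaleR_matrix_vector)
  have "ereal (\<gamma> * e + (\<integral>x. x \<bullet> ((\<gamma> *\<^sub>R ?K) *v x) \<partial>?\<mu>) / 2 - (\<integral>x. x \<bullet> ((\<gamma> *\<^sub>R ?K) *v x) \<partial>\<nu>) / 2) \<le> ereal \<gamma> * tsallis_entropy q \<nu>"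
    if "\<nu> \<in> P2" for \<nu>
    using ereal_mult_left_mono[OF ge[OF that], of "ereal \<gamma>"] \<gamma> unfolding \<gamma>K by (simp add: algebra_simps)
  note opt = linear_transport_barycenter[where E = "\<lambda>\<nu>. ereal \<gamma> * tsallis_entropy q \<nu>" and K = "\<gamma> *\<^sub>R ?K" and e = "\<gamma> * e",
      OF q_gaussian_P2[OF q X] assms(2,3) T(1) image sumT' _ this]
  have cost: "regularized_cost n w \<mu>s q \<gamma> = (\<lambda>\<nu>. barycenter_cost n w \<mu>s \<nu> + ereal \<gamma> * tsallis_entropy q \<nu>)"
    by (simp add: regularized_cost_def fun_eq_iff)
  have min: "is_arg_min (regularized_cost n w \<mu>s q \<gamma>) (\<lambda>\<nu>. \<nu> \<in> P2) ?\<mu>"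
    unfolding cost by (rule opt(1)) (simp_all add: e)
  moreover have "\<nu> = ?\<mu>" if "is_arg_min (regularized_cost n w \<mu>s q \<gamma>) (\<lambda>\<nu>. \<nu> \<in> P2) \<nu>" for \<nu>
    using that unfolding cost by (intro opt(2)) (simp_all add: e)
  ultimately show "\<exists>!\<mu>. is_arg_min (regularized_cost n w \<mu>s q \<gamma>) (\<lambda>\<nu>. \<nu> \<in> P2) \<mu>" by blast
  show "\<exists>X\<in>spd. is_arg_min (regularized_cost n w \<mu>s q \<gamma>) (\<lambda>\<nu>. \<nu> \<in> P2) (q_gaussian q 0 X) \<and>
           X - (\<gamma> * m_const q CARD('n) * det X powr ((q - 1) / 2)) *\<^sub>R mat 1
             = (\<Sum>i = 1..n. w i *\<^sub>R spd_sqrt (spd_sqrt X ** A i ** spd_sqrt X))"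
    using X min eq unfolding p_def by blast
next
  fix \<phi> :: "real \<Rightarrow> real" and \<mu>s :: "nat \<Rightarrow> (real ^ 'n) measure"
  assume \<phi>: "\<phi> \<in> O_class (2 / (real CARD('n) + 2))" and \<mu>s: "\<forall>i\<in>{1..n}. \<mu>s i = phi_exponential \<phi> 0 (A i)"
  obtain f where f: "f \<in> borel_measurable borel" "\<And>V :: real ^ 'n ^ 'n. phi_exponential \<phi> 0 V = elliptic f V"
    and P2: "\<And>V :: real ^ 'n ^ 'n. V \<in> spd \<Longrightarrow> phi_exponential \<phi> 0 V \<in> P2"
    using phi_exponential_elliptic[OF \<phi>] by metis
  obtain X where X: "X \<in> spd" and eq: "X = (\<Sum>i = 1..n. w i *\<^sub>R spd_sqrt (spd_sqrt X ** A i ** spd_sqrt X))"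
    using spd_fixed_point[of "{1..n}" w A 0 0] assms by auto
  have eq0: "X - 0 *\<^sub>R mat 1 = (\<Sum>i = 1..n. w i *\<^sub>R spd_sqrt (spd_sqrt X ** A i ** spd_sqrt X))"
    unfolding scaleR_zero_left diff_zero by (rule eq)
  obtain T where maps: "\<forall>i\<in>{1..n}. T i \<in> spd \<and> T i ** X ** T i = A i"
    and sumT: "(\<Sum>i = 1..n. w i *\<^sub>R T i) = mat 1 - 0 *\<^sub>R matrix_inv X"
    using spd_transport_maps[OF X assms(4) eq0] by blast
  have T: "T i \<in> spd" "T i ** X ** T i = A i" if "i \<in> {1..n}" for i using maps that by auto
  let ?\<mu> = "phi_exponential \<phi> 0 X"
  have image: "\<mu>s i = distr ?\<mu> borel ((*v) (T i))" if "i \<in> {1..n}" for i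
    using \<mu>s that distr_elliptic_spd[OF f(1) X T(1)[OF that]] T(2)[OF that] f(2) by simp
  have sumT': "(\<Sum>i = 1..n. w i *\<^sub>R T i) = mat 1 - 0"
    using sumT by (simp only: scaleR_zero_left)
  note opt = linear_transport_barycenter[where E = "\<lambda>_. 0" and K = 0 and e = 0,
      OF P2[OF X] assms(2,3) T(1) image sumT']
  have min: "is_arg_min (barycenter_cost n w \<mu>s) (\<lambda>\<nu>. \<nu> \<in> P2) ?\<mu>"
    using opt(1) by simp
  moreover have "\<nu> = ?\<mu>" if "is_arg_min (barycenter_cost n w \<mu>s) (\<lambda>\<nu>. \<nu> \<in> P2) \<nu>" for \<nu>
    using opt(2)[of \<nu>] that by simp
  ultimately show "\<exists>!\<mu>. is_arg_min (barycenter_cost n w \<mu>s) (\<lambda>\<nu>. \<nu> \<in> P2) \<mu>" by blast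
  show "\<exists>X\<in>spd. is_arg_min (barycenter_cost n w \<mu>s) (\<lambda>\<nu>. \<nu> \<in> P2) (phi_exponential \<phi> 0 X) \<and>
           X = (\<Sum>i = 1..n. w i *\<^sub>R spd_sqrt (spd_sqrt X ** A i ** spd_sqrt X))"
    using X min eq by blast
qed

end
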